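(* Let $(w_j)_{j\in\mathbb{Z}}$ be the configurations of the $\frac12$-discrete sine process on $\frac12\mathbb{Z}$, and let $\omega$ be a random variable uniformly distributed on $[0,\frac12)$, independent of this process. Then the point process on $\mathbb{R}$ with configurations $(\tilde w_j):=(w_j-\omega)$ is simple, is invariant under translations by all real numbers, and satisfies, for all $n\ge1$ and all $\eta\in\mathcal{K}_n$, $$\mathbb{E}\sum_{\substack{j_1,\dots,j_n\in\mathbb{Z}\\ \text{distinct}}}\eta(\tilde w_{j_1},\dots,\tilde w_{j_n})=\int_{\mathbb{R}^n}\eta(x_1,\dots,x_n)\det_{1\le i,j\le n}\big[S(x_i-x_j)\big]\,d^nx.$$ Moreover, any two points of any realized configuration $(\tilde w_j)$ are separated by a distance belonging to $\{\tfrac12,1,\tfrac32,\dots\}$.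
   Context: $S(x)=\frac{\sin\pi x}{\pi x}$ for $x\ne0$, $S(0)=1$. $\hat\eta(\xi)=\int_{\mathbb{R}^n}\eta(x)e^{-2\pi i x\cdot\xi}\,d^nx$. $\mathcal{K}_n$ is the set of $\eta\in\mathcal{S}(\mathbb{R}^n)$ with $\operatorname{supp}\hat\eta\subset\{\xi\in\mathbb{R}^n:\ \xi_1+\cdots+\xi_n\ne0\ \text{ or }\ |\xi_1|+\cdots+|\xi_n|<2\}$. A point process is a random locally finite configuration of points; it is simple if almost surely all its points are distinct, and translation invariant if every translate of the random configuration has the same distribution. The $\frac12$-discrete sine process is the point process supported on $\frac12\mathbb{Z}$ satisfying, for all $n\ge1$ and $\varphi\in C_c(\mathbb{R}^n)$, $\mathbb{E}\sum_{j_1,\dots,j_n\ \text{distinct}}\varphi(w_{j_1},\dots,w_{j_n})=(\tfrac12)^n\sum_{k\in(\frac12\mathbb{Z})^n}\varphi(k)\det_{1\le i,j\le n}[S(k_i-k_j)]$; it exists and is uniquely determined by these correlation functions. *)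

theory Defs
  imports "HOL-Probability.Probability" "Jordan_Normal_Form.Determinant"
begin

text \<open>
  Since the dimension \<open>n\<close> is quantified inside hypotheses and conclusions, a point of \<open>\<real>\<^sup>n\<close> is an
  extensional function on \<open>{..<n}\<close>.  Its topology is \<open>powertop_real {..<n}\<close> and its Lebesgue
  measure is \<open>\<Pi>\<^sub>M i\<in>{..<n}. lborel\<close>.
\<close>

abbreviation Rn :: "nat \<Rightarrow> (nat \<Rightarrow> real) set" where
  "Rn n \<equiv> {..<n} \<rightarrow>\<^sub>E UNIV"

abbreviation lborel_n :: "nat \<Rightarrow> (nat \<Rightarrow> real) measure" where
  "lborel_n n \<equiv> \<Pi>\<^sub>M i\<in>{..<n}. lborel"

definition support_n :: "nat \<Rightarrow> ((nat \<Rightarrow> real) \<Rightarrow> complex) \<Rightarrow> (nat \<Rightarrow> real) set" where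
  "support_n n f = (powertop_real {..<n}) closure_of {x \<in> Rn n. f x \<noteq> 0}"

definition C_c :: "nat \<Rightarrow> ((nat \<Rightarrow> real) \<Rightarrow> complex) set" where
  "C_c n = {f. continuous_map (powertop_real {..<n}) euclidean f \<and>
               compactin (powertop_real {..<n}) (support_n n f)}"

definition partial_deriv ::
    "nat \<Rightarrow> ((nat \<Rightarrow> real) \<Rightarrow> complex) \<Rightarrow> (nat \<Rightarrow> real) \<Rightarrow> complex" where
  "partial_deriv i f x = vector_derivative (\<lambda>t. f (x(i := t))) (at (x i))"

text \<open>
  Iterated partial derivatives are indexed by the list of the coordinates of differentiation.
  Values of a function outside \<open>Rn n\<close> are irrelevant.
\<close>

definition schwartz :: "nat \<Rightarrow> ((nat \<Rightarrow> real) \<Rightarrow> complex) set" where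
  "schwartz n = {f. \<forall>is. set is \<subseteq> {..<n} \<longrightarrow>
     continuous_map (powertop_real {..<n}) euclidean (foldr partial_deriv is f) \<and>
     (\<forall>x\<in>Rn n. \<forall>i<n. (\<lambda>t. foldr partial_deriv is f (x(i := t))) differentiable (at (x i))) \<and>
     (\<forall>\<alpha> :: nat \<Rightarrow> nat.
        bounded ((\<lambda>x. (\<Prod>i<n. x i ^ \<alpha> i) *\<^sub>R foldr partial_deriv is f x) ` Rn n))}"

definition fourier_n ::
    "nat \<Rightarrow> ((nat \<Rightarrow> real) \<Rightarrow> complex) \<Rightarrow> (nat \<Rightarrow> real) \<Rightarrow> complex" where
  "fourier_n n f \<xi> =
     (LINT x|lborel_n n. f x * exp (- 2 * of_real pi * \<i> * of_real (\<Sum>i<n. x i * \<xi> i)))"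

definition K_class :: "nat \<Rightarrow> ((nat \<Rightarrow> real) \<Rightarrow> complex) set" where
  "K_class n = {\<eta> \<in> schwartz n.
     support_n n (fourier_n n \<eta>) \<subseteq>
       {\<xi> \<in> Rn n. (\<Sum>i<n. \<xi> i) \<noteq> 0 \<or> (\<Sum>i<n. \<bar>\<xi> i\<bar>) < 2}}"

definition S_kernel :: "real \<Rightarrow> real" where
  "S_kernel x = (if x = 0 then 1 else sin (pi * x) / (pi * x))"

definition sine_det :: "nat \<Rightarrow> (nat \<Rightarrow> real) \<Rightarrow> real" where
  "sine_det n x = Determinant.det (Matrix.mat n n (\<lambda>(i, j). S_kernel (x i - x j)))"

text \<open>
  A random configuration is a family of points labelled by \<open>\<int>\<close>, in which points may coincide.
  The labelling itself need not be measurable: the process is observed only through the numbers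
  of points in bounded Borel sets, which generate the usual \<open>\<sigma>\<close>-algebra on configurations.
\<close>

definition bounded_borel :: "real set set" where
  "bounded_borel = {B \<in> sets borel. bounded B}"

definition config_space :: "(real set \<Rightarrow> nat) measure" where
  "config_space = (\<Pi>\<^sub>M B\<in>bounded_borel. count_space UNIV)"

definition counts :: "(int \<Rightarrow> 'a \<Rightarrow> real) \<Rightarrow> 'a \<Rightarrow> real set \<Rightarrow> nat" where
  "counts w \<omega> = (\<lambda>B\<in>bounded_borel. card {j. w j \<omega> \<in> B})"

definition point_process :: "'a measure \<Rightarrow> (int \<Rightarrow> 'a \<Rightarrow> real) \<Rightarrow> bool" where
  "point_process M w \<longleftrightarrow>
     (\<forall>\<omega>\<in>space M. \<forall>B. bounded B \<longrightarrow> finite {j. w j \<omega> \<in> B}) \<and>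
     counts w \<in> measurable M config_space"

definition simple_process :: "'a measure \<Rightarrow> (int \<Rightarrow> 'a \<Rightarrow> real) \<Rightarrow> bool" where
  "simple_process M w \<longleftrightarrow> (AE \<omega> in M. inj (\<lambda>j. w j \<omega>))"

definition config_law :: "'a measure \<Rightarrow> (int \<Rightarrow> 'a \<Rightarrow> real) \<Rightarrow> (real set \<Rightarrow> nat) measure" where
  "config_law M w = distr M config_space (counts w)"

definition translation_invariant :: "'a measure \<Rightarrow> (int \<Rightarrow> 'a \<Rightarrow> real) \<Rightarrow> bool" where
  "translation_invariant M w \<longleftrightarrow>
     (\<forall>t::real. config_law M (\<lambda>j \<omega>. w j \<omega> + t) = config_law M w)"

definition distinct_tuples :: "nat \<Rightarrow> (nat \<Rightarrow> int) set" where
  "distinct_tuples n = {js \<in> {..<n} \<rightarrow>\<^sub>E UNIV. inj_on js {..<n}}"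

definition point_tuple ::
    "nat \<Rightarrow> (int \<Rightarrow> 'a \<Rightarrow> real) \<Rightarrow> 'a \<Rightarrow> (nat \<Rightarrow> int) \<Rightarrow> nat \<Rightarrow> real" where
  "point_tuple n w \<omega> js = (\<lambda>i\<in>{..<n}. w (js i) \<omega>)"

definition half_ints :: "real set" where
  "half_ints = range (\<lambda>m::int. of_int m / 2)"

text \<open>
  \<open>has_bochner_integral\<close> records that the expectations exist.  The sums over tuples here are
  effectively finite, as \<open>\<phi>\<close> has compact support and the configurations are locally finite.
\<close>

definition half_discrete_sine_process :: "'a measure \<Rightarrow> (int \<Rightarrow> 'a \<Rightarrow> real) \<Rightarrow> bool" where
  "half_discrete_sine_process M w \<longleftrightarrow>
     point_process M w \<and>
     (\<forall>\<omega>\<in>space M. \<forall>j. w j \<omega> \<in> half_ints) \<and>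
     (\<forall>n\<ge>1. \<forall>\<phi>\<in>C_c n.
        has_bochner_integral M
          (\<lambda>\<omega>. \<Sum>\<^sub>\<infinity>js\<in>distinct_tuples n. \<phi> (point_tuple n w \<omega> js))
          ((1/2) ^ n * (\<Sum>\<^sub>\<infinity>k\<in>{..<n} \<rightarrow>\<^sub>E half_ints. \<phi> k * of_real (sine_det n k))))"

end

theory Submission
  imports Defs "HOL-Real_Asymp.Real_Asymp"
begin

text \<open>
  For \<open>f = \<eta> \<cdot> det S\<close>, conditioning on \<open>\<omega>\<close> turns the left-hand side into the average over
  \<open>u \<in> [0, 1/2)\<close> of \<open>2\<^sup>-\<^sup>n \<Sum> f (k/2 - u)\<close>, summed over \<open>k \<in> \<int>\<^sup>n\<close>.  By Poisson summation this is the
  sum of the Fourier coefficients of \<open>f\<close> over \<open>(2\<int>)\<^sup>n\<close>; averaging over \<open>u\<close> kills every frequency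
  \<open>2m\<close> with \<open>\<Sum> m\<^sub>i \<noteq> 0\<close>.  For \<open>m \<noteq> 0\<close> with \<open>\<Sum> m\<^sub>i = 0\<close>, write \<open>S\<close> as the Fourier transform of the
  indicator of \<open>[-1/2, 1/2]\<close>: each term of the determinant shifts \<open>2m\<close> by a vector
  \<open>t - t \<circ> \<sigma>\<^sup>-\<^sup>1\<close> with entries in \<open>[-1, 1]\<close> and sum \<open>0\<close>, and since \<open>m\<close> has at least two nonzero entries
  the result has \<open>\<ell>\<^sup>1\<close>-norm at least \<open>2\<close>, where the transform of \<open>\<eta>\<close> vanishes.  Only the frequency
  \<open>0\<close> survives, and it gives the right-hand side.

  Poisson summation is needed only for continuous functions with integrable decay all of whose
  nonzero frequencies vanish; testing against Fejer kernels then proves it directly, without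
  Fourier inversion.

  The law of the discrete process is determined by its correlations, because the configurations
  are almost surely simple and the events that all sites of a finite set are occupied form a
  \<open>\<pi>\<close>-system.  So it is invariant under half-integer shifts, and the uniform \<open>\<omega>\<close> upgrades this to
  invariance under all real shifts.
\<close>

section \<open>Sums and integrals over lattices\<close>

text \<open>Two obstacles shape the probabilistic half. The correlation identity is available only
  for compactly supported test functions, whereas a function in \<open>K_class n\<close> merely
  decays; and the labelling of the points is not assumed measurable. Both are met by regrouping
  label tuples by the sites they occupy: tent functions at single sites extract the expected number
  of labellings of each site tuple, together with its measurability, and the summability of
  \<open>decay\<close> over the lattice reassembles the sum. Independence is assumed only between
  the counts and \<open>U\<close>, so almost sure simplicity is used to express the number of
  labellings through the counts.

  On the analytic side the spacing 1/2 leaves no slack: a nonzero entry of \<open>2 m\<close> has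
  modulus at least 2 and loses at most 1 to the kernel, and the total 2 that remains is excluded
  only because the inequality in \<open>K_class\<close> is strict.\<close>

lemma integrable_count_space_iff:
  fixes f :: "'k \<Rightarrow> 'b::{banach, second_countable_topology}"
  shows "integrable (count_space K) f \<longleftrightarrow> (\<lambda>k. norm (f k)) summable_on K"
  by (simp add: abs_summable_equivalent abs_summable_on_def[symmetric])

text \<open>Complex families are summable exactly when they are absolutely summable, so both sides
  fall back to 0 at the same time.\<close>

lemma integral_count_space_eq_infsum:
  fixes f :: "'k \<Rightarrow> complex"
  shows "(LINT k|count_space K. f k) = (\<Sum>\<^sub>\<infinity>k\<in>K. f k)"
proof (cases "integrable (count_space K) f")
  case True
  then show ?thesis
    using infsetsum_infsum[of f K] by (simp add: infsetsum_def abs_summable_on_def)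
next
  case False
  then have "\<not> f summable_on K"
    by (simp add: integrable_count_space_iff summable_on_iff_abs_summable_on_complex)
  then show ?thesis using False by (simp add: not_integrable_integral_eq infsum_not_exists)
qed

text \<open>Dominated convergence for the counting measure on \<open>K\<close>.\<close>

lemma tendsto_infsum_dominated:
  fixes a :: "nat \<Rightarrow> 'k \<Rightarrow> complex"
  assumes "b summable_on K" and "\<And>N k. k \<in> K \<Longrightarrow> norm (a N k) \<le> b k"
    and "\<And>k. k \<in> K \<Longrightarrow> (\<lambda>N. a N k) \<longlonglongrightarrow> l k"
  shows "(\<lambda>N. \<Sum>\<^sub>\<infinity>k\<in>K. a N k) \<longlonglongrightarrow> (\<Sum>\<^sub>\<infinity>k\<in>K. l k)"
proof -
  have "b k \<ge> 0" if "k \<in> K" for k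
    using assms(2)[OF that, of 0] norm_ge_zero order_trans by blast
  then have "integrable (count_space K) b"
    using assms(1) by (simp add: integrable_count_space_iff cong: summable_on_cong)
  then have "(\<lambda>N. LINT k|count_space K. a N k) \<longlonglongrightarrow> (LINT k|count_space K. l k)"
    using assms(2,3) by (intro integral_dominated_convergence[where w = b]) (auto simp: AE_count_space)
  then show ?thesis by (simp add: integral_count_space_eq_infsum)
qed

text \<open>Fubini for the product of the counting measure on \<open>K\<close> with
  \<open>M\<close>. Countability of \<open>K\<close> makes the counting measure sigma-finite and
  reduces joint measurability to that of each \<open>g k\<close>.\<close>

lemma has_bochner_integral_infsum:
  fixes g :: "'k \<Rightarrow> 'a \<Rightarrow> complex"
  assumes K: "countable K" and "sigma_finite_measure M"
    and g: "\<And>k. k \<in> K \<Longrightarrow> integrable M (g k)"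
    and s: "(\<lambda>k. LINT x|M. norm (g k x)) summable_on K"
  shows "AE x in M. (\<lambda>k. norm (g k x)) summable_on K"
    and "has_bochner_integral M (\<lambda>x. \<Sum>\<^sub>\<infinity>k\<in>K. g k x) (\<Sum>\<^sub>\<infinity>k\<in>K. LINT x|M. g k x)"
proof -
  interpret M: sigma_finite_measure M by fact
  interpret C: sigma_finite_measure "count_space K"
    using K by (rule sigma_finite_measure_count_space_countable)
  interpret pair_sigma_finite "count_space K" M ..
  have meas: "(\<lambda>(k, x). g k x) \<in> borel_measurable (count_space K \<Otimes>\<^sub>M M)"
    using g by (intro measurable_pair_measure_countable1[OF K]) auto
  have int: "integrable (count_space K \<Otimes>\<^sub>M M) (\<lambda>(k, x). g k x)"
  proof (rule Fubini_integrable[OF meas])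
    show "integrable (count_space K) (\<lambda>x. LINT y|M. norm (case (x, y) of (k, x) \<Rightarrow> g k x))"
      using s by (simp add: integrable_count_space_iff)
    show "AE x in count_space K. integrable M (\<lambda>y. case (x, y) of (k, x) \<Rightarrow> g k x)"
      using g by (simp add: AE_count_space)
  qed
  show "AE x in M. (\<lambda>k. norm (g k x)) summable_on K"
    using AE_integrable_snd[OF int] by (simp add: integrable_count_space_iff)
  show "has_bochner_integral M (\<lambda>x. \<Sum>\<^sub>\<infinity>k\<in>K. g k x) (\<Sum>\<^sub>\<infinity>k\<in>K. LINT x|M. g k x)"
    using integrable_snd[OF int] integral_snd[OF int] integral_fst[OF int]
    by (simp add: has_bochner_integral_iff integral_count_space_eq_infsum)
qed

text \<open>A product rather than a power of a norm, so that sums over lattices and integrals factor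
  into one-dimensional ones.\<close>

definition decay :: "nat \<Rightarrow> (nat \<Rightarrow> real) \<Rightarrow> real" where
  "decay n x = (\<Prod>i<n. inverse (1 + (x i)\<^sup>2))"

abbreviation int_tuples :: "nat \<Rightarrow> (nat \<Rightarrow> int) set" where
  "int_tuples n \<equiv> {..<n} \<rightarrow>\<^sub>E UNIV"

lemma decay_nonneg: "0 \<le> decay n x"
  unfolding decay_def by (intro prod_nonneg) auto

lemma decay_le_1: "decay n x \<le> 1"
  unfolding decay_def by (intro prod_le_1) (auto intro!: inverse_le_1_iff[THEN iffD2])

lemma inverse_square_shift:
  fixes x c :: real
  assumes "\<bar>c\<bar> \<le> 1"
  shows "inverse (1 + (x + c)\<^sup>2) \<le> 3 * inverse (1 + x\<^sup>2)"
proof -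
  have "c\<^sup>2 \<le> 1" using assms by (simp add: abs_square_le_1)
  \<comment> \<open>\<open>3 * (1 + (x + c)\<^sup>2) - (1 + x\<^sup>2)\<close> is this sum of
    squares plus \<open>2 * (1 - c\<^sup>2)\<close>.\<close>
  moreover have "0 \<le> (x + 2 * c)\<^sup>2 + (x + c)\<^sup>2" by simp
  ultimately have "1 + x\<^sup>2 \<le> 3 * (1 + (x + c)\<^sup>2)"
    by (simp add: power2_eq_square algebra_simps)
  then show ?thesis
    by (simp add: field_simps add_pos_nonneg)
qed

text \<open>Serves displacements inside a cell and displacements by the random shift: both have
  coordinates of modulus below 1, so they cost only a constant factor.\<close>

lemma decay_shift:
  assumes "\<And>i. i < n \<Longrightarrow> \<bar>c i\<bar> \<le> 1"
  shows "decay n (\<lambda>i. x i + c i) \<le> 3 ^ n * decay n x"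
proof -
  have "decay n (\<lambda>i. x i + c i) \<le> (\<Prod>i<n. 3 * inverse (1 + (x i)\<^sup>2))"
    unfolding decay_def using assms by (intro prod_mono) (auto intro!: inverse_square_shift)
  then show ?thesis by (simp add: prod.distrib decay_def)
qed

lemma summable_int_inverse_square:
  "(\<lambda>k::int. inverse (1 + (real_of_int k / 2)\<^sup>2)) summable_on UNIV"
proof -
  let ?f = "\<lambda>k::int. inverse (1 + (real_of_int k / 2)\<^sup>2)"
  have nat: "(\<lambda>k::nat. ?f (int k)) summable_on UNIV"
  proof (rule summable_nonneg_imp_summable_on)
    have "summable (\<lambda>k::nat. 4 * inverse (real k ^ 2))"
      by (intro summable_mult inverse_power_summable) auto
    then show "summable (\<lambda>k::nat. ?f (int k))"
    proof (rule summable_comparison_test'[where N = 1])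
      fix k :: nat assume "1 \<le> k"
      then have "inverse (1 + (real k / 2)\<^sup>2) \<le> inverse ((real k / 2)\<^sup>2)"
        by (intro le_imp_inverse_le) auto
      then show "norm (?f (int k)) \<le> 4 * inverse (real k ^ 2)"
        by (simp add: power_divide inverse_eq_divide)
    qed
  qed auto
  have "?f summable_on range int"
    using nat by (subst summable_on_reindex) (auto simp: o_def)
  moreover have "?f summable_on range (\<lambda>n. - int n)"
    using nat by (subst summable_on_reindex) (auto simp: o_def inj_on_def)
  ultimately have "?f summable_on (range int \<union> range (\<lambda>n. - int n))"
    by (rule summable_on_union)
  moreover have "range int \<union> range (\<lambda>n. - int n) = UNIV"
    by (auto intro: int_cases2)
  ultimately show ?thesis by simp
qed

lemma countable_int_tuples: "countable (int_tuples n)"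
  by (rule countable_PiE) auto

lemma decay_summable:
  "(\<lambda>k. decay n (\<lambda>i. real_of_int (k i) / 2)) summable_on int_tuples n"
proof -
  have "Infinite_Set_Sum.abs_summable_on
      (\<lambda>g. \<Prod>x\<in>{..<n}. inverse (1 + (real_of_int (g x) / 2)\<^sup>2)) (int_tuples n)"
    using summable_int_inverse_square
    by (intro abs_summable_on_prod_PiE) (auto simp: abs_summable_equivalent[symmetric])
  then show ?thesis
    by (simp add: abs_summable_equivalent[symmetric] decay_def abs_prod)
qed

section \<open>Lebesgue measure on finite products: integrability, translations,
  measurability\<close>

interpretation lborel_product: product_sigma_finite "\<lambda>_::nat. lborel::real measure"
  by standard

lemma decay_integrable: "integrable (lborel_n n) (decay n)"
proof -
  have "integrable lborel (\<lambda>x::real. inverse (1 + x\<^sup>2))"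
    using integrable_inverse_1_plus_square by (simp add: set_integrable_def einterval_def)
  then show ?thesis
    unfolding decay_def by (intro lborel_product.product_integrable_prod) auto
qed

text \<open>Product measures agree once they agree on boxes, and each factor is translation
  invariant.\<close>

lemma lborel_n_shift:
  "distr (lborel_n n) (lborel_n n) (\<lambda>x. \<lambda>i\<in>{..<n}. x i + c i) = lborel_n n"
proof (rule lborel_product.PiM_eqI)
  fix A :: "nat \<Rightarrow> real set" assume A: "\<And>i. i \<in> {..<n} \<Longrightarrow> A i \<in> sets lborel"
  have A': "(\<lambda>x. x + c i) -` A i \<in> sets borel" if "i < n" for i
    using A[of i] that measurable_sets_borel[of "\<lambda>x. x + c i" borel "A i"] by auto
  have "emeasure (distr (lborel_n n) (lborel_n n) (\<lambda>x. \<lambda>i\<in>{..<n}. x i + c i)) (Pi\<^sub>E {..<n} A)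
     = emeasure (lborel_n n) (Pi\<^sub>E {..<n} (\<lambda>i. (\<lambda>x. x + c i) -` A i))"
    using A A' by (subst emeasure_distr)
       (auto intro!: arg_cong2[where f = emeasure] sets_PiM_I_finite simp: space_PiM PiE_iff)
  also have "\<dots> = (\<Prod>i<n. emeasure lborel ((\<lambda>x. x + c i) -` A i))"
    using A' by (intro lborel_product.emeasure_PiM) auto
  also have "\<dots> = (\<Prod>i<n. emeasure lborel (A i))"
  proof (rule prod.cong)
    fix i assume "i \<in> {..<n}"
    then have "emeasure lborel ((\<lambda>x. x + c i) -` A i) = emeasure (distr lborel borel (\<lambda>x. c i + x)) (A i)"
      using A by (subst emeasure_distr) (auto simp: vimage_def add.commute)
    then show "emeasure lborel ((\<lambda>x. x + c i) -` A i) = emeasure lborel (A i)"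
      by (simp add: lborel_distr_plus)
  qed simp
  finally show "emeasure (distr (lborel_n n) (lborel_n n) (\<lambda>x. \<lambda>i\<in>{..<n}. x i + c i)) (Pi\<^sub>E {..<n} A)
     = (\<Prod>i<n. emeasure lborel (A i))" .
qed auto

text \<open>Arguments such as \<open>\<lambda>i. x i + c i\<close> leave the extensional functions,
  so continuity is taken in the product topology on all of \<open>nat \<Rightarrow> real\<close>,
  whose Borel sets form the product sigma-algebra.\<close>

lemma continuous_measurable_lborel_n:
  fixes F :: "(nat \<Rightarrow> real) \<Rightarrow> 'b::topological_space"
  assumes "continuous_on UNIV F"
  shows "F \<in> borel_measurable (lborel_n n)"
proof -
  have "(\<lambda>x. x) \<in> measurable (lborel_n n) (Pi\<^sub>M UNIV (\<lambda>_. borel))"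
  proof (rule measurable_PiM_single')
    fix i :: nat
    show "(\<lambda>x. x i) \<in> borel_measurable (lborel_n n)"
    proof (cases "i < n")
      \<comment> \<open>Points of the space are extensional, so a coordinate beyond \<open>n\<close>
        is the constant \<open>undefined\<close>.\<close>
      case False
      then have "(\<lambda>x. x i) \<in> borel_measurable (lborel_n n) \<longleftrightarrow> (\<lambda>x. undefined :: real) \<in> borel_measurable (lborel_n n)"
        by (intro measurable_cong) (auto simp: space_PiM PiE_iff extensional_def)
      then show ?thesis by simp
    qed auto
  qed auto
  then have "(\<lambda>x. x) \<in> measurable (lborel_n n) (borel :: (nat \<Rightarrow> real) measure)"
    by (simp add: sets_PiM_equal_borel cong: measurable_cong_sets)
  then show ?thesis
    using borel_measurable_continuous_onI[OF assms] by (rule measurable_compose)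
qed

section \<open>Fejer kernels on the half-integer torus\<close>

text \<open>Half-open, so that half-integer translates tile space without overlap; centred, so that
  the point where the kernels concentrate is interior.\<close>

definition cell :: "nat \<Rightarrow> (nat \<Rightarrow> real) set" where
  "cell n = {..<n} \<rightarrow>\<^sub>E {-(1/4)..<1/4}"

lemma cell_sets [measurable]: "cell n \<in> sets (lborel_n n)"
  unfolding cell_def by (intro sets_PiM_I_finite) auto

lemma indicator_cell:
  "x \<in> Rn n \<Longrightarrow> indicator (cell n) x = (\<Prod>i<n. indicator {-(1/4)..<1/4} (x i) :: 'a::comm_semiring_1)"
proof (cases "x \<in> cell n")
  case False
  moreover assume "x \<in> Rn n"
  ultimately obtain i where "i < n" "x i \<notin> {-(1/4)..<1/4}"
    by (auto simp: cell_def PiE_iff)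
  then have "(\<Prod>i<n. indicator {-(1/4)..<1/4} (x i) :: 'a) = 0"
    by (intro prod_zero) (auto intro!: bexI[of _ i])
  then show ?thesis using False by simp
qed (auto simp: cell_def PiE_iff intro!: prod.neutral[symmetric])

lemma lborel_n_shift_integral:
  fixes F :: "(nat \<Rightarrow> real) \<Rightarrow> 'b::{banach, second_countable_topology}"
  assumes "F \<in> borel_measurable (lborel_n n)"
  shows "(LINT x|lborel_n n. F (\<lambda>i\<in>{..<n}. x i + c i)) = (LINT x|lborel_n n. F x)"
proof -
  have "(\<lambda>x. \<lambda>i\<in>{..<n}. x i + c i) \<in> measurable (lborel_n n) (lborel_n n)"
    by measurable
  from integral_distr[OF this assms] show ?thesis by (simp add: lborel_n_shift)
qed

text \<open>The cell is centred, so the index of the translate containing \<open>x\<close> is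
  \<open>2 * x\<close> rounded to the nearest integer; hence the summand \<open>1/2\<close>.\<close>

lemma floor_cell: "-(1/4) \<le> x - real_of_int k / 2 \<and> x - real_of_int k / 2 < 1/4 \<longleftrightarrow> k = \<lfloor>2 * x + 1/2\<rfloor>"
  by (subst eq_commute, subst floor_eq_iff) auto

text \<open>Each point lies in exactly one translate of the cell, and moving each piece back to the
  origin turns the integral into a sum over cells.\<close>

lemma integral_eq_infsum_cells:
  fixes F :: "(nat \<Rightarrow> real) \<Rightarrow> complex"
  assumes F: "integrable (lborel_n n) F"
  shows "(LINT x|lborel_n n. F x) = (\<Sum>\<^sub>\<infinity>k\<in>int_tuples n.
    LINT y|lborel_n n. indicator (cell n) y * F (\<lambda>i\<in>{..<n}. y i + real_of_int (k i) / 2))"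
proof -
  define g where "g k x = indicator (cell n) (\<lambda>i\<in>{..<n}. x i - real_of_int (k i) / 2) * F x" for k x
  define k0 where "k0 x = (\<lambda>i\<in>{..<n}. \<lfloor>2 * x i + 1/2\<rfloor>)" for x :: "nat \<Rightarrow> real"
  have ind: "indicator (cell n) (\<lambda>i\<in>{..<n}. x i - real_of_int (k i) / 2) =
      (if k = k0 x then 1 else 0 :: complex)" if "k \<in> int_tuples n" for k x
  proof -
    have "(\<lambda>i\<in>{..<n}. x i - real_of_int (k i) / 2) \<in> cell n \<longleftrightarrow> (\<forall>i<n. k i = k0 x i)"
      by (auto simp: cell_def PiE_iff k0_def floor_cell[symmetric])
    also have "\<dots> \<longleftrightarrow> k = k0 x"
      using that by (auto simp: k0_def PiE_iff extensional_def fun_eq_iff restrict_def)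
    finally show ?thesis by (simp add: indicator_def)
  qed
  have [measurable]: "F \<in> borel_measurable (lborel_n n)" using F by auto
  have [measurable]: "g k \<in> borel_measurable (lborel_n n)" for k
    unfolding g_def by measurable
  have gi: "integrable (lborel_n n) (g k)" if "k \<in> int_tuples n" for k
    using F by (rule Bochner_Integration.integrable_bound) (auto simp: g_def indicator_def)
  \<comment> \<open>At most one term is nonzero at each point, so finite sums of the integrals of
    the norms stay below the integral of \<open>norm (F x)\<close>.\<close>
  have sum_le: "(\<Sum>k\<in>X. norm (g k x)) \<le> norm (F x)" if "finite X" "X \<subseteq> int_tuples n" for X x
  proof -
    have "(\<Sum>k\<in>X. norm (g k x)) = (\<Sum>k\<in>X. if k = k0 x then norm (F x) else 0)"
      using that by (intro sum.cong) (auto simp: g_def ind)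
    also have "\<dots> \<le> norm (F x)" using that by (simp add: sum.delta)
    finally show ?thesis .
  qed
  have "(\<lambda>k. LINT x|lborel_n n. norm (g k x)) summable_on int_tuples n"
  proof (rule nonneg_bdd_above_summable_on)
    show "bdd_above (sum (\<lambda>k. LINT x|lborel_n n. norm (g k x)) ` {X. X \<subseteq> int_tuples n \<and> finite X})"
    proof (rule bdd_aboveI2)
      fix X assume X: "X \<in> {X. X \<subseteq> int_tuples n \<and> finite X}"
      then have "(\<Sum>k\<in>X. (LINT x|lborel_n n. norm (g k x))) = (LINT x|lborel_n n. (\<Sum>k\<in>X. norm (g k x)))"
        using gi by (subst Bochner_Integration.integral_sum) auto
      also have "\<dots> \<le> (LINT x|lborel_n n. norm (F x))"
        using X gi F sum_le by (intro integral_mono Bochner_Integration.integrable_sum) auto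
      finally show "(\<Sum>k\<in>X. (LINT x|lborel_n n. norm (g k x))) \<le> (LINT x|lborel_n n. norm (F x))" .
    qed
  qed auto
  then have "(LINT x|lborel_n n. (\<Sum>\<^sub>\<infinity>k\<in>int_tuples n. g k x)) =
      (\<Sum>\<^sub>\<infinity>k\<in>int_tuples n. (LINT x|lborel_n n. g k x))"
    using has_bochner_integral_infsum(2)[OF countable_int_tuples lborel_product.sigma_finite gi]
    by (simp add: has_bochner_integral_iff)
  moreover have "(\<Sum>\<^sub>\<infinity>k\<in>int_tuples n. g k x) = F x" for x
  proof -
    have "(\<Sum>\<^sub>\<infinity>k\<in>int_tuples n. g k x) = g (k0 x) x"
      by (subst infsum_cong_neutral[where T = "{k0 x}" and g = "\<lambda>k. g k x"]) (auto simp: g_def ind k0_def)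
    also have "\<dots> = F x"
    proof -
      have "k0 x \<in> int_tuples n" by (simp add: k0_def)
      from ind[OF this, of x] show ?thesis by (simp add: g_def)
    qed
    finally show ?thesis .
  qed
  moreover have "(LINT x|lborel_n n. g k x) =
      (LINT y|lborel_n n. indicator (cell n) y * F (\<lambda>i\<in>{..<n}. y i + real_of_int (k i) / 2))" for k
  proof -
    have "(LINT x|lborel_n n. g k x) = (LINT x|lborel_n n. g k (\<lambda>i\<in>{..<n}. x i + real_of_int (k i) / 2))"
      by (rule lborel_n_shift_integral[symmetric]) simp
    also have "\<dots> = (LINT y|lborel_n n. indicator (cell n) y * F (\<lambda>i\<in>{..<n}. y i + real_of_int (k i) / 2))"
    proof (rule Bochner_Integration.integral_cong)
      fix y assume "y \<in> space (lborel_n n)"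
      then have "(\<lambda>i\<in>{..<n}. y i) = y"
        by (auto simp: space_PiM PiE_iff extensional_def fun_eq_iff restrict_def)
      then show "g k (\<lambda>i\<in>{..<n}. y i + real_of_int (k i) / 2) =
        indicator (cell n) y * F (\<lambda>i\<in>{..<n}. y i + real_of_int (k i) / 2)"
        by (simp add: g_def cong: restrict_cong)
    qed simp
    finally show ?thesis .
  qed
  ultimately show ?thesis by simp
qed

text \<open>The Fejer kernel for period 1/2, with total mass 1/2 on a cell. The squared modulus
  shows positivity at once; the frequencies \<open>4 * pi * j\<close> are those of the torus of
  length 1/2.\<close>

definition fejer :: "nat \<Rightarrow> real \<Rightarrow> real" where
  "fejer N x = (cmod (\<Sum>j\<le>N. cis (4 * pi * real j * x)))\<^sup>2 / (real N + 1)"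

lemma fejer_nonneg: "0 \<le> fejer N x"
  by (simp add: fejer_def)

text \<open>Frequencies arise as differences of pairs and are left uncollected, so that coefficients
  become cardinalities of sets of pairs.\<close>

lemma fejer_expand:
  "of_real (fejer N x) =
     (\<Sum>p\<in>{..N} \<times> {..N}. cis (4 * pi * real_of_int (int (fst p) - int (snd p)) * x)) / (real N + 1)"
proof -
  let ?s = "\<Sum>j\<le>N. cis (4 * pi * real j * x)"
  have "of_real ((cmod ?s)\<^sup>2) = ?s * cnj ?s"
    by (rule complex_norm_square)
  also have "\<dots> = (\<Sum>p\<in>{..N} \<times> {..N}. cis (4 * pi * real (fst p) * x) * cis (- (4 * pi * real (snd p) * x)))"
    by (simp add: sum_product sum.cartesian_product cis_cnj case_prod_beta)
  also have "\<dots> = (\<Sum>p\<in>{..N} \<times> {..N}. cis (4 * pi * real_of_int (int (fst p) - int (snd p)) * x))"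
    by (simp add: cis_mult algebra_simps)
  finally show ?thesis by (simp add: fejer_def)
qed

lemma fejer_continuous [continuous_intros]: "continuous_on S f \<Longrightarrow> continuous_on S (\<lambda>x. fejer N (f x))"
  unfolding fejer_def by (intro continuous_intros) auto

lemma fejer_measurable [measurable]: "fejer N \<in> borel_measurable borel"
  by (intro borel_measurable_continuous_onI continuous_intros)

lemma fejer_bound: "fejer N x \<le> real N + 1"
proof -
  have "cmod (\<Sum>j\<le>N. cis (4 * pi * real j * x)) \<le> real N + 1"
    by (rule order_trans[OF norm_sum]) simp
  then have "(cmod (\<Sum>j\<le>N. cis (4 * pi * real j * x)))\<^sup>2 \<le> (real N + 1)\<^sup>2"
    by (intro power_mono) auto
  then show ?thesis by (simp add: fejer_def divide_le_eq power2_eq_square)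
qed

lemma cis_int_periodic: "cis (x + 2 * pi * real_of_int k) = cis x"
  by (simp add: complex_eq_iff sin_add cos_add)

lemma fejer_periodic: "fejer N (x + real_of_int k / 2) = fejer N x"
proof -
  have "cis (4 * pi * real j * (x + real_of_int k / 2)) = cis (4 * pi * real j * x)" for j
    using cis_int_periodic[of "4 * pi * real j * x" "int j * k"] by (simp add: algebra_simps)
  then show ?thesis by (simp add: fejer_def)
qed

lemma cis_measurable [measurable]: "cis \<in> borel_measurable borel"
  by (intro borel_measurable_continuous_onI continuous_intros)

lemma integrable_cis_Icc:
  "integrable lborel (\<lambda>t::real. indicator {-a..a} t *\<^sub>R cis (c * t))"
  using borel_integrable_atLeastAtMost'[of "-a" a "\<lambda>t. cis (c * t)"]
  by (simp add: set_integrable_def continuous_intros)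

text \<open>Used with \<open>a = 1/4\<close> for orthogonality on a cell and with
  \<open>a = 1/2\<close> for the Fourier representation of the sine kernel.\<close>

lemma integral_cis_Icc:
  assumes "0 \<le> a"
  shows "(LINT t|lborel. indicator {-a..a} t *\<^sub>R cis (c * t)) =
    of_real (if c = 0 then 2 * a else 2 * sin (c * a) / c)"
proof (cases "c = 0")
  case True
  then show ?thesis using assms by (simp add: scaleR_conv_of_real)
next
  case False
  let ?G = "\<lambda>t. exp (\<i> * of_real c * t) / (\<i> * of_real c)"
  have "(LINT t|lborel. indicator {-a..a} t *\<^sub>R cis (c * t)) = ?G (of_real a) - ?G (of_real (-a))"
  proof (rule integral_FTC_atLeastAtMost[where F = "\<lambda>t. ?G (of_real t)"])
    fix t :: real
    have "(?G has_field_derivative cis (c * t)) (at (of_real t))"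
      using False by (auto intro!: derivative_eq_intros simp: cis_conv_exp field_simps)
    then show "((\<lambda>t. ?G (of_real t)) has_vector_derivative cis (c * t)) (at t within {-a..a})"
      by (rule has_vector_derivative_real_field)
  qed (use assms in \<open>auto intro!: continuous_intros\<close>)
  also have "\<dots> = (cis (c * a) - cis (- (c * a))) / (\<i> * of_real c)"
    by (simp add: cis_conv_exp diff_divide_distrib mult.assoc)
  also have "cis (c * a) - cis (- (c * a)) = 2 * \<i> * of_real (sin (c * a))"
    by (simp add: complex_eq_iff)
  finally show ?thesis using False by simp
qed

text \<open>Orthogonality of characters over one period: for \<open>d \<noteq> 0\<close> the
  integral is a multiple of \<open>sin (pi * d)\<close>.\<close>

lemma integral_cis_cell:
  "(LINT x|lborel. indicator {-(1/4)..<1/4} x *\<^sub>R cis (4 * pi * real_of_int d * x)) = (if d = 0 then 1/2 else 0)"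
  and integrable_cis_cell:
  "integrable lborel (\<lambda>x. indicator {-(1/4)..<1/4} x *\<^sub>R cis (4 * pi * real_of_int d * x))"
proof -
  have i: "integrable lborel (\<lambda>x::real. indicator {-(1/4)..1/4} x *\<^sub>R cis (4 * pi * real_of_int d * x))"
    using integrable_cis_Icc[of "1/4" "4 * pi * real_of_int d"] by simp
  show "integrable lborel (\<lambda>x::real. indicator {-(1/4)..<1/4} x *\<^sub>R cis (4 * pi * real_of_int d * x))"
    using i by (rule Bochner_Integration.integrable_bound) (auto simp: indicator_def)
  have "AE x in lborel. indicator {-(1/4)..<1/4} x *\<^sub>R cis (4 * pi * real_of_int d * x)
      = indicator {-(1/4)..1/4} x *\<^sub>R cis (4 * pi * real_of_int d * x)"
    using AE_lborel_singleton[of "1/4"] by eventually_elim (auto simp: indicator_def)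
  then have "(LINT x|lborel. indicator {-(1/4)..<1/4} x *\<^sub>R cis (4 * pi * real_of_int d * x))
      = (LINT x|lborel. indicator {-(1/4)..1/4} x *\<^sub>R cis (4 * pi * real_of_int d * x))"
    by (intro integral_cong_AE) auto
  also have "\<dots> = (if d = 0 then 1/2 else 0)"
    using integral_cis_Icc[of "1/4" "4 * pi * real_of_int d"] sin_int_times_real[of d pi]
    by (auto simp: mult.commute)
  finally show "(LINT x|lborel. indicator {-(1/4)..<1/4} x *\<^sub>R cis (4 * pi * real_of_int d * x)) = (if d = 0 then 1/2 else 0)" .
qed

text \<open>Orthogonality leaves the pairs whose difference cancels \<open>d\<close>. Below,
  \<open>d = 0\<close> gives the mass (\<open>N + 1\<close> pairs) and \<open>d = 1\<close> the
  cosine moment (\<open>N\<close> pairs).\<close>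

lemma integral_fejer_cis:
  "(LINT x|lborel. indicator {-(1/4)..<1/4} x *\<^sub>R (of_real (fejer N x) * cis (4 * pi * real_of_int d * x)))
    = of_nat (card {p\<in>{..N} \<times> {..N}. int (fst p) - int (snd p) + d = 0}) / (2 * (real N + 1))"
proof -
  have "(LINT x|lborel. indicator {-(1/4)..<1/4} x *\<^sub>R (of_real (fejer N x) * cis (4 * pi * real_of_int d * x)))
    = (LINT x|lborel. (\<Sum>p\<in>{..N} \<times> {..N}. indicator {-(1/4)..<1/4} x *\<^sub>R
        cis (4 * pi * real_of_int (int (fst p) - int (snd p) + d) * x)) / (real N + 1))"
    by (intro Bochner_Integration.integral_cong)
      (auto simp: fejer_expand sum_distrib_left sum_distrib_right scaleR_sum_right cis_mult algebra_simps sum_divide_distrib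
        intro!: sum.cong)
  also have "\<dots> = (\<Sum>p\<in>{..N} \<times> {..N}. if int (fst p) - int (snd p) + d = 0 then 1/2 else 0 :: complex) / (real N + 1)"
    by (simp only: integral_divide_zero integral_cis_cell
        Bochner_Integration.integral_sum[OF integrable_cis_cell])
  also have "(\<Sum>p\<in>{..N} \<times> {..N}. if int (fst p) - int (snd p) + d = 0 then 1/2 else 0 :: complex)
    = of_nat (card {p\<in>{..N} \<times> {..N}. int (fst p) - int (snd p) + d = 0}) / 2"
    by (subst sum.inter_filter[symmetric]) auto
  finally show ?thesis by simp
qed

lemma integrable_fejer:
  assumes "g \<in> borel_measurable borel" "\<And>x. \<bar>g x\<bar> \<le> (B::real)"
  shows "integrable lborel (\<lambda>x. indicator {-(1/4)..<1/4} x * (fejer N x * g x))"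
proof -
  have "integrable lborel (\<lambda>x. (real N + 1) * B * indicator {-(1/4)..<1/4::real} x)"
    by (intro integrable_mult_right integrable_real_indicator emeasure_bounded_finite) auto
  then show ?thesis
  proof (rule Bochner_Integration.integrable_bound)
    have "0 \<le> B" using assms(2)[of 0] by linarith
    then have "\<bar>fejer N x * g x\<bar> \<le> \<bar>(real N + 1) * B\<bar>" for x
      using assms(2)[of x] fejer_bound[of N x] fejer_nonneg[of N x] by (auto simp: abs_mult intro!: mult_mono)
    then show "AE x in lborel. norm (indicator {-(1/4)..<1/4} x * (fejer N x * g x))
        \<le> norm ((real N + 1) * B * indicator {-(1/4)..<1/4::real} x)"
      by (intro AE_I2) (simp split: split_indicator)
  qed (use assms(1) in measurable)
qed

lemma integral_fejer: "(LINT x|lborel. indicator {-(1/4)..<1/4} x * fejer N x) = 1/2"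
proof -
  have "of_real (LINT x|lborel. indicator {-(1/4)..<1/4} x * fejer N x) =
    (LINT x|lborel. indicator {-(1/4)..<1/4} x *\<^sub>R (of_real (fejer N x) * cis (4 * pi * real_of_int 0 * x)))"
    by (simp add: integral_complex_of_real[symmetric] scaleR_conv_of_real)
  also have "\<dots> = of_nat (card ((\<lambda>j. (j, j)) ` {..N})) / (2 * (real N + 1))"
  proof -
    have "{p\<in>{..N} \<times> {..N}. int (fst p) - int (snd p) + 0 = 0} = (\<lambda>j. (j, j)) ` {..N}" by auto
    then show ?thesis unfolding integral_fejer_cis by simp
  qed
  also have "\<dots> = of_real (1/2)"
    by (subst card_image) (auto simp: inj_on_def field_simps simp flip: of_nat_Suc)
  finally show ?thesis by (simp only: of_real_eq_iff)
qed

text \<open>Within a cell \<open>1 - cos (4 * pi * x)\<close> is nonnegative and vanishes only at 0,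
  so this moment measures the mass away from 0. Its decay like \<open>1/N\<close> replaces pointwise
  bounds on the kernel.\<close>

lemma integral_fejer_one_minus_cos:
  "(LINT x|lborel. indicator {-(1/4)..<1/4} x * (fejer N x * (1 - cos (4 * pi * x)))) = 1 / (2 * (real N + 1))"
proof -
  have "(LINT x|lborel. indicator {-(1/4)..<1/4} x * (fejer N x * cos (4 * pi * x))) =
    Re (LINT x|lborel. indicator {-(1/4)..<1/4} x *\<^sub>R (of_real (fejer N x) * cis (4 * pi * real_of_int 1 * x)))"
  proof (subst integral_Re[symmetric])
    show "integrable lborel (\<lambda>x. indicator {-(1/4)..<1/4} x *\<^sub>R (of_real (fejer N x) * cis (4 * pi * real_of_int 1 * x)))"
      using integrable_fejer[of "\<lambda>x. 1" 1 N] fejer_nonneg[of N]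
      by (rule_tac Bochner_Integration.integrable_bound) (auto simp: norm_mult indicator_def)
  qed (auto intro!: Bochner_Integration.integral_cong)
  also have "\<dots> = Re (of_nat (card ((\<lambda>j. (j, Suc j)) ` {..<N})) / (2 * (real N + 1)))"
  proof -
    have "{p\<in>{..N} \<times> {..N}. int (fst p) - int (snd p) + 1 = 0} = (\<lambda>j. (j, Suc j)) ` {..<N}" by auto
    then show ?thesis unfolding integral_fejer_cis by simp
  qed
  also have "\<dots> = Re (of_real (real N / (2 * (real N + 1))))"
    by (subst card_image) (auto simp: inj_on_def)
  finally have "(LINT x|lborel. indicator {-(1/4)..<1/4} x * (fejer N x * cos (4 * pi * x))) = real N / (2 * (real N + 1))"
    by simp
  moreover have "(LINT x|lborel. indicator {-(1/4)..<1/4} x * (fejer N x * (1 - cos (4 * pi * x)))) =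
     (LINT x|lborel. indicator {-(1/4)..<1/4} x * fejer N x) - (LINT x|lborel. indicator {-(1/4)..<1/4} x * (fejer N x * cos (4 * pi * x)))"
    using integrable_fejer[of "\<lambda>x. 1" 1 N] integrable_fejer[of "\<lambda>x. cos (4 * pi * x)" 1 N]
    by (subst Bochner_Integration.integral_diff[symmetric]) (auto simp: algebra_simps)
  ultimately show ?thesis
    by (simp only: integral_fejer) (simp add: field_simps)
qed

text \<open>One free factor per coordinate covers both the total mass and a moment in a single
  coordinate.\<close>

lemma fejer_product_weight:
  fixes g :: "nat \<Rightarrow> real \<Rightarrow> real"
  assumes "\<And>i. g i \<in> borel_measurable borel" "\<And>i x. \<bar>g i x\<bar> \<le> B"
  shows "has_bochner_integral (lborel_n n)
     (\<lambda>y. indicator (cell n) y * (\<Prod>i<n. fejer N (y i) * g i (y i)))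
     (\<Prod>i<n. LINT x|lborel. indicator {-(1/4)..<1/4} x * (fejer N x * g i x))"
proof -
  have i: "integrable lborel (\<lambda>x. indicator {-(1/4)..<1/4} x * (fejer N x * g i x))" for i
    using assms by (rule integrable_fejer)
  have "has_bochner_integral (lborel_n n)
     (\<lambda>y. \<Prod>i<n. indicator {-(1/4)..<1/4} (y i) * (fejer N (y i) * g i (y i)))
     (\<Prod>i<n. LINT x|lborel. indicator {-(1/4)..<1/4} x * (fejer N x * g i x))"
    unfolding has_bochner_integral_iff
    using lborel_product.product_integrable_prod[of "{..<n}", OF _ i]
      lborel_product.product_integral_prod[of "{..<n}", OF _ i] by auto
  then show ?thesis
    by (rule has_bochner_integral_cong[THEN iffD1, rotated -1])
      (auto simp: indicator_cell prod.distrib space_PiM)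
qed

lemma fejer_weight:
  "has_bochner_integral (lborel_n n) (\<lambda>y. indicator (cell n) y * (\<Prod>i<n. fejer N (y i))) ((1/2) ^ n)"
  using fejer_product_weight[of "\<lambda>_ _. 1" 1 n N] by (simp add: integral_fejer)

lemma fejer_weight_one_minus_cos:
  assumes "a < n"
  shows "integrable (lborel_n n) (\<lambda>y. indicator (cell n) y * (\<Prod>i<n. fejer N (y i)) * (1 - cos (4 * pi * y a)))"
    and "(LINT y|lborel_n n. indicator (cell n) y * (\<Prod>i<n. fejer N (y i)) * (1 - cos (4 * pi * y a)))
      \<le> 1 / (2 * (real N + 1))"
proof -
  let ?g = "\<lambda>i x. if i = a then 1 - cos (4 * pi * x) else 1"
  have [simp]: "(\<Prod>i<n. ?g i (y i)) = 1 - cos (4 * pi * y a)" for y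
    using assms by (simp add: prod.delta)
  have abs: "\<bar>?g i x\<bar> \<le> 2" for i x
    using cos_ge_minus_one[of "4 * pi * x"] cos_le_one[of "4 * pi * x"] by (auto simp: abs_le_iff)
  have h: "has_bochner_integral (lborel_n n)
     (\<lambda>y. indicator (cell n) y * (\<Prod>i<n. fejer N (y i)) * (1 - cos (4 * pi * y a)))
     (\<Prod>i<n. LINT x|lborel. indicator {-(1/4)..<1/4} x * (fejer N x * ?g i x))"
    using fejer_product_weight[of ?g 2 n N, OF _ abs] by (simp add: prod.distrib mult.assoc)
  then show "integrable (lborel_n n) (\<lambda>y. indicator (cell n) y * (\<Prod>i<n. fejer N (y i)) * (1 - cos (4 * pi * y a)))"
    by (simp add: has_bochner_integral_iff)
  have "(\<Prod>i<n. LINT x|lborel. indicator {-(1/4)..<1/4} x * (fejer N x * ?g i x)) =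
     (\<Prod>i<n. if i = a then 1 / (2 * (real N + 1)) else 1/2)"
    by (intro prod.cong) (auto simp: integral_fejer_one_minus_cos integral_fejer)
  also have "\<dots> = 1 / (2 * (real N + 1)) * (\<Prod>i\<in>{..<n}-{a}. 1/2)"
    using assms by (subst prod.remove[of _ a]) auto
  also have "\<dots> \<le> 1 / (2 * (real N + 1))"
    by (intro mult_left_le prod_le_1) auto
  finally show "(LINT y|lborel_n n. indicator (cell n) y * (\<Prod>i<n. fejer N (y i)) * (1 - cos (4 * pi * y a)))
      \<le> 1 / (2 * (real N + 1))"
    using h by (simp add: has_bochner_integral_iff)
qed

text \<open>A Korovkin-type argument: continuity handles the points near 0, and away from 0 some
  coordinate has a sizeable \<open>1 - cos\<close>, whose moment tends to 0. The limit carries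
  \<open>(1/2) ^ n\<close> because that is the mass of the kernel.\<close>

lemma fejer_approximate_identity:
  fixes H :: "(nat \<Rightarrow> real) \<Rightarrow> complex"
  assumes [measurable]: "H \<in> borel_measurable (lborel_n n)"
    and B: "\<And>y. norm (H y) \<le> B"
    and cont: "\<And>e. e > 0 \<Longrightarrow> \<exists>d>0. \<forall>y\<in>Rn n. (\<forall>i<n. \<bar>y i\<bar> < d) \<longrightarrow> norm (H y - L) \<le> e"
  shows "(\<lambda>N. LINT y|lborel_n n. indicator (cell n) y * (H y * of_real (\<Prod>i<n. fejer N (y i))))
     \<longlonglongrightarrow> (1/2) ^ n * L"
proof -
  define W where "W N y = indicator (cell n) y * (\<Prod>i<n. fejer N (y i))" for N y
  have W0: "0 \<le> W N y" for N y
    unfolding W_def by (intro mult_nonneg_nonneg prod_nonneg) (auto simp: fejer_nonneg)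
  have WI: "integrable (lborel_n n) (W N)" "(LINT y|lborel_n n. W N y) = (1/2) ^ n" for N
    using fejer_weight[of n N] by (auto simp: has_bochner_integral_iff W_def[abs_def])
  have Wc: "integrable (lborel_n n) (\<lambda>y. W N y * (1 - cos (4 * pi * y a)))"
     "(LINT y|lborel_n n. W N y * (1 - cos (4 * pi * y a))) \<le> 1 / (2 * (real N + 1))" if "a < n" for N a
    using fejer_weight_one_minus_cos[OF that, of N] by (simp_all add: W_def)
  have [measurable]: "W N \<in> borel_measurable (lborel_n n)" for N
    using WI(1) by auto
  define I where "I N = (LINT y|lborel_n n. indicator (cell n) y * (H y * of_real (\<Prod>i<n. fejer N (y i))))" for N
  have I: "I N = (LINT y|lborel_n n. W N y *\<^sub>R H y)" for N
    unfolding I_def W_def by (intro Bochner_Integration.integral_cong) (auto simp: scaleR_conv_of_real split: split_indicator)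
  have HI: "integrable (lborel_n n) (\<lambda>y. W N y *\<^sub>R H y)" for N
  proof (rule Bochner_Integration.integrable_bound)
    show "integrable (lborel_n n) (\<lambda>y. B * W N y)" using WI by simp
    have "W N y * norm (H y) \<le> W N y * \<bar>B\<bar>" for y
      using B[of y] W0[of N y] by (intro mult_left_mono) auto
    then show "AE y in lborel_n n. norm (W N y *\<^sub>R H y) \<le> norm (B * W N y)"
      using W0 by (auto simp: abs_mult mult.commute)
  qed measurable
  have key: "\<exists>C. \<forall>N. norm (I N - (1/2) ^ n * L) \<le> e + C / (real N + 1)" if "e > 0" for e
  proof -
    from cont[OF that] obtain d0 where d0: "d0 > 0"
      "\<And>y. y \<in> Rn n \<Longrightarrow> (\<And>i. i < n \<Longrightarrow> \<bar>y i\<bar> < d0) \<Longrightarrow> norm (H y - L) \<le> e" by blast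
    \<comment> \<open>Capping at 1/4 keeps \<open>4 * pi * d\<close> within \<open>[0, pi]\<close>,
      where the cosine decreases.\<close>
    define d where "d = min d0 (1/4)"
    have d: "0 < d" "d \<le> 1/4" "d \<le> d0" using d0 by (auto simp: d_def)
    \<comment> \<open>A lower bound for \<open>1 - cos\<close> in any coordinate of modulus at least
      \<open>d\<close> within the cell.\<close>
    define s where "s = 1 - cos (4 * pi * d)"
    have "cos (4 * pi * d) < cos 0"
      using d by (intro cos_monotone_0_pi) auto
    then have s: "s > 0" by (simp add: s_def)
    define B' where "B' = B + norm L"
    have B': "norm (H y - L) \<le> B'" for y
      using norm_triangle_ineq4[of "H y" L] B[of y] by (simp add: B'_def)
    then have B'0: "0 \<le> B'" using norm_ge_zero order_trans by blast
    \<comment> \<open>One bound for the whole cell: \<open>e\<close> suffices near 0, and elsewhere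
      the sum is at least \<open>s\<close>, so that the second term is at least
      \<open>B'\<close>.\<close>
    have pw: "norm (H y - L) \<le> e + B' / s * (\<Sum>a<n. 1 - cos (4 * pi * y a))" if y: "y \<in> cell n" for y
    proof (cases "\<forall>i<n. \<bar>y i\<bar> < d")
      case True
      then have "norm (H y - L) \<le> e"
        using y d by (intro d0) (auto simp: cell_def PiE_iff intro: less_le_trans)
      moreover have "0 \<le> B' / s * (\<Sum>a<n. 1 - cos (4 * pi * y a))"
        using B'0 s by (intro mult_nonneg_nonneg sum_nonneg) auto
      ultimately show ?thesis by linarith
    next
      case False
      then obtain a where a: "a < n" "d \<le> \<bar>y a\<bar>" by force
      have ya: "\<bar>y a\<bar> \<le> 1/4" using y a by (force simp: cell_def PiE_iff)
      have "cos (4 * pi * \<bar>y a\<bar>) \<le> cos (4 * pi * d)"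
        using a d ya by (intro cos_monotone_0_pi_le) auto
      also have "cos (4 * pi * \<bar>y a\<bar>) = cos (4 * pi * y a)"
        by (cases "y a \<ge> 0") auto
      finally have "s \<le> 1 - cos (4 * pi * y a)" by (simp add: s_def)
      also have "\<dots> \<le> (\<Sum>a<n. 1 - cos (4 * pi * y a))"
        using a by (intro member_le_sum) auto
      finally have "B' / s * s \<le> B' / s * (\<Sum>a<n. 1 - cos (4 * pi * y a))"
        using B'0 s by (intro mult_left_mono) auto
      then show ?thesis using B'[of y] s \<open>e > 0\<close> by simp
    qed
    have "norm (I N - (1/2) ^ n * L) \<le> e + (B' / s * real n / 2) / (real N + 1)" for N
    proof -
      have "I N - (1/2) ^ n * L = (LINT y|lborel_n n. W N y *\<^sub>R (H y - L))"
        using HI[of N] WI[of N]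
        by (simp add: I scaleR_diff_right) (simp add: scaleR_conv_of_real)
      also have "norm \<dots> \<le> (LINT y|lborel_n n. norm (W N y *\<^sub>R (H y - L)))"
        by (rule integral_norm_bound)
      also have "\<dots> \<le> (LINT y|lborel_n n. e * W N y + B' / s * (\<Sum>a<n. W N y * (1 - cos (4 * pi * y a))))"
      proof (rule integral_mono)
        show "integrable (lborel_n n) (\<lambda>y. norm (W N y *\<^sub>R (H y - L)))"
          using HI[of N] WI[of N] by (auto simp: scaleR_diff_right)
        show "integrable (lborel_n n) (\<lambda>y. e * W N y + B' / s * (\<Sum>a<n. W N y * (1 - cos (4 * pi * y a))))"
          using WI(1) Wc(1)
          by (intro Bochner_Integration.integrable_add integrable_mult_right Bochner_Integration.integrable_sum) auto
        fix y
        show "norm (W N y *\<^sub>R (H y - L)) \<le> e * W N y + B' / s * (\<Sum>a<n. W N y * (1 - cos (4 * pi * y a)))"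
        proof (cases "y \<in> cell n")
          case True
          then show ?thesis
            using mult_left_mono[OF pw[OF True] W0[of N y]] W0[of N y]
            unfolding norm_scaleR sum_distrib_left[symmetric] by (simp add: algebra_simps)
        next
          case False
          then show ?thesis by (simp add: W_def)
        qed
      qed
      also have "\<dots> = e * (1/2) ^ n + B' / s * (\<Sum>a<n. (LINT y|lborel_n n. W N y * (1 - cos (4 * pi * y a))))"
      proof -
        have i: "integrable (lborel_n n) (\<lambda>y. \<Sum>a<n. W N y * (1 - cos (4 * pi * y a)))"
          using Wc(1) by (intro Bochner_Integration.integrable_sum) auto
        have "(LINT y|lborel_n n. e * W N y + B' / s * (\<Sum>a<n. W N y * (1 - cos (4 * pi * y a)))) =
            (LINT y|lborel_n n. e * W N y) + (LINT y|lborel_n n. B' / s * (\<Sum>a<n. W N y * (1 - cos (4 * pi * y a))))"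
          using WI(1) i by (intro Bochner_Integration.integral_add integrable_mult_right) auto
        moreover have "(LINT y|lborel_n n. (\<Sum>a<n. W N y * (1 - cos (4 * pi * y a)))) =
            (\<Sum>a<n. (LINT y|lborel_n n. W N y * (1 - cos (4 * pi * y a))))"
          using Wc(1) by (intro Bochner_Integration.integral_sum) auto
        ultimately show ?thesis
          by (simp only: integral_mult_right_zero WI(2))
      qed
      also have "\<dots> \<le> e * 1 + B' / s * (\<Sum>a<n. 1 / (2 * (real N + 1)))"
        using Wc(2) B'0 s \<open>e > 0\<close>
        by (intro add_mono mult_left_mono sum_mono) (auto intro!: power_le_one)
      also have "\<dots> = e + (B' / s * real n / 2) / (real N + 1)"
        by (simp add: field_simps)
      finally show ?thesis .
    qed
    then show ?thesis by blast
  qed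
  have "I \<longlonglongrightarrow> (1/2) ^ n * L"
  proof (rule tendstoI)
    fix r :: real assume "r > 0"
    with key[of "r/2"] obtain C where C: "\<And>N. norm (I N - (1/2) ^ n * L) \<le> r/2 + C / (real N + 1)" by auto
    have "(\<lambda>N. C / (real N + 1)) \<longlonglongrightarrow> 0"
      by real_asymp
    then have "eventually (\<lambda>N. C / (real N + 1) < r/2) sequentially"
      using \<open>r > 0\<close> by (intro order_tendstoD) auto
    then show "eventually (\<lambda>N. dist (I N) ((1/2) ^ n * L) < r) sequentially"
    proof eventually_elim
      case (elim N)
      then show ?case using C[of N] unfolding dist_norm by linarith
    qed
  qed
  then show ?thesis by (simp add: I_def[abs_def])
qed

section \<open>Poisson summation\<close>

lemma prod_cis: "(\<Prod>i\<in>A. cis (f i)) = cis (\<Sum>i\<in>A. f i)"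
  by (induction A rule: infinite_finite_induct) (auto simp: cis_mult)

lemma integrable_decay_bound:
  fixes F :: "(nat \<Rightarrow> real) \<Rightarrow> complex"
  assumes "F \<in> borel_measurable (lborel_n n)" "\<And>x. norm (F x) \<le> C * decay n x"
  shows "integrable (lborel_n n) F"
proof (rule Bochner_Integration.integrable_bound)
  show "integrable (lborel_n n) (\<lambda>x. C * decay n x)"
    using decay_integrable by simp
  show "AE x in lborel_n n. norm (F x) \<le> norm (C * decay n x)"
    using assms(2) by (auto intro: order_trans[OF _ abs_ge_self])
qed fact

text \<open>Expanding the kernels leaves exponentials, and by hypothesis only those of frequency 0
  contribute. They come from the \<open>(N + 1) ^ n\<close> diagonal choices of pairs, which cancel
  the normalisation.\<close>

lemma integral_mult_fejer_product:
  fixes F :: "(nat \<Rightarrow> real) \<Rightarrow> complex"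
  assumes F: "integrable (lborel_n n) F"
    and van: "\<And>m. (\<exists>i<n. m i \<noteq> 0) \<Longrightarrow>
       (LINT x|lborel_n n. F x * cis (4 * pi * (\<Sum>i<n. real_of_int (m i) * x i))) = 0"
  shows "(LINT x|lborel_n n. F x * of_real (\<Prod>i<n. fejer N (x i))) = (LINT x|lborel_n n. F x)"
proof -
  define P where "P = ({..<n} \<rightarrow>\<^sub>E {..N} \<times> {..N})"
  define d where "d p i = int (fst (p i)) - int (snd (p i))" for p :: "nat \<Rightarrow> nat \<times> nat" and i
  have finP: "finite P" unfolding P_def by (intro finite_PiE) auto
  have [measurable]: "F \<in> borel_measurable (lborel_n n)" using F by auto
  have int: "integrable (lborel_n n) (\<lambda>x. F x * cis (4 * pi * (\<Sum>i<n. real_of_int (m i) * x i)))" for m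
    using F by (rule Bochner_Integration.integrable_bound) (auto simp: norm_mult)
  have "(\<Prod>i<n. complex_of_real (fejer N (x i))) =
      (\<Sum>p\<in>P. cis (4 * pi * (\<Sum>i<n. real_of_int (d p i) * x i))) / (real N + 1) ^ n" for x
  proof -
    have "(\<Prod>i<n. complex_of_real (fejer N (x i))) =
       (\<Prod>i<n. \<Sum>p\<in>{..N} \<times> {..N}. cis (4 * pi * real_of_int (int (fst p) - int (snd p)) * x i)) / (real N + 1) ^ n"
      unfolding fejer_expand by (simp add: prod_dividef)
    also have "(\<Prod>i<n. \<Sum>p\<in>{..N} \<times> {..N}. cis (4 * pi * real_of_int (int (fst p) - int (snd p)) * x i)) =
       (\<Sum>p\<in>P. \<Prod>i<n. cis (4 * pi * real_of_int (d p i) * x i))"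
      unfolding P_def d_def by (rule prod_sum_PiE) auto
    finally show ?thesis by (simp add: prod_cis sum_distrib_left mult.assoc)
  qed
  then have "(LINT x|lborel_n n. F x * of_real (\<Prod>i<n. fejer N (x i))) =
     (LINT x|lborel_n n. (\<Sum>p\<in>P. F x * cis (4 * pi * (\<Sum>i<n. real_of_int (d p i) * x i))) / (real N + 1) ^ n)"
    by (simp add: sum_distrib_left)
  also have "\<dots> = (\<Sum>p\<in>P. (LINT x|lborel_n n. F x * cis (4 * pi * (\<Sum>i<n. real_of_int (d p i) * x i)))) / (real N + 1) ^ n"
    using int by (subst integral_divide_zero, subst Bochner_Integration.integral_sum) auto
  also have "(\<Sum>p\<in>P. (LINT x|lborel_n n. F x * cis (4 * pi * (\<Sum>i<n. real_of_int (d p i) * x i)))) =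
      (\<Sum>p\<in>{..<n} \<rightarrow>\<^sub>E (\<lambda>j. (j, j)) ` {..N}. (LINT x|lborel_n n. F x))"
  proof (rule sum.mono_neutral_cong_right[OF finP])
    show "({..<n} \<rightarrow>\<^sub>E (\<lambda>j. (j, j)) ` {..N}) \<subseteq> P"
      unfolding P_def by (intro PiE_mono) auto
    show "\<forall>p\<in>P - ({..<n} \<rightarrow>\<^sub>E (\<lambda>j. (j, j)) ` {..N}).
        (LINT x|lborel_n n. F x * cis (4 * pi * (\<Sum>i<n. real_of_int (d p i) * x i))) = 0"
    proof
      fix p assume p: "p \<in> P - ({..<n} \<rightarrow>\<^sub>E (\<lambda>j. (j, j)) ` {..N})"
      then obtain i where i: "i < n" "p i \<notin> (\<lambda>j. (j, j)) ` {..N}" "p i \<in> {..N} \<times> {..N}"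
        by (auto simp: P_def PiE_iff)
      then have "d p i \<noteq> 0" unfolding d_def by (cases "p i") auto
      with i(1) show "(LINT x|lborel_n n. F x * cis (4 * pi * (\<Sum>i<n. real_of_int (d p i) * x i))) = 0"
        by (intro van) auto
    qed
    fix p assume "p \<in> {..<n} \<rightarrow>\<^sub>E (\<lambda>j. (j, j)) ` {..N}"
    then have "d p i = 0" if "i < n" for i using that by (force simp: d_def PiE_iff)
    then show "(LINT x|lborel_n n. F x * cis (4 * pi * (\<Sum>i<n. real_of_int (d p i) * x i))) = (LINT x|lborel_n n. F x)"
      by simp
  qed
  also have "\<dots> = (real N + 1) ^ n * (LINT x|lborel_n n. F x)"
    by (simp add: card_PiE card_image inj_on_def add.commute)
  finally have "(LINT x|lborel_n n. F x * of_real (\<Prod>i<n. fejer N (x i))) =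
    (real N + 1) ^ n * (LINT x|lborel_n n. F x) / (real N + 1) ^ n" .
  moreover have "complex_of_nat N + 1 \<noteq> 0"
    using of_nat_neq_0[of N, where 'a = complex] by (simp add: add.commute)
  ultimately show ?thesis by simp
qed

text \<open>A basic neighbourhood in the product topology may constrain coordinates beyond
  \<open>n\<close>; since \<open>F\<close> depends only on the first \<open>n\<close>, the others
  can be left at \<open>a\<close>.\<close>

lemma continuous_on_fun_box:
  fixes F :: "(nat \<Rightarrow> real) \<Rightarrow> 'b::metric_space"
  assumes F: "continuous_on UNIV F" and dep: "\<And>x. F (restrict x {..<n}) = F x" and "e > 0"
  shows "\<exists>d>0. \<forall>y. (\<forall>i<n. \<bar>y i\<bar> < d) \<longrightarrow> dist (F (\<lambda>i. y i + a i)) (F a) \<le> e"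
proof -
  have "open (F -` ball (F a) e)"
    using F by (auto intro: open_vimage)
  then have "openin (product_topology (\<lambda>i. euclidean) UNIV) (F -` ball (F a) e)"
    by (simp add: open_fun_def)
  from product_topology_open_contains_basis[OF this, of a] \<open>e > 0\<close>
  obtain X where X: "a \<in> (\<Pi>\<^sub>E i\<in>UNIV. X i)" "\<And>i. open (X i)" "(\<Pi>\<^sub>E i\<in>UNIV. X i) \<subseteq> F -` ball (F a) e"
    by auto
  have "\<exists>d>0. \<forall>t. \<bar>t\<bar> < d \<longrightarrow> t + a i \<in> X i" for i
  proof -
    obtain d where "d > 0" "ball (a i) d \<subseteq> X i"
      using X(1,2) open_contains_ball by (metis PiE_iff UNIV_I)
    then show ?thesis by (intro exI[of _ d]) (auto simp: dist_real_def subset_iff)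
  qed
  then obtain d where d: "\<And>i. d i > 0" "\<And>i t. \<bar>t\<bar> < d i \<Longrightarrow> t + a i \<in> X i" by metis
  define d0 where "d0 = Min (insert 1 (d ` {..<n}))"
  have d0: "d0 > 0" "\<And>i. i < n \<Longrightarrow> d0 \<le> d i"
    using d(1) by (auto simp: d0_def)
  have "dist (F (\<lambda>i. y i + a i)) (F a) \<le> e" if "\<forall>i<n. \<bar>y i\<bar> < d0" for y
  proof -
    \<comment> \<open>\<open>z\<close> stays in the neighbourhood because it moves only the first
      \<open>n\<close> coordinates, and \<open>F\<close> cannot tell it from the shifted
      point.\<close>
    define z where "z i = (if i < n then y i + a i else a i)" for i
    have "z \<in> (\<Pi>\<^sub>E i\<in>UNIV. X i)"
      using that d0(2) d(2) X(1) by (force simp: z_def PiE_iff)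
    then have "dist (F a) (F z) < e" using X(3) by auto
    moreover have "F z = F (\<lambda>i. y i + a i)"
      using dep[of z] dep[of "\<lambda>i. y i + a i"] by (simp add: z_def cong: restrict_cong)
    ultimately show ?thesis by (simp add: dist_commute)
  qed
  with d0(1) show ?thesis by blast
qed

text \<open>The integral of \<open>F\<close> against the product of Fejer kernels is the same for
  all \<open>N\<close>. Cut into cells, it is a sum whose term at \<open>k\<close> converges to
  \<open>(1/2) ^ n\<close> times the value of \<open>F\<close> at the lattice point, with a summable
  bound uniform in \<open>N\<close>.\<close>

lemma poisson_half_lattice:
  fixes F :: "(nat \<Rightarrow> real) \<Rightarrow> complex"
  assumes cont: "continuous_on UNIV F" and dep: "\<And>x. F (restrict x {..<n}) = F x"
    and bd: "\<And>x. norm (F x) \<le> C * decay n x"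
    and van: "\<And>m. (\<exists>i<n. m i \<noteq> 0) \<Longrightarrow>
       (LINT x|lborel_n n. F x * cis (4 * pi * (\<Sum>i<n. real_of_int (m i) * x i))) = 0"
  shows "(1/2) ^ n * (\<Sum>\<^sub>\<infinity>k\<in>int_tuples n. F (\<lambda>i. real_of_int (k i) / 2)) = (LINT x|lborel_n n. F x)"
proof -
  have [measurable]: "F \<in> borel_measurable (lborel_n n)"
    using cont by (rule continuous_measurable_lborel_n)
  have FI: "integrable (lborel_n n) F"
    using bd by (rule integrable_decay_bound[rotated]) simp
  \<comment> \<open>\<open>decay\<close> equals 1 at the origin, so the bound there shows that
    \<open>C\<close> is nonnegative.\<close>
  have "0 \<le> C * decay n (\<lambda>_. 0)" using bd norm_ge_zero order_trans by blast
  then have C0: "0 \<le> C" by (simp add: decay_def)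
  define A where "A N k = (LINT y|lborel_n n. indicator (cell n) y *
      (F (\<lambda>i. y i + real_of_int (k i) / 2) * of_real (\<Prod>i<n. fejer N (y i))))" for N k
  \<comment> \<open>\<open>decay_shift\<close> moves the bound on \<open>F\<close> to the centre of
    the cell, and \<open>(1/2) ^ n\<close> is the mass of the Fejer weight.\<close>
  define b where "b k = C * 3 ^ n * decay n (\<lambda>i. real_of_int (k i) / 2) * (1/2) ^ n" for k
  have shift_cont: "continuous_on UNIV (\<lambda>y. F (\<lambda>i. y i + c i))" for c
    by (intro continuous_on_compose2[OF cont] continuous_intros) auto
  have [measurable]: "(\<lambda>y. F (\<lambda>i. y i + c i)) \<in> borel_measurable (lborel_n n)" for c
    by (rule continuous_measurable_lborel_n[OF shift_cont])
  have A: "(LINT x|lborel_n n. F x) = (\<Sum>\<^sub>\<infinity>k\<in>int_tuples n. A N k)" for N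
  proof -
    have i: "integrable (lborel_n n) (\<lambda>x. F x * of_real (\<Prod>i<n. fejer N (x i)))"
    proof (rule Bochner_Integration.integrable_bound)
      show "integrable (lborel_n n) (\<lambda>x. F x * (real N + 1) ^ n)" using FI by simp
      have "(\<Prod>i<n. fejer N (x i)) \<le> (real N + 1) ^ n" for x
        using prod_mono[of "{..<n}" "\<lambda>i. fejer N (x i)" "\<lambda>i. real N + 1"] by (simp add: fejer_bound fejer_nonneg)
      moreover have "0 \<le> (\<Prod>i<n. fejer N (x i))" for x by (intro prod_nonneg) (simp add: fejer_nonneg)
      ultimately show "AE x in lborel_n n. norm (F x * of_real (\<Prod>i<n. fejer N (x i))) \<le> norm (F x * (real N + 1) ^ n)"
        by (intro AE_I2) (simp only: norm_mult norm_of_real abs_of_nonneg,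
           simp add: mult_left_mono norm_power flip: of_nat_Suc)
    qed measurable
    have "(LINT x|lborel_n n. F x) = (LINT x|lborel_n n. F x * of_real (\<Prod>i<n. fejer N (x i)))"
      using FI van by (rule integral_mult_fejer_product[symmetric])
    also have "\<dots> = (\<Sum>\<^sub>\<infinity>k\<in>int_tuples n. A N k)"
      unfolding integral_eq_infsum_cells[OF i] A_def
    proof (intro infsum_cong Bochner_Integration.integral_cong refl)
      fix k y
      have "F (\<lambda>i\<in>{..<n}. y i + real_of_int (k i) / 2) = F (\<lambda>i. y i + real_of_int (k i) / 2)"
        using dep[of "\<lambda>i. y i + real_of_int (k i) / 2"] by simp
      \<comment> \<open>Half-integer translations leave the kernels unchanged, so only
        \<open>F\<close> carries the cell index.\<close>
      then show "indicator (cell n) y * (F (\<lambda>i\<in>{..<n}. y i + real_of_int (k i) / 2) *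
            of_real (\<Prod>i<n. fejer N ((\<lambda>i\<in>{..<n}. y i + real_of_int (k i) / 2) i))) =
          indicator (cell n) y * (F (\<lambda>i. y i + real_of_int (k i) / 2) * of_real (\<Prod>i<n. fejer N (y i)))"
        by (simp add: fejer_periodic cong: prod.cong_simp)
    qed
    finally show ?thesis .
  qed
  have "(\<lambda>N. \<Sum>\<^sub>\<infinity>k\<in>int_tuples n. A N k) \<longlonglongrightarrow>
      (\<Sum>\<^sub>\<infinity>k\<in>int_tuples n. (1/2) ^ n * F (\<lambda>i. real_of_int (k i) / 2))"
  proof (rule tendsto_infsum_dominated)
    show "b summable_on int_tuples n"
      unfolding b_def using decay_summable by (intro summable_on_cmult_left summable_on_cmult_right)
    fix k :: "nat \<Rightarrow> int"
    show "(\<lambda>N. A N k) \<longlonglongrightarrow> (1/2) ^ n * F (\<lambda>i. real_of_int (k i) / 2)"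
      unfolding A_def
    proof (rule fejer_approximate_identity)
      show "norm (F (\<lambda>i. y i + real_of_int (k i) / 2)) \<le> C" for y
        using bd decay_le_1 C0 by (metis mult_left_le order_trans)
      fix e :: real assume "e > 0"
      from continuous_on_fun_box[OF cont dep this, of "\<lambda>i. real_of_int (k i) / 2"]
      show "\<exists>d>0. \<forall>y\<in>Rn n. (\<forall>i<n. \<bar>y i\<bar> < d) \<longrightarrow>
          norm (F (\<lambda>i. y i + real_of_int (k i) / 2) - F (\<lambda>i. real_of_int (k i) / 2)) \<le> e"
        by (auto simp: dist_norm)
    qed measurable
    fix N
    define W where "W y = indicator (cell n) y * (\<Prod>i<n. fejer N (y i))" for y
    have W0: "0 \<le> W y" for y
      unfolding W_def by (intro mult_nonneg_nonneg prod_nonneg) (auto simp: fejer_nonneg)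
    have WI: "integrable (lborel_n n) W" "(LINT y|lborel_n n. W y) = (1/2) ^ n"
      using fejer_weight[of n N] by (auto simp: has_bochner_integral_iff W_def[abs_def])
    let ?b = "C * 3 ^ n * decay n (\<lambda>i. real_of_int (k i) / 2)"
    have bound: "norm (indicator (cell n) y *
        (F (\<lambda>i. y i + real_of_int (k i) / 2) * of_real (\<Prod>i<n. fejer N (y i)))) \<le> ?b * W y" for y
    proof (cases "y \<in> cell n")
      case True
      have "norm (F (\<lambda>i. y i + real_of_int (k i) / 2)) \<le> C * decay n (\<lambda>i. real_of_int (k i) / 2 + y i)"
        using bd[of "\<lambda>i. y i + real_of_int (k i) / 2"] by (simp add: add.commute)
      also have "\<dots> \<le> C * (3 ^ n * decay n (\<lambda>i. real_of_int (k i) / 2))"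
        using True C0 by (intro mult_left_mono decay_shift) (force simp: cell_def PiE_iff)+
      finally have "norm (F (\<lambda>i. y i + real_of_int (k i) / 2)) * W y \<le> ?b * W y"
        using W0 by (intro mult_right_mono) (auto simp: mult.assoc)
      moreover have "norm (indicator (cell n) y *
        (F (\<lambda>i. y i + real_of_int (k i) / 2) * of_real (\<Prod>i<n. fejer N (y i)))) = norm (F (\<lambda>i. y i + real_of_int (k i) / 2)) * W y"
        using True W0[of y] by (simp add: W_def norm_mult del: of_real_prod)
      ultimately show ?thesis by simp
    qed (simp add: W_def)
    have "norm (A N k) \<le> (LINT y|lborel_n n. ?b * W y)"
      unfolding A_def
    proof (rule order_trans[OF integral_norm_bound integral_mono])
      show wi: "integrable (lborel_n n) (\<lambda>y. ?b * W y)" using WI by simp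
      show "integrable (lborel_n n) (\<lambda>y. norm (indicator (cell n) y *
        (F (\<lambda>i. y i + real_of_int (k i) / 2) * of_real (\<Prod>i<n. fejer N (y i)))))"
        by (rule integrable_norm, rule Bochner_Integration.integrable_bound[OF wi]) (measurable, intro AE_I2 order_trans[OF bound], auto)
    qed (use bound in auto)
    also have "\<dots> = b k" using WI by (simp add: b_def)
    finally show "norm (A N k) \<le> b k" .
  qed
  moreover have "(\<lambda>N. \<Sum>\<^sub>\<infinity>k\<in>int_tuples n. A N k) = (\<lambda>N. LINT x|lborel_n n. F x)"
    using A by simp
  ultimately have "(\<Sum>\<^sub>\<infinity>k\<in>int_tuples n. (1/2) ^ n * F (\<lambda>i. real_of_int (k i) / 2)) = (LINT x|lborel_n n. F x)"
    by (metis LIMSEQ_unique tendsto_const)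
  then show ?thesis by (simp add: infsum_cmult_right')
qed

section \<open>Vanishing of Fourier coefficients\<close>

text \<open>Values of a Schwartz function off \<open>Rn n\<close> are arbitrary, so it is composed
  with \<open>restrict\<close> before being treated as a function of all sequences.\<close>

lemma schwartz_continuous:
  assumes "\<eta> \<in> schwartz n"
  shows "continuous_on UNIV (\<lambda>x. \<eta> (restrict x {..<n}))"
proof -
  have "set [] \<subseteq> {..<n} \<longrightarrow> continuous_map (powertop_real {..<n}) euclidean (foldr partial_deriv [] \<eta>)"
    using assms unfolding schwartz_def by blast
  then have "continuous_map (powertop_real {..<n}) euclidean \<eta>" by simp
  moreover have "continuous_map euclidean (powertop_real {..<n}) (\<lambda>x. restrict x {..<n})"
    unfolding continuous_map_componentwise
    by (auto simp: continuous_map_iff_continuous2 intro!: continuous_on_product_coordinates)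
  ultimately have "continuous_map euclidean euclidean (\<eta> \<circ> (\<lambda>x. restrict x {..<n}))"
    by (rule continuous_map_compose[rotated])
  then show ?thesis by (simp add: o_def)
qed

text \<open>Multiplying out \<open>\<Prod>i<n. 1 + (x i)\<^sup>2\<close> gives monomials with
  exponents 0 or 2, and the product of each with \<open>\<eta>\<close> is bounded.\<close>

lemma schwartz_decay:
  assumes "\<eta> \<in> schwartz n"
  obtains C where "\<And>x. norm (\<eta> (restrict x {..<n})) \<le> C * decay n x"
proof -
  have "set [] \<subseteq> {..<n} \<longrightarrow> (\<forall>\<alpha>. bounded ((\<lambda>x. (\<Prod>i<n. x i ^ \<alpha> i) *\<^sub>R foldr partial_deriv [] \<eta> x) ` Rn n))"
    using assms unfolding schwartz_def by blast
  then have "\<forall>\<alpha>. \<exists>B. \<forall>x\<in>Rn n. norm ((\<Prod>i<n. x i ^ \<alpha> i) *\<^sub>R \<eta> x) \<le> B"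
    by (simp add: bounded_iff)
  then obtain B where B: "\<And>\<alpha> x. x \<in> Rn n \<Longrightarrow> norm ((\<Prod>i<n. x i ^ \<alpha> i) *\<^sub>R \<eta> x) \<le> B \<alpha>"
    by metis
  define P where "P = ({..<n} \<rightarrow>\<^sub>E {0, 2::nat})"
  have "norm (\<eta> (restrict x {..<n})) \<le> (\<Sum>\<alpha>\<in>P. B \<alpha>) * decay n x" for x
  proof -
    let ?x = "restrict x {..<n}"
    have x: "?x \<in> Rn n" by simp
    have "(\<Prod>i<n. 1 + (x i)\<^sup>2) = (\<Prod>i<n. \<Sum>j\<in>{0, 2}. ?x i ^ j)"
      by (intro prod.cong) auto
    also have "\<dots> = (\<Sum>\<alpha>\<in>P. \<Prod>i<n. ?x i ^ \<alpha> i)"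
      unfolding P_def by (rule prod_sum_PiE) auto
    finally have "norm ((\<Prod>i<n. 1 + (x i)\<^sup>2) *\<^sub>R \<eta> ?x) = norm (\<Sum>\<alpha>\<in>P. (\<Prod>i<n. ?x i ^ \<alpha> i) *\<^sub>R \<eta> ?x)"
      by (simp only: scaleR_sum_left)
    also have "\<dots> \<le> (\<Sum>\<alpha>\<in>P. B \<alpha>)"
      by (intro order_trans[OF norm_sum] sum_mono B x)
    finally have "(\<Prod>i<n. 1 + (x i)\<^sup>2) * norm (\<eta> ?x) \<le> (\<Sum>\<alpha>\<in>P. B \<alpha>)"
      by (simp add: abs_prod)
    then have "decay n x * ((\<Prod>i<n. 1 + (x i)\<^sup>2) * norm (\<eta> ?x)) \<le> decay n x * (\<Sum>\<alpha>\<in>P. B \<alpha>)"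
      by (intro mult_left_mono decay_nonneg)
    moreover have "decay n x * (\<Prod>i<n. 1 + (x i)\<^sup>2) = 1"
      unfolding decay_def prod.distrib[symmetric]
      by (intro prod.neutral ballI) (simp add: add_nonneg_eq_0_iff)
    ultimately show ?thesis by (simp add: mult.assoc[symmetric]) (simp add: mult.commute)
  qed
  then show ?thesis by (rule that)
qed

section \<open>The sine kernel, its determinants, and their products with functions of the
  class\<close>

lemma S_kernel_sinc: "S_kernel x = sinc (pi * x)"
  by (simp add: S_kernel_def)

lemma S_kernel_continuous [continuous_intros]:
  "continuous_on A f \<Longrightarrow> continuous_on A (\<lambda>x. S_kernel (f x))"
  unfolding S_kernel_sinc by (intro continuous_on_sinc continuous_intros)

lemma S_kernel_abs_le: "\<bar>S_kernel x\<bar> \<le> 1"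
  using abs_sin_x_le_abs_x[of "pi * x"] by (simp add: S_kernel_def divide_le_eq abs_mult)

lemma S_kernel_integral:
  "of_real (S_kernel x) = (LINT t|lborel. indicator {-(1/2)..1/2} t *\<^sub>R cis (2 * pi * x * t))"
  by (subst integral_cis_Icc) (auto simp: S_kernel_def)

lemma sine_det_perm_sum:
  "sine_det n x = (\<Sum>p | p permutes {..<n}. signof p * (\<Prod>i<n. S_kernel (x i - x (p i))))"
proof -
  have "p i < n" if "p permutes {..<n}" "i < n" for p i
    using permutes_in_image[OF that(1), of i] that(2) by simp
  then show ?thesis
    unfolding sine_det_def Determinant.det_def
    by (auto simp: lessThan_atLeast0 intro!: sum.cong prod.cong)
qed

lemma sine_det_restrict: "sine_det n (restrict x {..<n}) = sine_det n x"
  unfolding sine_det_def by (intro arg_cong[where f = Determinant.det] eq_matI) auto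

text \<open>The kernel sees only differences. This lets the determinant leave the average over
  \<open>u\<close>, and makes the occupation probabilities invariant under half-integer
  shifts.\<close>

lemma sine_det_shift: "sine_det n (\<lambda>i. x i + c) = sine_det n x"
  by (simp add: sine_det_def)

lemma abs_signof: "\<bar>signof p\<bar> = (1::real)"
  by (simp add: sign_def)

lemma sine_det_bound: "\<bar>sine_det n x\<bar> \<le> fact n"
proof -
  have "\<bar>sine_det n x\<bar> \<le> (\<Sum>p | p permutes {..<n}. \<bar>signof p * (\<Prod>i<n. S_kernel (x i - x (p i)))\<bar>)"
    unfolding sine_det_perm_sum by (rule sum_abs)
  also have "\<dots> \<le> (\<Sum>p | p permutes {..<n}. 1)"
    by (intro sum_mono) (auto simp: abs_mult abs_signof abs_prod intro!: prod_le_1 S_kernel_abs_le)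
  also have "\<dots> = fact n"
    by (simp add: card_permutations[of "{..<n}" n])
  finally show ?thesis .
qed

lemma sine_det_continuous: "continuous_on UNIV (sine_det n)"
  unfolding sine_det_perm_sum by (intro continuous_intros) auto

text \<open>Norm exactly 2 belongs to the vanishing region because the bound in
  \<open>K_class\<close> is strict; the shifted frequencies below can attain this value.\<close>

lemma K_class_fourier_zero:
  assumes "\<eta> \<in> K_class n" "\<xi> \<in> Rn n" "(\<Sum>i<n. \<xi> i) = 0" "2 \<le> (\<Sum>i<n. \<bar>\<xi> i\<bar>)"
  shows "fourier_n n \<eta> \<xi> = 0"
proof (rule ccontr)
  assume "fourier_n n \<eta> \<xi> \<noteq> 0"
  then have "\<xi> \<in> {x \<in> Rn n. fourier_n n \<eta> x \<noteq> 0}" using assms by auto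
  moreover have "{x \<in> Rn n. fourier_n n \<eta> x \<noteq> 0} \<subseteq> support_n n (fourier_n n \<eta>)"
    unfolding support_n_def by (intro closure_of_subset) auto
  moreover have "\<xi> \<notin> support_n n (fourier_n n \<eta>)"
    using assms unfolding K_class_def by fastforce
  ultimately show False by blast
qed

text \<open>A zero sum cannot have exactly one nonzero term, and each index with
  \<open>m i \<noteq> 0\<close> contributes at least \<open>2 - 1\<close>.\<close>

lemma two_le_sum_abs_shifted:
  fixes m :: "nat \<Rightarrow> int" and s :: "nat \<Rightarrow> real"
  assumes "(\<Sum>i<n. m i) = 0" "j < n" "m j \<noteq> 0" "\<And>i. i < n \<Longrightarrow> \<bar>s i\<bar> \<le> 1"
  shows "2 \<le> (\<Sum>i<n. \<bar>s i + 2 * real_of_int (m i)\<bar>)"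
proof -
  have "\<exists>l<n. l \<noteq> j \<and> m l \<noteq> 0"
  proof (rule ccontr)
    assume "\<not> ?thesis"
    then have "(\<Sum>i\<in>{..<n} - {j}. m i) = 0" by (intro sum.neutral) auto
    then have "(\<Sum>i<n. m i) = m j" using assms(2) by (subst sum.remove[of _ j]) auto
    with assms show False by simp
  qed
  then obtain l where l: "l < n" "l \<noteq> j" "m l \<noteq> 0" by blast
  have one: "1 \<le> \<bar>s i + 2 * real_of_int (m i)\<bar>" if "i < n" "m i \<noteq> 0" for i
  proof -
    have "1 \<le> \<bar>real_of_int (m i)\<bar>" using that(2) by linarith
    then show ?thesis using assms(4)[OF that(1)] by linarith
  qed
  have "2 \<le> (\<Sum>i\<in>{j, l}. \<bar>s i + 2 * real_of_int (m i)\<bar>)"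
    using one[of j] one[of l] l assms by simp
  also have "\<dots> \<le> (\<Sum>i<n. \<bar>s i + 2 * real_of_int (m i)\<bar>)"
    using l assms by (intro sum_mono2) auto
  finally show ?thesis .
qed

lemma fourier_n_cis:
  "fourier_n n f \<xi> = (LINT x|lborel_n n. f x * cis (- 2 * pi * (\<Sum>i<n. x i * \<xi> i)))"
proof -
  have "cis (- 2 * pi * s) = exp (- 2 * of_real pi * \<i> * of_real s)" for s
    by (simp add: cis_conv_exp mult_ac)
  then show ?thesis unfolding fourier_n_def by simp
qed

text \<open>Merging the \<open>n\<close> one-dimensional integrals into one over
  \<open>lborel_n n\<close> allows a single exchange with the integral over
  \<open>x\<close>.\<close>

lemma S_kernel_prod_integral:
  "(\<Prod>i<n. of_real (S_kernel (z i))) =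
     (LINT t|lborel_n n. (\<Prod>i<n. indicator {-(1/2)..1/2} (t i)) *\<^sub>R cis (2 * pi * (\<Sum>i<n. t i * z i)))"
proof -
  have "(\<Prod>i<n. of_real (S_kernel (z i))) =
     (\<Prod>i<n. LINT t|lborel. indicator {-(1/2)..1/2} t *\<^sub>R cis (2 * pi * z i * t))"
    by (simp only: S_kernel_integral)
  also have "\<dots> = (LINT t|lborel_n n. (\<Prod>i<n. indicator {-(1/2)..1/2} (t i) *\<^sub>R cis (2 * pi * z i * t i)))"
    by (rule lborel_product.product_integral_prod[symmetric]) (auto intro: integrable_cis_Icc)
  also have "\<dots> = (LINT t|lborel_n n. (\<Prod>i<n. indicator {-(1/2)..1/2} (t i)) *\<^sub>R cis (2 * pi * (\<Sum>i<n. t i * z i)))"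
    by (intro Bochner_Integration.integral_cong refl)
      (simp add: scaleR_conv_of_real prod.distrib prod_cis sum_distrib_left mult_ac)
  finally show ?thesis .
qed

text \<open>For fixed \<open>t\<close> the integral over \<open>x\<close> is a value of the Fourier
  transform of \<open>\<eta>\<close> at a frequency of zero sum and large norm, so it vanishes
  before \<open>t\<close> is integrated.\<close>

lemma K_class_perm_vanish:
  assumes \<eta>: "\<eta> \<in> K_class n" and p: "p permutes {..<n}"
    and m: "(\<Sum>i<n. m i) = 0" "j < n" "m j \<noteq> (0::int)"
  shows "(LINT x|lborel_n n. \<eta> (restrict x {..<n}) * (\<Prod>i<n. of_real (S_kernel (x i - x (p i)))) *
     cis (4 * pi * (\<Sum>i<n. real_of_int (m i) * x i))) = 0"
proof -
  let ?e = "\<lambda>x. \<eta> (restrict x {..<n})"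
  let ?q = "inv_into UNIV p"
  define ind where "ind t = (\<Prod>i<n. indicator {-(1/2)..1/2} (t i) :: real)" for t :: "nat \<Rightarrow> real"
  have S: "\<eta> \<in> schwartz n" using \<eta> by (simp add: K_class_def)
  interpret L: sigma_finite_measure "lborel_n n"
    by (rule lborel_product.sigma_finite) simp
  interpret pair_sigma_finite "lborel_n n" "lborel_n n" ..
  have [measurable]: "?e \<in> borel_measurable (lborel_n n)"
    by (rule continuous_measurable_lborel_n[OF schwartz_continuous[OF S]])
  obtain C where "\<And>x. norm (?e x) \<le> C * decay n x" using schwartz_decay[OF S] by blast
  then have eI: "integrable (lborel_n n) ?e"
    by (rule integrable_decay_bound[rotated]) simp
  have pn: "p i < n" if "i < n" for i
    using permutes_in_image[OF p, of i] that by simp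
  have qn: "?q i < n" if "i < n" for i
    using permutes_in_image[OF permutes_inv[OF p], of i] that by simp
  have coord: "(\<lambda>x. x i) \<in> borel_measurable (lborel_n n)" if "i < n" for i
    using that by auto
  have indI: "integrable (lborel_n n) ind"
    unfolding ind_def
    by (intro lborel_product.product_integrable_prod integrable_real_indicator emeasure_bounded_finite) auto
  then have [measurable]: "ind \<in> borel_measurable (lborel_n n)" by auto
  have ind01: "0 \<le> ind t" for t unfolding ind_def by (intro prod_nonneg) auto
  define G where "G x t = ?e x * (ind t *\<^sub>R cis (2 * pi * (\<Sum>i<n. t i * (x i - x (p i))))) *
      cis (4 * pi * (\<Sum>i<n. real_of_int (m i) * x i))" for x t
  have [measurable]: "(\<lambda>(x, t). G x t) \<in> borel_measurable (lborel_n n \<Otimes>\<^sub>M lborel_n n)"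
  proof -
    have [measurable]: "(\<lambda>x. \<Sum>i<n. snd x i * (fst x i - fst x (p i))) \<in> borel_measurable (lborel_n n \<Otimes>\<^sub>M lborel_n n)"
      using pn
      by (intro borel_measurable_sum borel_measurable_times borel_measurable_diff
          measurable_compose[OF measurable_fst] measurable_compose[OF measurable_snd] coord) auto
    show ?thesis unfolding G_def case_prod_beta by measurable
  qed
  \<comment> \<open>The modulus splits into a function of \<open>x\<close> times a function of
    \<open>t\<close>, which settles the integrability for Fubini.\<close>
  have nG: "norm (G x t) = norm (?e x) * ind t" for x t
    using ind01[of t] by (simp add: G_def norm_mult)
  have GI: "integrable (lborel_n n \<Otimes>\<^sub>M lborel_n n) (\<lambda>(x, t). G x t)"
  proof (rule Fubini_integrable)
    show "integrable (lborel_n n) (\<lambda>x. LINT t|lborel_n n. norm (case (x, t) of (x, t) \<Rightarrow> G x t))"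
      using eI by (simp add: nG)
    show "AE x in lborel_n n. integrable (lborel_n n) (\<lambda>t. case (x, t) of (x, t) \<Rightarrow> G x t)"
    proof (rule AE_I2)
      fix x assume [measurable]: "x \<in> space (lborel_n n)"
      have "integrable (lborel_n n) (\<lambda>t. norm (?e x) * ind t)" using indI by simp
      moreover have "(\<lambda>t. G x t) \<in> borel_measurable (lborel_n n)" 
        unfolding G_def by measurable
      ultimately have "integrable (lborel_n n) (\<lambda>t. G x t)"
        by (rule Bochner_Integration.integrable_bound) (auto simp only: nG real_norm_def intro!: AE_I2 abs_ge_self)
      then show "integrable (lborel_n n) (\<lambda>t. case (x, t) of (x, t) \<Rightarrow> G x t)" by simp
    qed
  qed measurable
  have "(LINT x|lborel_n n. ?e x * (\<Prod>i<n. of_real (S_kernel (x i - x (p i)))) *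
     cis (4 * pi * (\<Sum>i<n. real_of_int (m i) * x i))) = (LINT x|lborel_n n. (LINT t|lborel_n n. G x t))"
    by (simp only: S_kernel_prod_integral G_def ind_def integral_mult_left_zero integral_mult_right_zero)
  also have "\<dots> = (LINT t|lborel_n n. (LINT x|lborel_n n. G x t))"
    by (rule Fubini_integral[OF GI, symmetric])
  also have "\<dots> = (LINT t|lborel_n n. 0)"
  proof (intro Bochner_Integration.integral_cong refl)
    fix t :: "nat \<Rightarrow> real"
    show "(LINT x|lborel_n n. G x t) = 0"
    proof (cases "\<forall>i<n. t i \<in> {-(1/2)..1/2}")
      case False
      then obtain i where "i < n" "t i \<notin> {-(1/2)..1/2}" by blast
      then have "ind t = 0" unfolding ind_def by (intro prod_zero) (auto intro!: bexI[of _ i])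
      then show ?thesis by (simp add: G_def)
    next
      case True
      then have ind1: "ind t = 1" unfolding ind_def by (intro prod.neutral) auto
      \<comment> \<open>The minus sign matches the factor \<open>- 2 * pi\<close> in the Fourier
        transform; the inverse permutation appears because reindexing moves the permutation from
        \<open>x\<close> to \<open>t\<close>.\<close>
      define \<xi> where "\<xi> = (\<lambda>i\<in>{..<n}. - ((t i - t (?q i)) + 2 * real_of_int (m i)))"
      have perm: "(\<Sum>i<n. t i * x (p i)) = (\<Sum>i<n. t (?q i) * x i)" for x
        by (subst sum.permute[OF p, of "\<lambda>i. t (?q i) * x i"]) (simp add: permutes_inverses(2)[OF p] o_def)
      have "(LINT x|lborel_n n. G x t) = fourier_n n \<eta> \<xi>"
        unfolding fourier_n_cis
      proof (intro Bochner_Integration.integral_cong refl)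
        fix x assume "x \<in> space (lborel_n n)"
        then have "restrict x {..<n} = x"
          by (auto simp: space_PiM PiE_iff extensional_def fun_eq_iff restrict_def)
        moreover have "2 * pi * (\<Sum>i<n. t i * (x i - x (p i))) + 4 * pi * (\<Sum>i<n. real_of_int (m i) * x i) =
            - 2 * pi * (\<Sum>i<n. x i * \<xi> i)"
        proof -
          have a: "(\<Sum>i<n. t i * (x i - x (p i))) = (\<Sum>i<n. t i * x i) - (\<Sum>i<n. t (?q i) * x i)"
            by (simp add: right_diff_distrib sum_subtractf perm)
          have b: "(\<Sum>i<n. x i * \<xi> i) = - ((\<Sum>i<n. t i * x i) - (\<Sum>i<n. t (?q i) * x i)
              + 2 * (\<Sum>i<n. real_of_int (m i) * x i))"
            by (simp add: \<xi>_def sum_subtractf[symmetric] sum.distrib[symmetric] sum_distrib_left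
                sum_negf[symmetric] algebra_simps del: minus_add_distrib)
          show ?thesis unfolding a b by (simp add: algebra_simps)
        qed
        ultimately show "G x t = \<eta> x * cis (- 2 * pi * (\<Sum>i<n. x i * \<xi> i))"
          by (simp add: G_def ind1 cis_mult mult.assoc)
      qed
      also have "\<dots> = 0"
      proof (rule K_class_fourier_zero[OF \<eta>])
        show "\<xi> \<in> Rn n" by (simp add: \<xi>_def)
        \<comment> \<open>Applied to the constant 1, \<open>perm\<close> says that permuting the
          entries of \<open>t\<close> preserves their sum.\<close>
        have "(\<Sum>i<n. t i) = (\<Sum>i<n. t (?q i))" using perm[of "\<lambda>_. 1"] by simp
        moreover have "(\<Sum>i<n. real_of_int (m i)) = 0" using m(1) by (metis of_int_0 of_int_sum)
        ultimately show "(\<Sum>i<n. \<xi> i) = 0"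
          by (simp add: \<xi>_def sum_subtractf sum.distrib sum_distrib_left[symmetric])
        have "2 \<le> (\<Sum>i<n. \<bar>(t i - t (?q i)) + 2 * real_of_int (m i)\<bar>)"
        proof (rule two_le_sum_abs_shifted[OF m])
          fix i assume "i < n"
          then have "t i \<in> {-(1/2)..1/2}" "t (?q i) \<in> {-(1/2)..1/2}" using True qn by blast+
          then show "\<bar>t i - t (?q i)\<bar> \<le> 1" by auto
        qed
        also have "\<dots> = (\<Sum>i<n. \<bar>\<xi> i\<bar>)"
          by (intro sum.cong) (auto simp: \<xi>_def)
        finally show "2 \<le> (\<Sum>i<n. \<bar>\<xi> i\<bar>)" .
      qed
      finally show ?thesis .
    qed
  qed
  finally show ?thesis by simp
qed

section \<open>Averages over the uniform shift\<close>

abbreviation (input) half_unif :: "real measure" where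
  "half_unif \<equiv> uniform_measure lborel {0..<1/2}"

lemma prob_space_half_unif: "prob_space half_unif"
  by (rule prob_space_uniform_measure) auto

lemma AE_half_unif: "AE u in half_unif. 0 \<le> u \<and> u < 1/2"
  by (rule AE_uniform_measureI) auto

lemma half_unif_eq_density: "half_unif = density lborel (\<lambda>u. 2 * indicator {0..<1/2} u)"
  unfolding uniform_measure_def
proof -
  have "inverse (inverse (ennreal 2)) = ennreal 2"
    by (simp only: inverse_ennreal zero_less_numeral inverse_positive_iff_positive inverse_inverse_eq)
  then have "inverse (inverse 2) = (2 :: ennreal)" by simp
  then show "density lborel (\<lambda>x::real. indicator {0..<1/2} x / emeasure lborel {0..<1/2::real}) =
      density lborel (\<lambda>u. 2 * indicator {0..<1/2} u)"
    by (intro density_cong) (auto simp: divide_ennreal_def mult.commute)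
qed

lemma integral_half_unif:
  fixes g :: "real \<Rightarrow> complex"
  assumes "g \<in> borel_measurable borel"
  shows "(LINT u|half_unif. g u) = 2 * (LINT u|lborel. indicator {0..<1/2} u *\<^sub>R g u)"
proof -
  have "half_unif = density lborel (\<lambda>u. ennreal (2 * indicator {0..<1/2} u))"
    unfolding half_unif_eq_density by (intro density_cong) (auto simp: indicator_def)
  then have "(LINT u|half_unif. g u) = (LINT u|lborel. (2 * indicator {0..<1/2} u) *\<^sub>R g u)"
    using assms by (simp add: integral_density)
  also have "\<dots> = (LINT u|lborel. 2 * (indicator {0..<1/2} u *\<^sub>R g u))"
    by (simp add: scaleR_conv_of_real mult.assoc)
  finally show ?thesis by (simp only: integral_mult_right_zero)
qed

text \<open>Moving the interval by \<open>1/4\<close> onto the centred one only introduces the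
  constant phase \<open>cis (pi * d)\<close>.\<close>

lemma integral_half_unif_cis:
  assumes "d \<noteq> 0"
  shows "(LINT u|half_unif. cis (4 * pi * real_of_int d * u)) = 0"
proof -
  have "(LINT u|lborel. indicator {0..<1/2} u *\<^sub>R cis (4 * pi * real_of_int d * u)) =
     (LINT u|lborel. indicator {0..<1/2} (1/4 + 1 * u) *\<^sub>R cis (4 * pi * real_of_int d * (1/4 + 1 * u)))"
    by (subst lborel_integral_real_affine[of 1 _ "1/4"]) auto
  also have "\<dots> = (LINT u|lborel. cis (pi * real_of_int d) * (indicator {-(1/4)..<1/4} u *\<^sub>R cis (4 * pi * real_of_int d * u)))"
    by (intro Bochner_Integration.integral_cong refl)
      (auto simp: indicator_def cis_mult algebra_simps)
  also have "\<dots> = 0" using assms by (simp only: integral_mult_right_zero integral_cis_cell) simp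
  finally show ?thesis by (subst integral_half_unif) auto
qed

lemma lborel_n_diff_const_measurable:
  "(\<lambda>(x, u). \<lambda>i\<in>{..<n}. x i - u) \<in> measurable (lborel_n n \<Otimes>\<^sub>M borel) (lborel_n n)"
  unfolding case_prod_beta by measurable

text \<open>The Leibniz expansion reduces this to single permutations; every term is dominated by
  the modulus of \<open>\<eta>\<close>, so the sum may leave the integral.\<close>

lemma K_class_det_vanish:
  assumes \<eta>: "\<eta> \<in> K_class n" and m: "(\<Sum>i<n. m i) = 0" "j < n" "m j \<noteq> (0::int)"
  shows "(LINT x|lborel_n n. \<eta> (restrict x {..<n}) * of_real (sine_det n x) *
     cis (4 * pi * (\<Sum>i<n. real_of_int (m i) * x i))) = 0"
proof -
  let ?e = "\<lambda>x. \<eta> (restrict x {..<n})"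
  let ?c = "\<lambda>x. cis (4 * pi * (\<Sum>i<n. real_of_int (m i) * x i))"
  have S: "\<eta> \<in> schwartz n" using \<eta> by (simp add: K_class_def)
  have eM[measurable]: "?e \<in> borel_measurable (lborel_n n)"
    by (rule continuous_measurable_lborel_n[OF schwartz_continuous[OF S]])
  obtain C where "\<And>x. norm (?e x) \<le> C * decay n x" using schwartz_decay[OF S] by blast
  then have eI: "integrable (lborel_n n) ?e"
    by (rule integrable_decay_bound[rotated]) simp
  have sM: "(\<lambda>x. \<Prod>i<n. of_real (S_kernel (x i - x (p i))) :: complex) \<in> borel_measurable (lborel_n n)" for p
    by (intro continuous_measurable_lborel_n continuous_intros) auto
  have i: "integrable (lborel_n n) (\<lambda>x. of_real (signof p) * (?e x * (\<Prod>i<n. of_real (S_kernel (x i - x (p i)))) * ?c x))" for p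
  proof (rule Bochner_Integration.integrable_bound[OF eI])
    show "(\<lambda>x. of_real (signof p) * (?e x * (\<Prod>i<n. of_real (S_kernel (x i - x (p i)))) * ?c x)) \<in> borel_measurable (lborel_n n)"
      by (intro borel_measurable_times sM eM) measurable
    have "norm (\<Prod>i<n. of_real (S_kernel (x i - x (p i))) :: complex) \<le> 1" for x
      by (simp add: prod_norm[symmetric]) (intro prod_le_1, auto intro: S_kernel_abs_le)
    then show "AE x in lborel_n n. norm (of_real (signof p) * (?e x * (\<Prod>i<n. of_real (S_kernel (x i - x (p i)))) * ?c x)) \<le> norm (?e x)"
      by (intro AE_I2) (simp only: norm_mult norm_of_real abs_signof, simp add: mult_left_le)
  qed
  have "(LINT x|lborel_n n. ?e x * of_real (sine_det n x) * ?c x) =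
     (LINT x|lborel_n n. (\<Sum>p | p permutes {..<n}. of_real (signof p) * (?e x * (\<Prod>i<n. of_real (S_kernel (x i - x (p i)))) * ?c x)))"
    unfolding sine_det_perm_sum by (simp add: sum_distrib_left sum_distrib_right mult_ac)
  also have "\<dots> = (\<Sum>p | p permutes {..<n}. (LINT x|lborel_n n. of_real (signof p) * (?e x * (\<Prod>i<n. of_real (S_kernel (x i - x (p i)))) * ?c x)))"
    using i by (rule Bochner_Integration.integral_sum)
  also have "\<dots> = 0"
    using K_class_perm_vanish[OF \<eta> _ m] by (intro sum.neutral) auto
  finally show ?thesis .
qed

text \<open>Poisson summation is not applied to \<open>f\<close> itself, whose coefficients at
  \<open>2 m\<close> with nonzero sum of entries need not vanish. The averaged function
  \<open>F\<close> has all nonzero lattice frequencies equal to 0, and its samples at half-integer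
  points are the required averages.\<close>

lemma K_class_lattice_average:
  assumes \<eta>: "\<eta> \<in> K_class n"
  shows "(1/2) ^ n * (\<Sum>\<^sub>\<infinity>k\<in>int_tuples n. of_real (sine_det n (\<lambda>i. real_of_int (k i) / 2)) *
        (LINT u|half_unif. \<eta> (\<lambda>i\<in>{..<n}. real_of_int (k i) / 2 - u)))
     = (LINT x|lborel_n n. \<eta> x * of_real (sine_det n x))"
proof -
  let ?e = "\<lambda>x. \<eta> (restrict x {..<n})"
  define f where "f x = ?e x * of_real (sine_det n x)" for x
  define F where "F x = (LINT u|half_unif. f (\<lambda>i. x i - u))" for x
  interpret U: prob_space half_unif by (rule prob_space_half_unif)
  have S: "\<eta> \<in> schwartz n" using \<eta> by (simp add: K_class_def)
  obtain C where C: "\<And>x. norm (?e x) \<le> C * decay n x" using schwartz_decay[OF S] by blast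
  have "0 \<le> C * decay n (\<lambda>_. 0)" using C norm_ge_zero order_trans by blast
  then have C0: "0 \<le> C" by (simp add: decay_def)
  define D where "D = C * fact n"
  have D0: "0 \<le> D" using C0 by (simp add: D_def)
  have f_cont: "continuous_on UNIV f"
    unfolding f_def using schwartz_continuous[OF S] sine_det_continuous by (intro continuous_intros) auto
  have f_dep: "f (restrict x {..<n}) = f x" for x
    by (simp add: f_def sine_det_restrict)
  have f_bd: "norm (f x) \<le> D * decay n x" for x
  proof -
    have "norm (f x) \<le> (C * decay n x) * fact n"
      unfolding f_def norm_mult using C sine_det_bound decay_nonneg C0
      by (intro mult_mono) auto
    then show ?thesis by (simp add: D_def mult_ac)
  qed
  have f_shift_cont: "continuous_on UNIV (\<lambda>x. f (\<lambda>i. x i - u))" for u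
    by (intro continuous_on_compose2[OF f_cont] continuous_intros) auto
  have f_shift_cont_u: "continuous_on UNIV (\<lambda>u. f (\<lambda>i. x i - u))" for x
    by (intro continuous_on_compose2[OF f_cont] continuous_intros) auto
  have fu_meas[measurable]: "(\<lambda>u. f (\<lambda>i. x i - u)) \<in> borel_measurable half_unif" for x
    using borel_measurable_continuous_onI[OF f_shift_cont_u] by simp
  \<comment> \<open>A shift in \<open>[0, 1/2)\<close> has modulus at most 1, so the decay survives
    with the factor \<open>3 ^ n\<close>.\<close>
  have f_shift_bd: "norm (f (\<lambda>i. x i - u)) \<le> D * 3 ^ n * decay n x" if "0 \<le> u \<and> u < 1/2" for x u
  proof -
    have "norm (f (\<lambda>i. x i - u)) \<le> D * decay n (\<lambda>i. x i + - u)" using f_bd by simp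
    also have "\<dots> \<le> D * (3 ^ n * decay n x)"
      using that D0 by (intro mult_left_mono decay_shift) auto
    finally show ?thesis by (simp add: mult.assoc)
  qed
  have AE_bd: "AE u in half_unif. norm (f (\<lambda>i. x i - u)) \<le> D * 3 ^ n * decay n x" for x
    using AE_half_unif by eventually_elim (rule f_shift_bd)
  have D_le: "D * 3 ^ n * decay n x \<le> D * 3 ^ n" for x
    using D0 decay_le_1[of n x] by (simp add: mult_left_le)
  have fu_int: "integrable half_unif (\<lambda>u. f (\<lambda>i. x i - u))" for x
    using AE_bd by (rule U.integrable_const_bound) simp
  have F_bd: "norm (F x) \<le> D * 3 ^ n * decay n x" for x
  proof -
    have "norm (F x) \<le> (LINT u|half_unif. norm (f (\<lambda>i. x i - u)))"
      unfolding F_def by (rule integral_norm_bound)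
    also have "\<dots> \<le> (LINT u|half_unif. D * 3 ^ n * decay n x)"
      using fu_int AE_bd by (intro integral_mono_AE) auto
    finally show ?thesis by simp
  qed
  have F_dep: "F (restrict x {..<n}) = F x" for x
  proof -
    have "f (\<lambda>i. restrict x {..<n} i - u) = f (\<lambda>i. x i - u)" for u
      using f_dep[of "\<lambda>i. restrict x {..<n} i - u"] f_dep[of "\<lambda>i. x i - u"]
      by (simp cong: restrict_cong)
    then show ?thesis by (simp add: F_def)
  qed
  \<comment> \<open>Sequential continuity suffices, and dominated convergence moves the limit inside
    the average.\<close>
  have F_cont: "continuous_on UNIV F"
    unfolding continuous_on_sequentially
  proof (intro allI ballI impI)
    fix X :: "nat \<Rightarrow> nat \<Rightarrow> real" and a assume X: "(\<forall>k. X k \<in> UNIV) \<and> X \<longlonglongrightarrow> a"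
    have "(\<lambda>k. LINT u|half_unif. f (\<lambda>i. X k i - u)) \<longlonglongrightarrow> (LINT u|half_unif. f (\<lambda>i. a i - u))"
    proof (rule integral_dominated_convergence[where w = "\<lambda>_. D * 3 ^ n"])
      show "AE u in half_unif. (\<lambda>k. f (\<lambda>i. X k i - u)) \<longlonglongrightarrow> f (\<lambda>i. a i - u)"
        using X f_shift_cont unfolding continuous_on_sequentially o_def by auto
      show "AE u in half_unif. norm (f (\<lambda>i. X k i - u)) \<le> D * 3 ^ n" for k
        using AE_bd[of "X k"] by eventually_elim (rule order_trans[OF _ D_le])
    qed auto
    then show "(F \<circ> X) \<longlonglongrightarrow> F a" by (simp add: F_def o_def)
  qed
  have f_meas[measurable]: "f \<in> borel_measurable (lborel_n n)"
    by (rule continuous_measurable_lborel_n[OF f_cont])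
  have fI: "integrable (lborel_n n) f"
    using f_bd by (rule integrable_decay_bound[rotated]) simp
  interpret L: sigma_finite_measure "lborel_n n"
    by (rule lborel_product.sigma_finite) simp
  interpret LU: pair_sigma_finite "lborel_n n" half_unif ..
  \<comment> \<open>Translating the integration variable by \<open>u\<close> separates a phase,
    which is averaged over \<open>u\<close>, from the coefficient of \<open>f\<close>.\<close>
  have fourier: "(LINT x|lborel_n n. F x * cis (4 * pi * (\<Sum>i<n. real_of_int (m i) * x i))) =
     (LINT u|half_unif. cis (4 * pi * real_of_int (\<Sum>i<n. m i) * u)) *
     (LINT x|lborel_n n. f x * cis (4 * pi * (\<Sum>i<n. real_of_int (m i) * x i)))" for m
  proof -
    let ?c = "\<lambda>x. cis (4 * pi * (\<Sum>i<n. real_of_int (m i) * x i))"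
    define G where "G x u = f (\<lambda>i. x i - u) * ?c x" for x u
    have G_meas: "(\<lambda>(x, u). G x u) \<in> borel_measurable (lborel_n n \<Otimes>\<^sub>M half_unif)"
    proof -
      have "(\<lambda>(x, u). f (\<lambda>i\<in>{..<n}. x i - u)) \<in> borel_measurable (lborel_n n \<Otimes>\<^sub>M borel)"
        using measurable_compose[OF lborel_n_diff_const_measurable f_meas] by (simp add: case_prod_beta)
      moreover have "f (\<lambda>i\<in>{..<n}. x i - u) = f (\<lambda>i. x i - u)" for x u
        using f_dep[of "\<lambda>i. x i - u"] by simp
      ultimately have "(\<lambda>(x, u). f (\<lambda>i. x i - u)) \<in> borel_measurable (lborel_n n \<Otimes>\<^sub>M borel)" by simp
      then have "(\<lambda>(x, u). G x u) \<in> borel_measurable (lborel_n n \<Otimes>\<^sub>M borel)"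
        unfolding G_def case_prod_beta by measurable
      moreover have "sets (lborel_n n \<Otimes>\<^sub>M half_unif) = sets (lborel_n n \<Otimes>\<^sub>M borel)"
        by (intro sets_pair_measure_cong) auto
      ultimately show ?thesis by (simp cong: measurable_cong_sets)
    qed
    have nG: "norm (G x u) = norm (f (\<lambda>i. x i - u))" for x u by (simp add: G_def norm_mult)
    have GI: "integrable (lborel_n n \<Otimes>\<^sub>M half_unif) (\<lambda>(x, u). G x u)"
    proof (rule LU.Fubini_integrable[OF G_meas])
      show "integrable (lborel_n n) (\<lambda>x. LINT u|half_unif. norm (case (x, u) of (x, u) \<Rightarrow> G x u))"
      proof (rule Bochner_Integration.integrable_bound)
        show "integrable (lborel_n n) (\<lambda>x. D * 3 ^ n * decay n x)" using decay_integrable by simp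
        show "(\<lambda>x. LINT u|half_unif. norm (case (x, u) of (x, u) \<Rightarrow> G x u)) \<in> borel_measurable (lborel_n n)"
          by (intro U.borel_measurable_lebesgue_integral) (use G_meas in \<open>simp add: case_prod_beta\<close>)
        have "\<bar>LINT u|half_unif. norm (G x u)\<bar> \<le> D * 3 ^ n * decay n x" for x
        proof -
          have "(LINT u|half_unif. norm (G x u)) \<le> (LINT u|half_unif. D * 3 ^ n * decay n x)"
            unfolding nG using fu_int AE_bd by (intro integral_mono_AE) auto
          then show ?thesis by simp
        qed
        then show "AE x in lborel_n n. norm (LINT u|half_unif. norm (case (x, u) of (x, u) \<Rightarrow> G x u)) \<le> norm (D * 3 ^ n * decay n x)"
          by (intro AE_I2) (auto intro: order_trans[OF _ abs_ge_self])
      qed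
      show "AE x in lborel_n n. integrable half_unif (\<lambda>u. case (x, u) of (x, u) \<Rightarrow> G x u)"
        using fu_int by (auto simp: G_def)
    qed
    have "(LINT x|lborel_n n. F x * ?c x) = (LINT x|lborel_n n. (LINT u|half_unif. G x u))"
      by (simp add: F_def G_def)
    also have "\<dots> = (LINT u|half_unif. (LINT x|lborel_n n. G x u))"
      by (rule LU.Fubini_integral[OF GI, symmetric])
    also have "\<dots> = (LINT u|half_unif. cis (4 * pi * real_of_int (\<Sum>i<n. m i) * u) * (LINT x|lborel_n n. f x * ?c x))"
    proof (intro Bochner_Integration.integral_cong refl)
      fix u
      have cM: "(\<lambda>x. f x * ?c x * cis (4 * pi * real_of_int (\<Sum>i<n. m i) * u)) \<in> borel_measurable (lborel_n n)"
        by measurable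
      have "(LINT x|lborel_n n. G x u) = (LINT x|lborel_n n. f (\<lambda>i\<in>{..<n}. x i + - u) *
          ?c (\<lambda>i\<in>{..<n}. x i + - u) * cis (4 * pi * real_of_int (\<Sum>i<n. m i) * u))"
      proof (intro Bochner_Integration.integral_cong refl)
        fix x
        have "f (\<lambda>i\<in>{..<n}. x i + - u) = f (\<lambda>i. x i - u)"
          using f_dep[of "\<lambda>i. x i - u"] by simp
        moreover have "4 * pi * (\<Sum>i<n. real_of_int (m i) * (\<lambda>i\<in>{..<n}. x i + - u) i) + 4 * pi * real_of_int (\<Sum>i<n. m i) * u
           = 4 * pi * (\<Sum>i<n. real_of_int (m i) * x i)"
          by (simp add: algebra_simps sum_subtractf sum_distrib_left sum_distrib_right)
        ultimately show "G x u = f (\<lambda>i\<in>{..<n}. x i + - u) *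
          ?c (\<lambda>i\<in>{..<n}. x i + - u) * cis (4 * pi * real_of_int (\<Sum>i<n. m i) * u)"
          by (simp only: G_def mult.assoc cis_mult)
      qed
      also have "\<dots> = (LINT x|lborel_n n. f x * ?c x * cis (4 * pi * real_of_int (\<Sum>i<n. m i) * u))"
        by (rule lborel_n_shift_integral[OF cM, of "\<lambda>_. - u"])
      finally show "(LINT x|lborel_n n. G x u) =
        cis (4 * pi * real_of_int (\<Sum>i<n. m i) * u) * (LINT x|lborel_n n. f x * ?c x)"
        by (simp only: integral_mult_left_zero) (rule mult.commute)
    qed
    finally show ?thesis by (simp only: integral_mult_left_zero)
  qed
  have restr: "restrict x {..<n} = x" if "x \<in> space (lborel_n n)" for x
    using that by (auto simp: space_PiM PiE_iff extensional_def fun_eq_iff restrict_def)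
  have "(1/2) ^ n * (\<Sum>\<^sub>\<infinity>k\<in>int_tuples n. F (\<lambda>i. real_of_int (k i) / 2)) = (LINT x|lborel_n n. F x)"
  proof (rule poisson_half_lattice[OF F_cont F_dep F_bd])
    fix m :: "nat \<Rightarrow> int" assume "\<exists>i<n. m i \<noteq> 0"
    then obtain j where j: "j < n" "m j \<noteq> 0" by blast
    show "(LINT x|lborel_n n. F x * cis (4 * pi * (\<Sum>i<n. real_of_int (m i) * x i))) = 0"
    proof (cases "(\<Sum>i<n. m i) = 0")
      case True
      then show ?thesis
        using K_class_det_vanish[OF \<eta> True j] by (simp add: fourier f_def)
    next
      case False
      then show ?thesis unfolding fourier by (simp only: integral_half_unif_cis[OF False] mult_zero_left)
    qed
  qed
  \<comment> \<open>Frequency 0 in \<open>fourier\<close>: averaging over shifts preserves the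
    integral.\<close>
  also have "(LINT x|lborel_n n. F x) = (LINT x|lborel_n n. f x)"
    using fourier[of "\<lambda>_. 0"] U.prob_space by simp
  also have "\<dots> = (LINT x|lborel_n n. \<eta> x * of_real (sine_det n x))"
    by (intro Bochner_Integration.integral_cong refl) (simp add: f_def restr)
  finally have "(1/2) ^ n * (\<Sum>\<^sub>\<infinity>k\<in>int_tuples n. F (\<lambda>i. real_of_int (k i) / 2)) =
     (LINT x|lborel_n n. \<eta> x * of_real (sine_det n x))" .
  moreover have "F (\<lambda>i. real_of_int (k i) / 2) = of_real (sine_det n (\<lambda>i. real_of_int (k i) / 2)) *
        (LINT u|half_unif. \<eta> (\<lambda>i\<in>{..<n}. real_of_int (k i) / 2 - u))" for k
  proof -
    have "F (\<lambda>i. real_of_int (k i) / 2) = (LINT u|half_unif. of_real (sine_det n (\<lambda>i. real_of_int (k i) / 2)) *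
        \<eta> (\<lambda>i\<in>{..<n}. real_of_int (k i) / 2 - u))"
      unfolding F_def f_def
      using sine_det_shift[of n "\<lambda>i. real_of_int (k i) / 2" "- u" for u] by (simp add: mult.commute)
    then show ?thesis by simp
  qed
  ultimately show ?thesis by simp
qed

section \<open>The half-discrete sine process\<close>

text \<open>Regroups a sum over \<open>J\<close> by the values of \<open>f\<close>; finite fibres
  become multiplicities. The two summability conditions are compared first, so that both sums
  default to 0 together when they fail.\<close>

lemma
  fixes h :: "'k \<Rightarrow> complex"
  assumes f: "\<And>j. j \<in> J \<Longrightarrow> f j \<in> K" and fin: "\<And>k. k \<in> K \<Longrightarrow> finite {j\<in>J. f j = k}"
  shows summable_on_fibres: "(\<lambda>j. norm (h (f j))) summable_on J \<longleftrightarrow>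
        (\<lambda>k. norm (of_nat (card {j\<in>J. f j = k}) * h k)) summable_on K"
    and infsum_fibres: "(\<Sum>\<^sub>\<infinity>j\<in>J. h (f j)) = (\<Sum>\<^sub>\<infinity>k\<in>K. of_nat (card {j\<in>J. f j = k}) * h k)"
proof -
  let ?B = "\<lambda>k. {j\<in>J. f j = k}"
  have bij: "bij_betw (\<lambda>j. (f j, j)) J (Sigma K ?B)"
    using f by (intro bij_betw_imageI) (auto simp: inj_on_def)
  let ?h = "\<lambda>(k, j). h k"
  have inner: "(\<Sum>\<^sub>\<infinity>y\<in>?B k. norm (?h (k, y))) = norm (of_nat (card (?B k)) * h k)" if "k \<in> K" for k
    using fin[OF that] by (simp add: norm_mult)
  have "(\<lambda>j. norm (h (f j))) summable_on J \<longleftrightarrow> (\<lambda>p. norm (?h p)) summable_on Sigma K ?B"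
    using summable_on_reindex_bij_betw[OF bij, of "\<lambda>p. norm (?h p)"] by simp
  also have "\<dots> \<longleftrightarrow> (\<lambda>k. \<Sum>\<^sub>\<infinity>y\<in>?B k. norm (?h (k, y))) summable_on K"
    using fin unfolding Infinite_Sum.abs_summable_on_Sigma_iff by (simp add: infsum_nonneg)
  also have "\<dots> \<longleftrightarrow> (\<lambda>k. norm (of_nat (card (?B k)) * h k)) summable_on K"
    by (rule summable_on_cong) (rule inner)
  finally show iff: "(\<lambda>j. norm (h (f j))) summable_on J \<longleftrightarrow>
     (\<lambda>k. norm (of_nat (card (?B k)) * h k)) summable_on K" .
  show "(\<Sum>\<^sub>\<infinity>j\<in>J. h (f j)) = (\<Sum>\<^sub>\<infinity>k\<in>K. of_nat (card (?B k)) * h k)"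
  proof (cases "(\<lambda>j. h (f j)) summable_on J")
    case True
    then have "?h summable_on Sigma K ?B"
      using summable_on_reindex_bij_betw[OF bij, of ?h] by simp
    then have "(\<Sum>\<^sub>\<infinity>k\<in>K. \<Sum>\<^sub>\<infinity>j\<in>?B k. ?h (k, j)) = (\<Sum>\<^sub>\<infinity>p\<in>Sigma K ?B. ?h p)"
      by (rule infsum_Sigma_banach)
    also have "\<dots> = (\<Sum>\<^sub>\<infinity>j\<in>J. h (f j))"
      using infsum_reindex_bij_betw[OF bij, of ?h] by simp
    finally have "(\<Sum>\<^sub>\<infinity>j\<in>J. h (f j)) = (\<Sum>\<^sub>\<infinity>k\<in>K. \<Sum>\<^sub>\<infinity>j\<in>?B k. ?h (k, j))" ..
    also have "\<dots> = (\<Sum>\<^sub>\<infinity>k\<in>K. of_nat (card (?B k)) * h k)"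
      using fin by (intro infsum_cong) simp
    finally show ?thesis .
  next
    case False
    then have "\<not> (\<lambda>k. of_nat (card (?B k)) * h k) summable_on K"
      using iff by (simp add: summable_on_iff_abs_summable_on_complex)
    with False show ?thesis by (simp add: infsum_not_exists)
  qed
qed

text \<open>A continuous stand-in for the indicator of one lattice point: the tents have radius 1/4,
  below the spacing 1/2, so no second half-integer is seen.\<close>

definition bump :: "nat \<Rightarrow> (nat \<Rightarrow> int) \<Rightarrow> (nat \<Rightarrow> real) \<Rightarrow> complex" where
  "bump n k x = of_real (\<Prod>i<n. max 0 (1 - 4 * \<bar>x i - real_of_int (k i) / 2\<bar>))"

lemma bump_C_c: "bump n k \<in> C_c n"
proof -
  let ?T = "powertop_real {..<n}"
  let ?box = "Pi\<^sub>E {..<n} (\<lambda>i. {real_of_int (k i) / 2 - 1/4 .. real_of_int (k i) / 2 + 1/4})"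
  have "continuous_map ?T euclideanreal (\<lambda>x. \<Prod>i<n. max 0 (1 - 4 * \<bar>x i - real_of_int (k i) / 2\<bar>))"
    by (intro continuous_map_prod continuous_map_real_max continuous_map_diff
       continuous_map_real_mult continuous_map_real_abs continuous_map_product_projection) auto
  then have "continuous_map ?T euclidean
      (complex_of_real \<circ> (\<lambda>x. \<Prod>i<n. max 0 (1 - 4 * \<bar>x i - real_of_int (k i) / 2\<bar>)))"
    by (rule continuous_map_compose) (auto intro: continuous_intros)
  then have "continuous_map ?T euclidean (bump n k)"
    by (simp add: bump_def[abs_def] o_def)
  moreover have box: "compactin ?T ?box"
    by (simp add: compactin_PiE)
  moreover have "support_n n (bump n k) \<subseteq> ?box"
    unfolding support_n_def
  proof (rule closure_of_minimal)
    show "{x \<in> Rn n. bump n k x \<noteq> 0} \<subseteq> ?box"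
    proof
      fix x assume x: "x \<in> {x \<in> Rn n. bump n k x \<noteq> 0}"
      have "x i \<in> {real_of_int (k i) / 2 - 1/4 .. real_of_int (k i) / 2 + 1/4}" if "i < n" for i
      proof (rule ccontr)
        assume "\<not> ?thesis"
        then have "max 0 (1 - 4 * \<bar>x i - real_of_int (k i) / 2\<bar>) = 0" by auto
        then have "bump n k x = 0" unfolding bump_def using that by (auto intro!: bexI[of _ i])
        with x show False by simp
      qed
      with x show "x \<in> ?box" by (auto simp: PiE_iff)
    qed
    show "closedin ?T ?box"
      by (simp add: closedin_product_topology)
  qed
  ultimately show ?thesis
    unfolding C_c_def using closed_compactin[OF box] by (simp add: support_n_def)
qed

lemma bump_half_ints:
  assumes "\<And>i. i < n \<Longrightarrow> x i \<in> half_ints"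
  shows "bump n k x = (if \<forall>i<n. x i = real_of_int (k i) / 2 then 1 else 0)"
proof (cases "\<forall>i<n. x i = real_of_int (k i) / 2")
  case True
  then have "(\<Prod>i<n. max 0 (1 - 4 * \<bar>x i - real_of_int (k i) / 2\<bar>)) = 1"
    by (intro prod.neutral) auto
  then have "bump n k x = of_real 1" unfolding bump_def by (simp only:)
  with True show ?thesis by simp
next
  case False
  then obtain i where i: "i < n" "x i \<noteq> real_of_int (k i) / 2" by blast
  then obtain m :: int where m: "x i = real_of_int m / 2" using assms[of i] by (auto simp: half_ints_def)
  with i have "m \<noteq> k i" by auto
  \<comment> \<open>Distinct half-integers are at least 1/2 apart, beyond the radius 1/4 of the
    tent.\<close>
  then have "1 \<le> \<bar>real_of_int m - real_of_int (k i)\<bar>" by linarith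
  then have "1 - 4 * \<bar>x i - real_of_int (k i) / 2\<bar> \<le> 0"
    by (simp add: m abs_divide flip: diff_divide_distrib)
  then have "max 0 (1 - 4 * \<bar>x i - real_of_int (k i) / 2\<bar>) = 0" by simp
  then have "bump n k x = 0" unfolding bump_def using i by (auto intro!: bexI[of _ i])
  with False show ?thesis by simp
qed

text \<open>Two points at the same site give equal rows; this is what forbids double points.\<close>

lemma sine_det_repeated:
  assumes "i < n" "j < n" "i \<noteq> j" "x i = x j"
  shows "sine_det n x = 0"
  unfolding sine_det_def
  using assms by (intro det_identical_rows[of _ n i j]) (auto simp: vec_eq_iff)

section \<open>Occupied sites of the discrete process\<close>

locale half_sine_process = prob_space M for M :: "'a measure" +
  fixes w :: "int \<Rightarrow> 'a \<Rightarrow> real"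
  assumes process: "half_discrete_sine_process M w"
begin

lemma w_in_half_ints: "\<omega> \<in> space M \<Longrightarrow> w j \<omega> \<in> half_ints"
  using process by (auto simp: half_discrete_sine_process_def)

lemma w_half_int: "\<omega> \<in> space M \<Longrightarrow> \<exists>m. w j \<omega> = real_of_int m / 2"
  using w_in_half_ints[of \<omega> j] by (auto simp: half_ints_def)

lemma w_finite: "\<omega> \<in> space M \<Longrightarrow> bounded B \<Longrightarrow> finite {j. w j \<omega> \<in> B}"
  using process by (auto simp: half_discrete_sine_process_def point_process_def)

lemma counts_measurable [measurable]: "counts w \<in> measurable M config_space"
  using process by (auto simp: half_discrete_sine_process_def point_process_def)

text \<open>Coincident points give several labellings of the same sites. Only the cardinality enters
  expectations, so a nonmeasurable labelling does no harm.\<close>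

definition labels :: "nat \<Rightarrow> (nat \<Rightarrow> int) \<Rightarrow> 'a \<Rightarrow> (nat \<Rightarrow> int) set" where
  "labels n k \<omega> = {js \<in> distinct_tuples n. \<forall>i<n. w (js i) \<omega> = real_of_int (k i) / 2}"

lemma finite_labels:
  assumes "\<omega> \<in> space M" shows "finite (labels n k \<omega>)"
proof (rule finite_subset)
  show "labels n k \<omega> \<subseteq> Pi\<^sub>E {..<n} (\<lambda>i. {j. w j \<omega> \<in> {real_of_int (k i) / 2}})"
    by (fastforce simp: labels_def distinct_tuples_def PiE_iff extensional_def)
  show "finite (Pi\<^sub>E {..<n} (\<lambda>i. {j. w j \<omega> \<in> {real_of_int (k i) / 2}}))"
    using assms by (intro finite_PiE w_finite) auto
qed

text \<open>Testing against one \<open>bump\<close> collapses both sides of the correlation identity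
  to a single term. The measurability of the cardinality comes with it.\<close>

lemma expectation_card_labels:
  assumes "n \<ge> 1"
  shows "has_bochner_integral M (\<lambda>\<omega>. real (card (labels n k \<omega>)))
    ((1/2) ^ n * sine_det n (\<lambda>i. real_of_int (k i) / 2))"
proof -
  let ?k = "\<lambda>i\<in>{..<n}. real_of_int (k i) / 2"
  have "has_bochner_integral M
      (\<lambda>\<omega>. \<Sum>\<^sub>\<infinity>js\<in>distinct_tuples n. bump n k (point_tuple n w \<omega> js))
      ((1/2) ^ n * (\<Sum>\<^sub>\<infinity>x\<in>{..<n} \<rightarrow>\<^sub>E half_ints. bump n k x * of_real (sine_det n x)))"
    using process assms bump_C_c by (auto simp: half_discrete_sine_process_def)
  moreover have "(\<Sum>\<^sub>\<infinity>js\<in>distinct_tuples n. bump n k (point_tuple n w \<omega> js)) = of_real (real (card (labels n k \<omega>)))"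
    if "\<omega> \<in> space M" for \<omega>
  proof -
    have b: "bump n k (point_tuple n w \<omega> js) = (if \<forall>i<n. w (js i) \<omega> = real_of_int (k i) / 2 then 1 else 0)" for js
      using w_in_half_ints[OF that]
      by (subst bump_half_ints) (auto simp: point_tuple_def)
    have "(\<Sum>\<^sub>\<infinity>js\<in>distinct_tuples n. bump n k (point_tuple n w \<omega> js)) = (\<Sum>\<^sub>\<infinity>js\<in>labels n k \<omega>. 1)"
      by (rule infsum_cong_neutral) (auto simp: labels_def b)
    then show ?thesis using finite_labels[OF that] by simp
  qed
  moreover have "(\<Sum>\<^sub>\<infinity>x\<in>{..<n} \<rightarrow>\<^sub>E half_ints. bump n k x * of_real (sine_det n x)) =
      of_real (sine_det n (\<lambda>i. real_of_int (k i) / 2))"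
  proof -
    have k: "?k \<in> {..<n} \<rightarrow>\<^sub>E half_ints" by (auto simp: half_ints_def)
    have eq: "x = ?k" if "x \<in> {..<n} \<rightarrow>\<^sub>E half_ints" "\<forall>i<n. x i = real_of_int (k i) / 2" for x
      using that by (auto simp: PiE_iff extensional_def fun_eq_iff)
    have "(\<Sum>\<^sub>\<infinity>x\<in>{..<n} \<rightarrow>\<^sub>E half_ints. bump n k x * of_real (sine_det n x)) =
        (\<Sum>\<^sub>\<infinity>x\<in>{?k}. bump n k x * of_real (sine_det n x))"
    proof (rule infsum_cong_neutral)
      fix x assume x: "x \<in> ({..<n} \<rightarrow>\<^sub>E half_ints) - {?k}"
      then have "\<not> (\<forall>i<n. x i = real_of_int (k i) / 2)" using eq by blast
      moreover have "bump n k x = (if \<forall>i<n. x i = real_of_int (k i) / 2 then 1 else 0)"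
        using x by (intro bump_half_ints) auto
      ultimately have "bump n k x = 0" by (simp only: if_False)
      then show "bump n k x * of_real (sine_det n x) = 0" by simp
    qed (use k in auto)
    also have "\<dots> = of_real (sine_det n ?k)" by (simp add: bump_def)
    finally show ?thesis using sine_det_restrict[of n "\<lambda>i. real_of_int (k i) / 2"] by simp
  qed
  ultimately have "has_bochner_integral M (\<lambda>\<omega>. complex_of_real (real (card (labels n k \<omega>))))
     ((1/2) ^ n * of_real (sine_det n (\<lambda>i. real_of_int (k i) / 2)))"
    by (simp cong: has_bochner_integral_cong)
  then have "integrable M (\<lambda>\<omega>. complex_of_real (real (card (labels n k \<omega>))))"
    "(LINT \<omega>|M. complex_of_real (real (card (labels n k \<omega>)))) = of_real ((1/2) ^ n * sine_det n (\<lambda>i. real_of_int (k i) / 2))"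
    by (auto simp: has_bochner_integral_iff)
  then show ?thesis
    unfolding has_bochner_integral_iff complex_of_real_integrable_eq integral_complex_of_real of_real_eq_iff
    by blast
qed

text \<open>A double point at site \<open>a\<close> contributes a pair to
  \<open>labels 2 (\<lambda>_. a)\<close>, whose expected cardinality is a multiple of a determinant
  with equal rows. There are only countably many sites.\<close>

lemma AE_inj: "AE \<omega> in M. inj (\<lambda>j. w j \<omega>)"
proof -
  have "AE \<omega> in M. real (card (labels 2 (\<lambda>_. a) \<omega>)) = 0" for a
  proof -
    have "has_bochner_integral M (\<lambda>\<omega>. real (card (labels 2 (\<lambda>_. a) \<omega>))) 0"
      using expectation_card_labels[of 2 "\<lambda>_. a"] sine_det_repeated[of 0 2 1 "\<lambda>_. real_of_int a / 2"] by simp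
    then show ?thesis
      by (subst integral_nonneg_eq_0_iff_AE[symmetric]) (auto simp: has_bochner_integral_iff)
  qed
  then have "AE \<omega> in M. \<forall>a. real (card (labels 2 (\<lambda>_. a) \<omega>)) = 0"
    by (simp add: AE_all_countable)
  then show ?thesis
    using AE_space
  proof eventually_elim
    case (elim \<omega>)
    show ?case
    proof (rule injI, rule ccontr)
      fix i j assume ij: "w i \<omega> = w j \<omega>" "i \<noteq> j"
      obtain a where a: "w i \<omega> = real_of_int a / 2" using w_half_int elim by blast
      have "(\<lambda>l\<in>{..<2::nat}. if l = 0 then i else j) \<in> labels 2 (\<lambda>_. a) \<omega>"
        using ij a by (simp add: labels_def distinct_tuples_def inj_on_def less_2_cases_iff) auto
      then have "card (labels 2 (\<lambda>_. a) \<omega>) \<noteq> 0" using finite_labels elim by auto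
      then show False using elim by simp
    qed
  qed
qed

text \<open>Singleton counts suffice: as all points are half-integers, they determine every other
  count.\<close>

definition occ :: "'a \<Rightarrow> int \<Rightarrow> nat" where
  "occ \<omega> a = counts w \<omega> {real_of_int a / 2}"

lemma occ_eq: "occ \<omega> a = card {j. w j \<omega> = real_of_int a / 2}"
  by (simp add: occ_def counts_def bounded_borel_def)

lemma occ_pos_iff: "\<omega> \<in> space M \<Longrightarrow> 1 \<le> occ \<omega> a \<longleftrightarrow> (\<exists>j. w j \<omega> = real_of_int a / 2)"
  using w_finite[of \<omega> "{real_of_int a / 2}"] by (auto simp: occ_eq Suc_le_eq card_gt_0_iff)

text \<open>Without double points every occupied site has one label, so a labelling is unique if it
  exists. This expresses the cardinality through the counts, the data assumed independent of
  \<open>U\<close>.\<close>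

lemma card_labels_inj:
  assumes \<omega>: "\<omega> \<in> space M" and inj: "inj (\<lambda>j. w j \<omega>)"
  shows "card (labels n k \<omega>) = (if inj_on k {..<n} \<and> (\<forall>i<n. 1 \<le> occ \<omega> (k i)) then 1 else 0)"
proof (cases "labels n k \<omega> = {}")
  case True
  have "\<not> (inj_on k {..<n} \<and> (\<forall>i<n. 1 \<le> occ \<omega> (k i)))"
  proof
    assume as: "inj_on k {..<n} \<and> (\<forall>i<n. 1 \<le> occ \<omega> (k i))"
    then have "\<forall>i. \<exists>j. i < n \<longrightarrow> w j \<omega> = real_of_int (k i) / 2"
      using occ_pos_iff[OF \<omega>] by blast
    then obtain js where js: "\<And>i. i < n \<Longrightarrow> w (js i) \<omega> = real_of_int (k i) / 2"
      by metis
    have "inj_on js {..<n}"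
    proof (rule inj_onI)
      fix a b assume ab: "a \<in> {..<n}" "b \<in> {..<n}" "js a = js b"
      then have "k a = k b" using js[of a] js[of b] by simp
      then show "a = b" using as ab by (auto dest: inj_onD)
    qed
    then have "restrict js {..<n} \<in> labels n k \<omega>"
      using js by (simp add: labels_def distinct_tuples_def inj_on_restrict_eq)
    with True show False by simp
  qed
  with True show ?thesis by simp
next
  case False
  then obtain js where js: "js \<in> labels n k \<omega>" by blast
  have "js' = js" if "js' \<in> labels n k \<omega>" for js'
  proof -
    have "w (js' i) \<omega> = w (js i) \<omega>" if "i < n" for i
      using js \<open>js' \<in> _\<close> that unfolding labels_def mem_Collect_eq by metis
    then have eq: "js' i = js i" if "i < n" for i
      using injD[OF inj] that by blast
    have "js \<in> extensional {..<n}" "js' \<in> extensional {..<n}"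
      using js that by (auto simp: labels_def distinct_tuples_def PiE_iff)
    then show ?thesis
      using eq by (intro extensionalityI) auto
  qed
  then have "labels n k \<omega> = {js}" using js by blast
  moreover have "inj_on k {..<n}"
  proof (rule inj_onI)
    fix a b assume ab: "a \<in> {..<n}" "b \<in> {..<n}" "k a = k b"
    then have "w (js a) \<omega> = w (js b) \<omega>"
      using js unfolding labels_def mem_Collect_eq lessThan_iff by metis
    then have "js a = js b" by (rule injD[OF inj])
    then show "a = b" using js ab by (auto simp: labels_def distinct_tuples_def dest: inj_onD)
  qed
  moreover have "\<forall>i<n. 1 \<le> occ \<omega> (k i)"
    using js occ_pos_iff[OF \<omega>] by (auto simp: labels_def)
  ultimately show ?thesis by simp
qed

end

section \<open>The randomly shifted process and its correlations\<close>

locale half_sine_shift = half_sine_process M w for M :: "'a measure" and w :: "int \<Rightarrow> 'a \<Rightarrow> real" +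
  fixes U :: "'a \<Rightarrow> real"
  assumes U_measurable [measurable]: "U \<in> borel_measurable M"
    and U_distr: "distr M borel U = half_unif"
    and U_indep: "indep_set {counts w -` A \<inter> space M | A. A \<in> sets config_space}
          {U -` B \<inter> space M | B. B \<in> sets borel}"
begin

definition shifted :: "int \<Rightarrow> 'a \<Rightarrow> real" where
  "shifted j \<omega> = w j \<omega> - U \<omega>"

text \<open>Independence is stated for the sigma-algebra of the counts; passing through
  \<open>r\<close> yields the joint law of \<open>U\<close> with the counts themselves and with the
  occupation numbers alike.\<close>

lemma joint_law:
  assumes r[measurable]: "r \<in> measurable config_space N"
  shows "distr M (N \<Otimes>\<^sub>M borel) (\<lambda>\<omega>. (r (counts w \<omega>), U \<omega>)) =
     distr M N (\<lambda>\<omega>. r (counts w \<omega>)) \<Otimes>\<^sub>M half_unif"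
proof (rule pair_measure_eqI[symmetric])
  let ?D = "distr M N (\<lambda>\<omega>. r (counts w \<omega>))"
  interpret c: prob_space ?D by (rule prob_space_distr) simp
  show "sigma_finite_measure ?D" ..
  interpret u: prob_space half_unif by (rule prob_space_half_unif)
  show "sigma_finite_measure half_unif" ..
  show "sets (?D \<Otimes>\<^sub>M half_unif) = sets (distr M (N \<Otimes>\<^sub>M borel) (\<lambda>\<omega>. (r (counts w \<omega>), U \<omega>)))"
    by (simp cong: sets_pair_measure_cong)
  fix A B assume "A \<in> sets ?D" "B \<in> sets half_unif"
  then have A[measurable]: "A \<in> sets N" and B[measurable]: "B \<in> sets borel" by auto
  define R where "R = r -` A \<inter> space config_space"
  have A': "(\<lambda>\<omega>. r (counts w \<omega>)) -` A \<inter> space M = counts w -` R \<inter> space M"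
    using measurable_space[OF counts_measurable] by (auto simp: R_def)
  have "R \<in> sets config_space" unfolding R_def by measurable
  then have "prob (((\<lambda>\<omega>. r (counts w \<omega>)) -` A \<inter> space M) \<inter> (U -` B \<inter> space M)) =
      prob ((\<lambda>\<omega>. r (counts w \<omega>)) -` A \<inter> space M) * prob (U -` B \<inter> space M)"
    using B unfolding A' by (intro indep_setD[OF U_indep]) auto
  then have "emeasure M (((\<lambda>\<omega>. r (counts w \<omega>)) -` A \<inter> space M) \<inter> (U -` B \<inter> space M)) =
      emeasure M ((\<lambda>\<omega>. r (counts w \<omega>)) -` A \<inter> space M) * emeasure M (U -` B \<inter> space M)"
    by (simp add: emeasure_eq_measure ennreal_mult)
  moreover have "emeasure half_unif B = emeasure M (U -` B \<inter> space M)"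
    unfolding U_distr[symmetric] by (rule emeasure_distr) auto
  moreover have "(\<lambda>\<omega>. (r (counts w \<omega>), U \<omega>)) -` (A \<times> B) \<inter> space M =
      ((\<lambda>\<omega>. r (counts w \<omega>)) -` A \<inter> space M) \<inter> (U -` B \<inter> space M)" by auto
  ultimately show "emeasure ?D A * emeasure half_unif B =
      emeasure (distr M (N \<Otimes>\<^sub>M borel) (\<lambda>\<omega>. (r (counts w \<omega>), U \<omega>))) (A \<times> B)"
    by (simp add: emeasure_distr)
qed

lemma AE_U: "AE \<omega> in M. 0 \<le> U \<omega> \<and> U \<omega> < 1/2"
proof -
  have "AE u in distr M borel U. 0 \<le> u \<and> u < 1/2"
    unfolding U_distr by (rule AE_half_unif)
  then show ?thesis by (subst (asm) AE_distr_iff) auto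
qed

text \<open>Tuples are grouped by the sites they occupy: the fibre over \<open>k\<close> is
  \<open>labels n k \<omega>\<close>, and \<open>\<eta>\<close> takes the same value on the whole
  fibre.\<close>

lemma
  fixes \<eta> :: "(nat \<Rightarrow> real) \<Rightarrow> complex"
  assumes \<omega>: "\<omega> \<in> space M"
  shows summable_labels: "(\<lambda>js. norm (\<eta> (point_tuple n shifted \<omega> js))) summable_on distinct_tuples n \<longleftrightarrow>
      (\<lambda>k. norm (of_nat (card (labels n k \<omega>)) * \<eta> (\<lambda>i\<in>{..<n}. real_of_int (k i) / 2 - U \<omega>))) summable_on int_tuples n"
    and infsum_labels: "(\<Sum>\<^sub>\<infinity>js\<in>distinct_tuples n. \<eta> (point_tuple n shifted \<omega> js)) =
      (\<Sum>\<^sub>\<infinity>k\<in>int_tuples n. of_nat (card (labels n k \<omega>)) * \<eta> (\<lambda>i\<in>{..<n}. real_of_int (k i) / 2 - U \<omega>))"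
proof -
  \<comment> \<open>Exact rather than a rounding: \<open>2 * w (js i) \<omega>\<close> is an
    integer.\<close>
  define f where "f js = (\<lambda>i\<in>{..<n}. \<lfloor>2 * w (js i) \<omega>\<rfloor>)" for js :: "nat \<Rightarrow> int"
  define h where "h k = \<eta> (\<lambda>i\<in>{..<n}. real_of_int (k i) / 2 - U \<omega>)" for k :: "nat \<Rightarrow> int"
  have fl: "real_of_int \<lfloor>2 * w j \<omega>\<rfloor> / 2 = w j \<omega>" for j
  proof -
    obtain m where "w j \<omega> = real_of_int m / 2" using w_half_int[OF \<omega>] by blast
    then have "2 * w j \<omega> = real_of_int m" by simp
    then show ?thesis by (simp only: floor_of_int)
  qed
  have hf: "\<eta> (point_tuple n shifted \<omega> js) = h (f js)" for js
    unfolding h_def f_def point_tuple_def shifted_def by (intro arg_cong[where f = \<eta>]) (auto simp: fl)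
  have "w j \<omega> = real_of_int m / 2 \<longleftrightarrow> \<lfloor>2 * w j \<omega>\<rfloor> = m" for j m
    using fl[of j] by auto
  then have fib: "{js \<in> distinct_tuples n. f js = k} = labels n k \<omega>" if "k \<in> int_tuples n" for k
    using that by (auto simp: labels_def f_def PiE_iff extensional_def fun_eq_iff restrict_def)
  have f: "f js \<in> int_tuples n" for js by (simp add: f_def)
  have fin: "finite {js \<in> distinct_tuples n. f js = k}" if "k \<in> int_tuples n" for k
    using finite_labels[OF \<omega>] by (simp add: fib[OF that])
  show "(\<lambda>js. norm (\<eta> (point_tuple n shifted \<omega> js))) summable_on distinct_tuples n \<longleftrightarrow>
      (\<lambda>k. norm (of_nat (card (labels n k \<omega>)) * \<eta> (\<lambda>i\<in>{..<n}. real_of_int (k i) / 2 - U \<omega>))) summable_on int_tuples n"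
    using summable_on_fibres[of "distinct_tuples n" f "int_tuples n" h, OF f fin]
    unfolding hf h_def[symmetric] by (simp add: fib cong: summable_on_cong)
  show "(\<Sum>\<^sub>\<infinity>js\<in>distinct_tuples n. \<eta> (point_tuple n shifted \<omega> js)) =
      (\<Sum>\<^sub>\<infinity>k\<in>int_tuples n. of_nat (card (labels n k \<omega>)) * \<eta> (\<lambda>i\<in>{..<n}. real_of_int (k i) / 2 - U \<omega>))"
    using infsum_fibres[of "distinct_tuples n" f "int_tuples n" h, OF f fin]
    unfolding hf h_def[symmetric] by (simp add: fib cong: infsum_cong)
qed

lemma singleton_bounded_borel [simp]: "{x} \<in> bounded_borel"
  by (simp add: bounded_borel_def)

text \<open>The cardinality is replaced, almost surely, by the function \<open>\<psi>\<close> of the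
  counts so that independence applies, and then put back because its expectation is known.\<close>

lemma expectation_labels_indep:
  fixes \<zeta> :: "real \<Rightarrow> complex"
  assumes n: "n \<ge> 1" and [measurable]: "\<zeta> \<in> borel_measurable borel" and bd: "\<And>u. norm (\<zeta> u) \<le> C"
  shows "(LINT \<omega>|M. of_nat (card (labels n k \<omega>)) * \<zeta> (U \<omega>)) =
    (1/2) ^ n * of_real (sine_det n (\<lambda>i. real_of_int (k i) / 2)) * (LINT u|half_unif. \<zeta> u)"
proof -
  define \<psi> :: "(real set \<Rightarrow> nat) \<Rightarrow> complex" where
    "\<psi> c = (if inj_on k {..<n} \<and> (\<forall>i<n. 1 \<le> c {real_of_int (k i) / 2}) then 1 else 0)" for c
  have comp[measurable]: "(\<lambda>c. c {x}) \<in> measurable config_space (count_space UNIV)" for x :: real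
    unfolding config_space_def by (rule measurable_component_singleton) simp
  have [measurable]: "Measurable.pred config_space (\<lambda>c. 1 \<le> c {x})" for x :: real
    by (rule measurable_compose[OF comp]) simp
  have [measurable]: "\<psi> \<in> borel_measurable config_space"
    unfolding \<psi>_def by measurable
  have L: "has_bochner_integral M (\<lambda>\<omega>. real (card (labels n k \<omega>))) ((1/2) ^ n * sine_det n (\<lambda>i. real_of_int (k i) / 2))"
    using n by (rule expectation_card_labels)
  then have [measurable]: "(\<lambda>\<omega>. real (card (labels n k \<omega>))) \<in> borel_measurable M"
    by (auto simp: has_bochner_integral_iff)
  have "(\<lambda>\<omega>. complex_of_real (real (card (labels n k \<omega>)))) \<in> borel_measurable M"
    by measurable
  then have [measurable]: "(\<lambda>\<omega>. of_nat (card (labels n k \<omega>)) :: complex) \<in> borel_measurable M"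
    by simp
  have ae: "AE \<omega> in M. of_nat (card (labels n k \<omega>)) = \<psi> (counts w \<omega>)"
    using AE_inj AE_space
  proof eventually_elim
    case (elim \<omega>)
    show ?case unfolding card_labels_inj[OF elim(2,1)] \<psi>_def occ_def by simp
  qed
  have "(LINT \<omega>|M. of_nat (card (labels n k \<omega>)) * \<zeta> (U \<omega>)) = (LINT \<omega>|M. \<psi> (counts w \<omega>) * \<zeta> (U \<omega>))"
    using ae by (intro integral_cong_AE) auto
  also have "\<dots> = (LINT p|distr M (config_space \<Otimes>\<^sub>M borel) (\<lambda>\<omega>. (counts w \<omega>, U \<omega>)). \<psi> (fst p) * \<zeta> (snd p))"
    by (subst integral_distr) auto
  also have "\<dots> = (LINT c|config_law M w. (LINT u|half_unif. \<psi> c * \<zeta> u))"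
  proof -
    interpret c: prob_space "config_law M w"
      unfolding config_law_def by (rule prob_space_distr) simp
    interpret u: prob_space half_unif by (rule prob_space_half_unif)
    interpret cu: pair_prob_space "config_law M w" half_unif ..
    have sets: "sets (config_law M w \<Otimes>\<^sub>M half_unif) = sets (config_space \<Otimes>\<^sub>M borel)"
      by (simp add: config_law_def cong: sets_pair_measure_cong)
    have "(\<lambda>p. \<psi> (fst p) * \<zeta> (snd p)) \<in> borel_measurable (config_space \<Otimes>\<^sub>M borel)"
      by measurable
    then have "integrable (config_law M w \<Otimes>\<^sub>M half_unif) (\<lambda>p. \<psi> (fst p) * \<zeta> (snd p))"
      using bd order_trans[OF norm_ge_zero bd]
      by (intro cu.integrable_const_bound[where B = C]) (auto simp: \<psi>_def norm_mult measurable_cong_sets[OF sets])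
    then have "integrable (config_law M w \<Otimes>\<^sub>M half_unif) (\<lambda>(c, u). \<psi> c * \<zeta> u)"
      by (simp add: case_prod_unfold)
    from cu.integral_fst[OF this] show ?thesis
      unfolding config_law_def joint_law[of "\<lambda>c. c" config_space, OF measurable_ident_sets[OF refl]]
      by (simp add: case_prod_unfold)
  qed
  also have "\<dots> = (LINT c|config_law M w. \<psi> c) * (LINT u|half_unif. \<zeta> u)"
    by (simp only: integral_mult_left_zero integral_mult_right_zero)
  also have "(LINT c|config_law M w. \<psi> c) = (LINT \<omega>|M. \<psi> (counts w \<omega>))"
    unfolding config_law_def by (rule integral_distr) auto
  also have "(LINT \<omega>|M. \<psi> (counts w \<omega>)) = (LINT \<omega>|M. of_real (real (card (labels n k \<omega>))))"
    using ae by (intro integral_cong_AE) auto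
  also have "\<dots> = (1/2) ^ n * of_real (sine_det n (\<lambda>i. real_of_int (k i) / 2))"
    using L by (simp only: integral_complex_of_real has_bochner_integral_iff) simp
  finally show ?thesis .
qed

text \<open>Expectation and lattice sum are exchanged under absolute convergence: the decay of
  \<open>\<eta>\<close> controls the sum, and \<open>fact n\<close> bounds every determinant. The
  resulting sum is the one evaluated by \<open>K_class_lattice_average\<close>.\<close>

lemma K_class_expectation:
  assumes n: "n \<ge> 1" and \<eta>: "\<eta> \<in> K_class n"
  shows "AE \<omega> in M. (\<lambda>js. norm (\<eta> (point_tuple n shifted \<omega> js))) summable_on distinct_tuples n"
    and "has_bochner_integral M (\<lambda>\<omega>. \<Sum>\<^sub>\<infinity>js\<in>distinct_tuples n. \<eta> (point_tuple n shifted \<omega> js))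
       (LINT x|lborel_n n. \<eta> x * of_real (sine_det n x))"
proof -
  let ?e = "\<lambda>x. \<eta> (restrict x {..<n})"
  define \<zeta> where "\<zeta> k u = \<eta> (\<lambda>i\<in>{..<n}. real_of_int (k i) / 2 - u)" for k :: "nat \<Rightarrow> int" and u
  define g where "g k \<omega> = of_nat (card (labels n k \<omega>)) * \<zeta> k (U \<omega>)" for k \<omega>
  have S: "\<eta> \<in> schwartz n" using \<eta> by (simp add: K_class_def)
  obtain C where C: "\<And>x. norm (?e x) \<le> C * decay n x" using schwartz_decay[OF S] by blast
  have "0 \<le> C * decay n (\<lambda>_. 0)" using C norm_ge_zero order_trans by blast
  then have C0: "0 \<le> C" by (simp add: decay_def)
  \<comment> \<open>This crude bound holds for every shift and gives integrability; the summable
    bound \<open>b k\<close> is available for shifts in \<open>[0, 1/2)\<close>, hence almost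
    surely.\<close>
  have \<zeta>_bd: "norm (\<zeta> k u) \<le> C" for k u
    using C[of "\<lambda>i. real_of_int (k i) / 2 - u"] decay_le_1 C0 unfolding \<zeta>_def by (meson mult_left_le order_trans)
  have "continuous_on UNIV (\<lambda>u. ?e (\<lambda>i. real_of_int (k i) / 2 - u))" for k :: "nat \<Rightarrow> int"
    by (intro continuous_on_compose2[OF schwartz_continuous[OF S]] continuous_intros) auto
  then have \<zeta>_meas[measurable]: "\<zeta> k \<in> borel_measurable borel" for k
    unfolding \<zeta>_def by (intro borel_measurable_continuous_onI) simp
  define b where "b k = C * (3 ^ n * decay n (\<lambda>i. real_of_int (k i) / 2))" for k :: "nat \<Rightarrow> int"
  have \<zeta>_b: "norm (\<zeta> k u) \<le> b k" if "0 \<le> u \<and> u < 1/2" for k u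
  proof -
    have "norm (\<zeta> k u) \<le> C * decay n (\<lambda>i. real_of_int (k i) / 2 + - u)"
      using C[of "\<lambda>i. real_of_int (k i) / 2 - u"] by (simp add: \<zeta>_def)
    also have "\<dots> \<le> b k"
      unfolding b_def using that C0 by (intro mult_left_mono decay_shift) auto
    finally show ?thesis .
  qed
  have L: "integrable M (\<lambda>\<omega>. real (card (labels n k \<omega>)))"
    "(LINT \<omega>|M. real (card (labels n k \<omega>))) = (1/2) ^ n * sine_det n (\<lambda>i. real_of_int (k i) / 2)" for k
    using expectation_card_labels[OF n, of k] by (auto simp: has_bochner_integral_iff)
  have [measurable]: "(\<lambda>\<omega>. real (card (labels n k \<omega>))) \<in> borel_measurable M" for k
    using L(1)[of k] by auto
  have "(\<lambda>\<omega>. complex_of_real (real (card (labels n k \<omega>)))) \<in> borel_measurable M" for k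
    by measurable
  then have [measurable]: "(\<lambda>\<omega>. of_nat (card (labels n k \<omega>)) :: complex) \<in> borel_measurable M" for k
    by simp
  have gM[measurable]: "g k \<in> borel_measurable M" for k
    unfolding g_def by measurable
  have gI: "integrable M (g k)" for k
  proof (rule Bochner_Integration.integrable_bound)
    show "integrable M (\<lambda>\<omega>. C * real (card (labels n k \<omega>)))" using L by simp
    show "AE \<omega> in M. norm (g k \<omega>) \<le> norm (C * real (card (labels n k \<omega>)))"
      using \<zeta>_bd C0 by (intro AE_I2) (simp add: g_def norm_mult mult.commute mult_right_mono)
  qed measurable
  have g_le: "(LINT \<omega>|M. norm (g k \<omega>)) \<le> b k * fact n" for k
  proof -
    have b0: "0 \<le> b k" unfolding b_def using C0 decay_nonneg by (intro mult_nonneg_nonneg) auto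
    have "(LINT \<omega>|M. norm (g k \<omega>)) \<le> (LINT \<omega>|M. b k * real (card (labels n k \<omega>)))"
    proof (rule integral_mono_AE)
      show "AE \<omega> in M. norm (g k \<omega>) \<le> b k * real (card (labels n k \<omega>))"
        using AE_U
      proof eventually_elim
        case (elim \<omega>)
        then show ?case
          using mult_right_mono[OF \<zeta>_b[OF elim], of "real (card (labels n k \<omega>))" k]
          by (simp add: g_def norm_mult mult.commute)
      qed
    qed (use gI L in auto)
    also have "\<dots> = b k * ((1/2) ^ n * sine_det n (\<lambda>i. real_of_int (k i) / 2))"
      using L by simp
    also have "\<dots> \<le> b k * (1 * fact n)"
    proof -
      have "(1/2) ^ n * sine_det n (\<lambda>i. real_of_int (k i) / 2) \<le> (1/2) ^ n * fact n"
        using abs_le_D1[OF sine_det_bound] by (intro mult_left_mono) auto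
      also have "\<dots> \<le> 1 * fact n"
        by (intro mult_right_mono power_le_one) auto
      finally show ?thesis using b0 by (rule mult_left_mono)
    qed
    finally show ?thesis by simp
  qed
  have "(\<lambda>k. LINT \<omega>|M. norm (g k \<omega>)) summable_on int_tuples n"
  proof (rule summable_on_comparison_test)
    show "(\<lambda>k. b k * fact n) summable_on int_tuples n"
      unfolding b_def using decay_summable by (intro summable_on_cmult_left summable_on_cmult_right)
  qed (use g_le in auto)
  from has_bochner_integral_infsum[OF countable_int_tuples sigma_finite_measure_axioms gI this]
  have sum: "AE \<omega> in M. (\<lambda>k. norm (g k \<omega>)) summable_on int_tuples n"
    and int: "has_bochner_integral M (\<lambda>\<omega>. \<Sum>\<^sub>\<infinity>k\<in>int_tuples n. g k \<omega>) (\<Sum>\<^sub>\<infinity>k\<in>int_tuples n. LINT \<omega>|M. g k \<omega>)"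
    by auto
  show "AE \<omega> in M. (\<lambda>js. norm (\<eta> (point_tuple n shifted \<omega> js))) summable_on distinct_tuples n"
    using sum AE_space by eventually_elim (simp add: summable_labels g_def \<zeta>_def)
  have "(\<Sum>\<^sub>\<infinity>k\<in>int_tuples n. LINT \<omega>|M. g k \<omega>) = (\<Sum>\<^sub>\<infinity>k\<in>int_tuples n. (1/2) ^ n *
      (of_real (sine_det n (\<lambda>i. real_of_int (k i) / 2)) * (LINT u|half_unif. \<zeta> k u)))"
    unfolding g_def expectation_labels_indep[OF n \<zeta>_meas \<zeta>_bd] by (simp add: mult.assoc)
  also have "\<dots> = (LINT x|lborel_n n. \<eta> x * of_real (sine_det n x))"
    unfolding infsum_cmult_right' \<zeta>_def by (rule K_class_lattice_average[OF \<eta>])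
  finally show "has_bochner_integral M (\<lambda>\<omega>. \<Sum>\<^sub>\<infinity>js\<in>distinct_tuples n. \<eta> (point_tuple n shifted \<omega> js))
       (LINT x|lborel_n n. \<eta> x * of_real (sine_det n x))"
    using int by (simp add: infsum_labels g_def \<zeta>_def cong: has_bochner_integral_cong)
qed

end

section \<open>Translation invariance\<close>

lemma nn_integral_half_unif:
  assumes "h \<in> borel_measurable borel"
  shows "(\<integral>\<^sup>+u. h u \<partial>half_unif) = 2 * (\<integral>\<^sup>+u. h u * indicator {0..<1/2} u \<partial>lborel)"
  using assms unfolding half_unif_eq_density
  by (subst nn_integral_density) (auto simp: mult_ac nn_integral_cmult[symmetric])

text \<open>The integral over a full period does not depend on where the period starts.\<close>

lemma nn_integral_half_unif_periodic:
  assumes h[measurable]: "h \<in> borel_measurable borel"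
    and per: "\<And>v m. h (v + real_of_int m / 2) = h v"
  shows "(\<integral>\<^sup>+u. h (u - t) \<partial>half_unif) = (\<integral>\<^sup>+u. h u \<partial>half_unif)"
proof -
  \<comment> \<open>The remainder of \<open>t\<close> modulo 1/2, which has the same effect on
    \<open>h\<close> by periodicity.\<close>
  define s where "s = t - real_of_int \<lfloor>2 * t\<rfloor> / 2"
  have s: "0 \<le> s" "s < 1/2" unfolding s_def by linarith+
  have "h (u - t) = h (u - s)" for u
    using per[of "u - t" "\<lfloor>2 * t\<rfloor>"] by (simp add: s_def algebra_simps)
  then have "(\<integral>\<^sup>+u. h (u - t) * indicator {0..<1/2} u \<partial>lborel) = (\<integral>\<^sup>+u. h (u - s) * indicator {0..<1/2} u \<partial>lborel)"
    by simp
  also have "\<dots> = (\<integral>\<^sup>+v. h v * indicator {0..<1/2} (v + s) \<partial>lborel)"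
    by (subst nn_integral_real_affine[where c = 1 and t = s]) (auto simp: add.commute)
  \<comment> \<open>The interval is cut at 0, and its left part is then moved by one period to
    complete \<open>[0, 1/2)\<close>.\<close>
  also have "\<dots> = (\<integral>\<^sup>+v. h v * indicator {-s..<0} v + h v * indicator {0..<1/2-s} v \<partial>lborel)"
    using s by (intro nn_integral_cong) (auto split: split_indicator)
  also have "\<dots> = (\<integral>\<^sup>+v. h v * indicator {-s..<0} v \<partial>lborel) + (\<integral>\<^sup>+v. h v * indicator {0..<1/2-s} v \<partial>lborel)"
    by (intro nn_integral_add) auto
  also have "(\<integral>\<^sup>+v. h v * indicator {-s..<0} v \<partial>lborel) = (\<integral>\<^sup>+v. h v * indicator {1/2-s..<1/2} v \<partial>lborel)"
  proof -
    have "h (v - 1/2) = h v" for v using per[of v "-1"] by simp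
    then show ?thesis
      by (subst nn_integral_real_affine[where c = 1 and t = "-(1/2)"])
        (auto intro!: nn_integral_cong split: split_indicator)
  qed
  also have "(\<integral>\<^sup>+v. h v * indicator {1/2-s..<1/2} v \<partial>lborel) + (\<integral>\<^sup>+v. h v * indicator {0..<1/2-s} v \<partial>lborel) =
      (\<integral>\<^sup>+v. h v * indicator {1/2-s..<1/2} v + h v * indicator {0..<1/2-s} v \<partial>lborel)"
    by (intro nn_integral_add[symmetric]) auto
  also have "\<dots> = (\<integral>\<^sup>+v. h v * indicator {0..<1/2} v \<partial>lborel)"
    using s by (intro nn_integral_cong) (auto split: split_indicator)
  finally show ?thesis by (simp add: nn_integral_half_unif)
qed

section \<open>Occupation numbers and the counts they generate\<close>

abbreviation occ_space :: "(int \<Rightarrow> nat) measure" where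
  "occ_space \<equiv> (\<Pi>\<^sub>M a\<in>UNIV. count_space UNIV)"

text \<open>Rebuilds the counts of the shifted configuration from the occupation numbers and the
  shift, with no reference to labels.\<close>

definition shifted_counts :: "(int \<Rightarrow> nat) \<Rightarrow> real \<Rightarrow> real set \<Rightarrow> nat" where
  "shifted_counts x u = (\<lambda>B\<in>bounded_borel. \<Sum>a | real_of_int a / 2 - u \<in> B. x a)"

text \<open>Keeps the sum in \<open>shifted_counts\<close> finite; over an infinite index set it
  would default to 0.\<close>

lemma finite_half_ints_bounded:
  assumes "bounded B" shows "finite {a::int. real_of_int a / 2 - u \<in> B}"
proof -
  obtain C where C: "\<And>x. x \<in> B \<Longrightarrow> \<bar>x\<bar> \<le> C"
    using assms by (auto simp: bounded_iff)
  have "{a::int. real_of_int a / 2 - u \<in> B} \<subseteq> {\<lfloor>2 * (u - C)\<rfloor>..\<lceil>2 * (u + C)\<rceil>}"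
  proof
    fix a :: int assume "a \<in> {a. real_of_int a / 2 - u \<in> B}"
    then have "\<bar>real_of_int a / 2 - u\<bar> \<le> C" using C by auto
    then show "a \<in> {\<lfloor>2 * (u - C)\<rfloor>..\<lceil>2 * (u + C)\<rceil>}"
      by (simp add: floor_le_iff le_ceiling_iff) linarith
  qed
  then show ?thesis by (rule finite_subset) simp
qed

text \<open>Trades a half-integer shift of the line for a translation of the occupation numbers,
  under which the discrete law is invariant.\<close>

lemma shifted_counts_half_int:
  "shifted_counts x (u + real_of_int m / 2) = shifted_counts (\<lambda>a. x (a + m)) u"
  unfolding shifted_counts_def
proof (rule restrict_ext)
  fix B
  show "(\<Sum>a | real_of_int a / 2 - (u + real_of_int m / 2) \<in> B. x a) = (\<Sum>a | real_of_int a / 2 - u \<in> B. x (a + m))"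
  proof (rule sum.reindex_bij_witness[of _ "\<lambda>a. a + m" "\<lambda>a. a - m"])
    have eq: "real_of_int (a + m) / 2 - (u + real_of_int m / 2) = real_of_int a / 2 - u" for a
      by (simp add: field_simps)
    show "a + m \<in> {a. real_of_int a / 2 - (u + real_of_int m / 2) \<in> B}"
      if "a \<in> {a. real_of_int a / 2 - u \<in> B}" for a
      using that unfolding mem_Collect_eq eq .
    show "a - m \<in> {a. real_of_int a / 2 - u \<in> B}"
      if "a \<in> {a. real_of_int a / 2 - (u + real_of_int m / 2) \<in> B}" for a
      using that eq[of "a - m"] by (simp only: mem_Collect_eq diff_add_cancel)
  qed auto
qed

text \<open>Lets the measurability of a natural-number count be obtained from a limit of real
  functions.\<close>

lemma measurable_count_space_real:
  assumes "(\<lambda>p. real (f p)) \<in> borel_measurable N"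
  shows "f \<in> measurable N (count_space (UNIV :: nat set))"
proof (subst measurable_count_space_eq_countable)
  have "f -` {n} \<inter> space N = (\<lambda>p. real (f p)) -` {real n} \<inter> space N" for n by auto
  then show "f \<in> space N \<rightarrow> UNIV \<and> (\<forall>n\<in>UNIV. f -` {n} \<inter> space N \<in> sets N)"
    using measurable_sets[OF assms] by simp
qed simp

text \<open>The index set of the sum depends on the shift. Fixed ranges with an indicator avoid
  this, and the partial sums are eventually constant.\<close>

lemma shifted_counts_measurable:
  "(\<lambda>p. shifted_counts (fst p) (snd p)) \<in> measurable (occ_space \<Otimes>\<^sub>M borel) config_space"
  unfolding shifted_counts_def config_space_def
proof (rule measurable_restrict)
  fix B :: "real set" assume "B \<in> bounded_borel"
  then have B: "bounded B" and [measurable]: "B \<in> sets borel" by (auto simp: bounded_borel_def)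
  have occ[measurable]: "(\<lambda>x. x a) \<in> measurable occ_space (count_space UNIV)" for a
    by (rule measurable_component_singleton) simp
  show "(\<lambda>p. \<Sum>a | real_of_int a / 2 - snd p \<in> B. fst p a) \<in> measurable (occ_space \<Otimes>\<^sub>M borel) (count_space UNIV)"
  proof (rule measurable_count_space_real, rule borel_measurable_LIMSEQ_real)
    fix p :: "(int \<Rightarrow> nat) \<times> real"
    let ?A = "{a::int. real_of_int a / 2 - snd p \<in> B}"
    have fin: "finite ?A" using B by (rule finite_half_ints_bounded)
    \<comment> \<open>The largest modulus of a contributing index; inserting 0 covers the empty
      set.\<close>
    define N0 where "N0 = nat (Max (insert 0 (abs ` ?A)))"
    have N0: "\<bar>a\<bar> \<le> int N0" if "a \<in> ?A" for a
    proof -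
      have "\<bar>a\<bar> \<le> Max (insert 0 (abs ` ?A))" using fin that by (intro Max_ge) auto
      then show ?thesis unfolding N0_def by linarith
    qed
    have "(\<Sum>a\<in>{-int N..int N}. real (fst p a) * indicator B (real_of_int a / 2 - snd p)) =
       real (\<Sum>a\<in>?A. fst p a)" if "N0 \<le> N" for N
    proof -
      have "(\<Sum>a\<in>?A. real (fst p a)) = (\<Sum>a\<in>{-int N..int N}. real (fst p a) * indicator B (real_of_int a / 2 - snd p))"
      proof (rule sum.mono_neutral_cong_left)
        show "?A \<subseteq> {-int N..int N}"
          using N0 that by (fastforce simp: abs_le_iff)
      qed auto
      then show ?thesis by simp
    qed
    then show "(\<lambda>N. \<Sum>a\<in>{-int N..int N}. real (fst p a) * indicator B (real_of_int a / 2 - snd p))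
       \<longlonglongrightarrow> real (\<Sum>a\<in>?A. fst p a)"
      by (intro tendsto_eventually) (auto simp: eventually_sequentially)
  next
    fix N
    have [measurable]: "(\<lambda>p. real (fst p a)) \<in> borel_measurable (occ_space \<Otimes>\<^sub>M borel)" for a
      by (intro measurable_compose[OF measurable_compose[OF measurable_fst occ]]) simp
    show "(\<lambda>p. \<Sum>a\<in>{-int N..int N}. real (fst p a) * indicator B (real_of_int a / 2 - snd p))
       \<in> borel_measurable (occ_space \<Otimes>\<^sub>M borel)"
      by measurable
  qed
qed

text \<open>A coordinate event over \<open>bool\<close> is empty, full, \<open>y a\<close> or its
  complement, so the events that all of \<open>F\<close> is occupied generate everything.\<close>

lemma sets_PiM_bool:
  "sets (\<Pi>\<^sub>M a\<in>(UNIV::int set). count_space (UNIV::bool set)) =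
     sigma_sets UNIV {{y. \<forall>a\<in>F. y a} | F. finite F}"
proof -
  have "sets (\<Pi>\<^sub>M a\<in>(UNIV::int set). count_space (UNIV::bool set)) =
     sigma_sets UNIV {{y. y a \<in> A} | a (A :: bool set). True}"
    by (subst sets_PiM_single) simp
  also have "\<dots> = sigma_sets UNIV {{y. \<forall>a\<in>F. y a} | F. finite F}"
  proof (rule sigma_sets_eqI)
    fix S :: "(int \<Rightarrow> bool) set" assume "S \<in> {{y. y a \<in> A} | a (A :: bool set). True}"
    then obtain a A where S: "S = {y. y a \<in> A}" by blast
    have T: "{y. y a} \<in> sigma_sets UNIV {{y. \<forall>a\<in>F. y a} | F. finite F}"
      by (rule sigma_sets.Basic) (auto intro!: exI[of _ "{a}"])
    have F: "{y. \<not> y a} \<in> sigma_sets UNIV {{y. \<forall>a\<in>F. y a} | F. finite F}"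
      using sigma_sets.Compl[OF T] by (simp add: Compl_eq_Diff_UNIV[symmetric] Collect_neg_eq)
    have iff: "b \<in> A \<longleftrightarrow> (b \<and> True \<in> A) \<or> (\<not> b \<and> False \<in> A)" for b
      by (cases b) auto
    have "S = {y. (y a \<and> True \<in> A) \<or> (\<not> y a \<and> False \<in> A)}"
      unfolding S by (rule Collect_cong) (rule iff)
    then consider "S = {}" | "S = {y. y a}" | "S = {y. \<not> y a}" | "S = UNIV"
      by (cases "True \<in> A"; cases "False \<in> A") auto
    then show "S \<in> sigma_sets UNIV {{y. \<forall>a\<in>F. y a} | F. finite F}"
    proof cases
      case 1
      then show ?thesis by (simp only: sigma_sets.Empty)
    next
      case 4
      then show ?thesis by (simp only: sigma_sets_top)
    qed (use T F in \<open>simp_all only:\<close>)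
  next
    fix S :: "(int \<Rightarrow> bool) set" assume "S \<in> {{y. \<forall>a\<in>F. y a} | F. finite F}"
    then obtain F where F: "finite F" "S = {y. \<forall>a\<in>F. y a}" by blast
    interpret sigma_algebra UNIV "sigma_sets UNIV {{y. y a \<in> A} | (a::int) (A :: bool set). True}"
      by (rule sigma_algebra_sigma_sets) auto
    have "{y\<in>UNIV. \<forall>a\<in>F. y a} \<in> sigma_sets UNIV {{y. y a \<in> A} | (a::int) (A :: bool set). True}"
    proof (rule sets_Collect_finite_All)
      fix a :: int
      have "{y. y a \<in> {True}} \<in> sigma_sets UNIV {{y. y a \<in> A} | (a::int) (A :: bool set). True}"
        by (rule sigma_sets.Basic) blast
      then show "{y\<in>UNIV. y a} \<in> sigma_sets UNIV {{y. y a \<in> A} | (a::int) (A :: bool set). True}" by simp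
    qed fact
    then show "S \<in> sigma_sets UNIV {{y. y a \<in> A} | (a::int) (A :: bool set). True}" by (simp add: F)
  qed
  finally show ?thesis .
qed

section \<open>Invariance of the discrete law under half-integer shifts\<close>

context half_sine_process
begin

lemma occ_measurable [measurable]: "(\<lambda>\<omega>. occ \<omega> a) \<in> measurable M (count_space UNIV)"
proof -
  have "(\<lambda>c. c {real_of_int a / 2}) \<in> measurable config_space (count_space UNIV)"
    unfolding config_space_def by (rule measurable_component_singleton) (simp add: bounded_borel_def)
  from measurable_compose[OF counts_measurable this] show ?thesis by (simp add: occ_def)
qed

text \<open>For distinct sites, and almost surely, the cardinality of \<open>labels n k\<close> is
  the indicator of all these sites being occupied.\<close>

lemma prob_occ:
  assumes "n \<ge> 1" "inj_on k {..<n}"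
  shows "prob {\<omega>\<in>space M. \<forall>i<n. 1 \<le> occ \<omega> (k i)} = (1/2) ^ n * sine_det n (\<lambda>i. real_of_int (k i) / 2)"
proof -
  have L: "has_bochner_integral M (\<lambda>\<omega>. real (card (labels n k \<omega>))) ((1/2) ^ n * sine_det n (\<lambda>i. real_of_int (k i) / 2))"
    using assms(1) by (rule expectation_card_labels)
  have "AE \<omega> in M. real (card (labels n k \<omega>)) = indicator {\<omega>\<in>space M. \<forall>i<n. 1 \<le> occ \<omega> (k i)} \<omega>"
    using AE_inj AE_space
  proof eventually_elim
    case (elim \<omega>)
    then show ?case using assms(2) by (simp add: card_labels_inj indicator_def)
  qed
  then have "(LINT \<omega>|M. real (card (labels n k \<omega>))) = (LINT \<omega>|M. indicator {\<omega>\<in>space M. \<forall>i<n. 1 \<le> occ \<omega> (k i)} \<omega>)"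
    using L by (intro integral_cong_AE) (auto simp: has_bochner_integral_iff)
  then show ?thesis using L by (simp add: has_bochner_integral_iff)
qed

text \<open>Enumerating \<open>F\<close> expresses both probabilities by determinants, which
  \<open>sine_det_shift\<close> identifies.\<close>

lemma prob_occ_shift:
  assumes "finite F"
  shows "prob {\<omega>\<in>space M. \<forall>a\<in>F. 1 \<le> occ \<omega> (a + m)} = prob {\<omega>\<in>space M. \<forall>a\<in>F. 1 \<le> occ \<omega> a}"
proof (cases "F = {}")
  case False
  obtain k where k: "bij_betw k {0..<card F} F" using ex_bij_betw_nat_finite[OF assms] by blast
  define n where "n = card F"
  have k': "inj_on k {..<n}" "k ` {..<n} = F"
    using k by (auto simp: bij_betw_def n_def atLeast0LessThan)
  have n: "n \<ge> 1" using False assms by (auto simp: n_def Suc_le_eq card_gt_0_iff)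
  have inj: "inj_on (\<lambda>i. k i + m) {..<n}" using k'(1) by (auto simp: inj_on_def)
  have "{\<omega>\<in>space M. \<forall>a\<in>F. 1 \<le> occ \<omega> (a + m)} = {\<omega>\<in>space M. \<forall>i<n. 1 \<le> occ \<omega> (k i + m)}"
    unfolding k'(2)[symmetric] by auto
  moreover have "{\<omega>\<in>space M. \<forall>a\<in>F. 1 \<le> occ \<omega> a} = {\<omega>\<in>space M. \<forall>i<n. 1 \<le> occ \<omega> (k i)}"
    unfolding k'(2)[symmetric] by auto
  moreover have "sine_det n (\<lambda>i. real_of_int (k i + m) / 2) = sine_det n (\<lambda>i. real_of_int (k i) / 2)"
    using sine_det_shift[of n "\<lambda>i. real_of_int (k i) / 2" "real_of_int m / 2"] by (simp add: add_divide_distrib)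
  ultimately show ?thesis
    using prob_occ[OF n k'(1)] prob_occ[OF n inj] by simp
qed simp

abbreviation occ_bool_space :: "(int \<Rightarrow> bool) measure" where
  "occ_bool_space \<equiv> (\<Pi>\<^sub>M a\<in>UNIV. count_space UNIV)"

lemma occ_bool_law_shift:
  "distr M occ_bool_space (\<lambda>\<omega> a. 1 \<le> occ \<omega> (a + m)) = distr M occ_bool_space (\<lambda>\<omega> a. 1 \<le> occ \<omega> a)"
proof (rule measure_eqI_generator_eq[where \<Omega> = UNIV and E = "{{y. \<forall>a\<in>F. y a} | F :: int set. finite F}" and A = "\<lambda>_::nat. UNIV"])
  have meas: "(\<lambda>\<omega> a. 1 \<le> occ \<omega> (f a)) \<in> measurable M occ_bool_space" for f
    by (rule measurable_PiM_single') auto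
  show "Int_stable {{y. \<forall>a\<in>F. y a} | F :: int set. finite F}"
  proof (rule Int_stableI, safe)
    fix F G :: "int set" assume "finite F" "finite G"
    then show "\<exists>H. {y. \<forall>a\<in>F. y a} \<inter> {y. \<forall>a\<in>G. y a} = {y. \<forall>a\<in>H. y a} \<and> finite H"
      by (intro exI[of _ "F \<union> G"]) auto
  qed
  fix S :: "(int \<Rightarrow> bool) set" assume S: "S \<in> {{y. \<forall>a\<in>F. y a} | F. finite F}"
  then obtain F where F: "finite F" "S = {y. \<forall>a\<in>F. y a}" by blast
  have "S \<in> sets occ_bool_space" unfolding sets_PiM_bool using S by (rule sigma_sets.Basic)
  then have "emeasure (distr M occ_bool_space (\<lambda>\<omega> a. 1 \<le> occ \<omega> (f a))) S = prob {\<omega>\<in>space M. \<forall>a\<in>F. 1 \<le> occ \<omega> (f a)}" for f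
    using meas by (subst emeasure_distr) (auto simp: F emeasure_eq_measure intro!: arg_cong[where f = prob])
  from this[of "\<lambda>a. a + m"] this[of "\<lambda>a. a"]
  show "emeasure (distr M occ_bool_space (\<lambda>\<omega> a. 1 \<le> occ \<omega> (a + m))) S = emeasure (distr M occ_bool_space (\<lambda>\<omega> a. 1 \<le> occ \<omega> a)) S"
    using prob_occ_shift[OF F(1)] by simp
next
  \<comment> \<open>The empty \<open>F\<close> gives \<open>UNIV\<close>, so a constant sequence
    exhausts the space.\<close>
  show "range (\<lambda>_::nat. UNIV) \<subseteq> {{y. \<forall>a\<in>F. y a} | F :: int set. finite F}"
    by (auto intro!: exI[of _ "{}"])
  have "prob_space (distr M occ_bool_space (\<lambda>\<omega> a. 1 \<le> occ \<omega> (a + m)))"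
    by (rule prob_space_distr, rule measurable_PiM_single') auto
  then show "emeasure (distr M occ_bool_space (\<lambda>\<omega> a. 1 \<le> occ \<omega> (a + m))) UNIV \<noteq> \<infinity>"
    by (simp add: prob_space.emeasure_le_1[THEN order.trans] prob_space.finite_measure finite_measure.emeasure_finite)
qed (auto simp: sets_PiM_bool)

text \<open>Without double points the occupation numbers are 0 or 1, so \<open>of_bool\<close>
  recovers them from the boolean occupation, whose law is already known to be invariant.\<close>

lemma occ_law_shift:
  "distr M occ_space (\<lambda>\<omega> a. occ \<omega> (a + m)) = distr M occ_space (\<lambda>\<omega>. occ \<omega>)"
proof -
  have meas: "(\<lambda>\<omega> a. occ \<omega> (f a)) \<in> measurable M occ_space" for f
    by (rule measurable_PiM_single') auto
  have measb: "(\<lambda>\<omega> a. 1 \<le> occ \<omega> (f a)) \<in> measurable M occ_bool_space" for f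
    by (rule measurable_PiM_single') auto
  have measo: "(\<lambda>y a. of_bool (y a)) \<in> measurable occ_bool_space occ_space"
    by (rule measurable_PiM_single') auto
  have eq: "distr M occ_space (\<lambda>\<omega> a. occ \<omega> (f a)) =
     distr (distr M occ_bool_space (\<lambda>\<omega> a. 1 \<le> occ \<omega> (f a))) occ_space (\<lambda>y a. of_bool (y a))" for f
  proof -
    have "AE \<omega> in M. (\<lambda>a. occ \<omega> (f a)) = (\<lambda>a. of_bool (1 \<le> occ \<omega> (f a)))"
      using AE_inj AE_space
    proof eventually_elim
      case (elim \<omega>)
      have "occ \<omega> a \<le> 1" for a
      proof -
        have "card {j. w j \<omega> = real_of_int a / 2} \<le> 1"
        proof (cases "\<exists>j. w j \<omega> = real_of_int a / 2")
          case True
          then obtain j where "w j \<omega> = real_of_int a / 2" by blast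
          then have "{j. w j \<omega> = real_of_int a / 2} \<subseteq> {j}"
            using injD[OF elim(1)] by (metis (mono_tags) mem_Collect_eq singleton_iff subsetI)
          then show ?thesis using card_mono[of "{j}"] by simp
        next
          case False
          then have "{j. w j \<omega> = real_of_int a / 2} = {}" by blast
          then show ?thesis by (simp only: card.empty)
        qed
        then show ?thesis unfolding occ_eq .
      qed
      then show ?case by (auto simp: fun_eq_iff of_bool_def not_le intro: antisym)
    qed
    then have "distr M occ_space (\<lambda>\<omega> a. occ \<omega> (f a)) = distr M occ_space (\<lambda>\<omega> a. of_bool (1 \<le> occ \<omega> (f a)))"
      using meas measurable_compose[OF measb measo] by (intro distr_cong_AE) auto
    also have "\<dots> = distr (distr M occ_bool_space (\<lambda>\<omega> a. 1 \<le> occ \<omega> (f a))) occ_space (\<lambda>y a. of_bool (y a))"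
      using measb measo by (subst distr_distr) (auto simp: o_def)
    finally show ?thesis .
  qed
  show ?thesis
    using eq[of "\<lambda>a. a + m"] eq[of "\<lambda>a. a"] occ_bool_law_shift[of m] by simp
qed

end

section \<open>Invariance of the shifted process under real shifts\<close>

context half_sine_shift
begin

text \<open>The points in \<open>B\<close> split into disjoint groups by site. The identity holds at
  every sample point, so it transfers measurability to the shifted counts.\<close>

lemma counts_shifted:
  assumes \<omega>: "\<omega> \<in> space M"
  shows "counts (\<lambda>j \<omega>. shifted j \<omega> + t) \<omega> = shifted_counts (occ \<omega>) (U \<omega> - t)"
  unfolding counts_def shifted_counts_def
proof (rule restrict_ext)
  fix B :: "real set" assume "B \<in> bounded_borel"
  then have B: "bounded B" by (simp add: bounded_borel_def)
  let ?A = "{a::int. real_of_int a / 2 - (U \<omega> - t) \<in> B}"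
  let ?J = "\<lambda>a::int. {j. w j \<omega> = real_of_int a / 2}"
  have "{j. shifted j \<omega> + t \<in> B} = (\<Union>a\<in>?A. ?J a)"
  proof (intro equalityI subsetI)
    fix j assume j: "j \<in> {j. shifted j \<omega> + t \<in> B}"
    obtain a where a: "w j \<omega> = real_of_int a / 2" using w_half_int[OF \<omega>] by blast
    have "real_of_int a / 2 - (U \<omega> - t) = shifted j \<omega> + t" by (simp add: shifted_def a)
    with j have "a \<in> ?A" by (simp only: mem_Collect_eq)
    moreover have "j \<in> ?J a" using a by (simp only: mem_Collect_eq)
    ultimately show "j \<in> (\<Union>a\<in>?A. ?J a)" by (rule UN_I)
  next
    fix j assume "j \<in> (\<Union>a\<in>?A. ?J a)"
    then obtain a where "a \<in> ?A" "j \<in> ?J a" by (rule UN_E)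
    then have a: "w j \<omega> = real_of_int a / 2" "real_of_int a / 2 - (U \<omega> - t) \<in> B"
      by (simp_all only: mem_Collect_eq)
    have "shifted j \<omega> + t = real_of_int a / 2 - (U \<omega> - t)" by (simp add: shifted_def a)
    with a(2) show "j \<in> {j. shifted j \<omega> + t \<in> B}" by (simp only: mem_Collect_eq)
  qed
  also have "card (\<Union>a\<in>?A. ?J a) = (\<Sum>a\<in>?A. card (?J a))"
  proof (rule card_UN_disjoint)
    show "finite ?A" using B by (rule finite_half_ints_bounded)
    show "\<forall>a\<in>?A. finite (?J a)"
    proof
      fix a :: int
      have "finite {j. w j \<omega> \<in> {real_of_int a / 2}}" by (rule w_finite[OF \<omega>]) simp
      then show "finite (?J a)" by (simp only: singleton_iff)
    qed
    show "\<forall>a\<in>?A. \<forall>b\<in>?A. a \<noteq> b \<longrightarrow> ?J a \<inter> ?J b = {}" by auto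
  qed
  finally show "card {j. shifted j \<omega> + t \<in> B} = (\<Sum>a\<in>?A. occ \<omega> a)" by (simp only: occ_eq)
qed

lemma occ_all_measurable [measurable]: "occ \<in> measurable M occ_space"
  by (rule measurable_PiM_single') auto

lemma shifted_counts_diff_measurable [measurable]:
  "(\<lambda>p. shifted_counts (fst p) (snd p - t)) \<in> measurable (occ_space \<Otimes>\<^sub>M borel) config_space"
proof -
  have "(\<lambda>p. (fst p, snd p - t)) \<in> measurable (occ_space \<Otimes>\<^sub>M borel) (occ_space \<Otimes>\<^sub>M borel)"
    by measurable
  from measurable_compose[OF this shifted_counts_measurable] show ?thesis by simp
qed

lemma counts_shifted_measurable:
  "(\<lambda>\<omega>. shifted_counts (occ \<omega>) (U \<omega> - t)) \<in> measurable M config_space"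
proof -
  have "(\<lambda>\<omega>. (occ \<omega>, U \<omega>)) \<in> measurable M (occ_space \<Otimes>\<^sub>M borel)" by measurable
  from measurable_compose[OF this shifted_counts_diff_measurable] show ?thesis by simp
qed

lemma point_process_shifted: "point_process M shifted"
  unfolding point_process_def
proof (intro conjI ballI allI impI)
  fix \<omega> B assume \<omega>: "\<omega> \<in> space M" and B: "bounded (B :: real set)"
  have "y \<in> (\<lambda>x. x + U \<omega>) ` B \<longleftrightarrow> y - U \<omega> \<in> B" for y
    by (auto intro: rev_image_eqI[of "y - U \<omega>"])
  then have "{j. shifted j \<omega> \<in> B} = {j. w j \<omega> \<in> (\<lambda>x. x + U \<omega>) ` B}"
    by (simp add: shifted_def)
  moreover have "bounded ((\<lambda>x. x + U \<omega>) ` B)"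
    using bounded_translation[OF B, of "U \<omega>"] by (simp add: add.commute)
  ultimately show "finite {j. shifted j \<omega> \<in> B}" using w_finite[OF \<omega>] by simp
next
  have "counts shifted \<in> measurable M config_space \<longleftrightarrow>
      (\<lambda>\<omega>. shifted_counts (occ \<omega>) (U \<omega> - 0)) \<in> measurable M config_space"
    using counts_shifted[of _ 0] by (intro measurable_cong) (simp add: counts_def)
  then show "counts shifted \<in> measurable M config_space"
    using counts_shifted_measurable by blast
qed

text \<open>Given \<open>U = u\<close>, the law of the translate by \<open>t\<close> depends only on
  \<open>u - t\<close>. This dependence has period 1/2 because the occupation numbers are
  stationary, and a uniform average over one period absorbs \<open>t\<close>.\<close>

lemma translation_invariant_shifted: "translation_invariant M shifted"
proof -
  define PX where "PX = distr M occ_space occ"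
  have PX_sets[simp, measurable_cong]: "sets PX = sets occ_space" by (simp add: PX_def)
  interpret X: prob_space PX unfolding PX_def by (rule prob_space_distr) simp
  interpret u: prob_space half_unif by (rule prob_space_half_unif)
  interpret Xu: pair_prob_space PX half_unif ..
  have pair_sets: "sets (PX \<Otimes>\<^sub>M half_unif) = sets (occ_space \<Otimes>\<^sub>M borel)"
    by (simp cong: sets_pair_measure_cong)
  have joint: "distr M (occ_space \<Otimes>\<^sub>M borel) (\<lambda>\<omega>. (occ \<omega>, U \<omega>)) = PX \<Otimes>\<^sub>M half_unif"
  proof -
    have "(\<lambda>c a. c {real_of_int a / 2}) \<in> measurable config_space occ_space"
      unfolding config_space_def
      by (rule measurable_PiM_single') (auto intro!: measurable_component_singleton)
    from joint_law[OF this] show ?thesis by (simp add: occ_def[abs_def] PX_def)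
  qed
  have law: "emeasure (config_law M (\<lambda>j \<omega>. shifted j \<omega> + t)) A =
      (\<integral>\<^sup>+u. emeasure PX {x. shifted_counts x (u - t) \<in> A} \<partial>half_unif)"
    if [measurable]: "A \<in> sets config_space" for t A
  proof -
    let ?T = "\<lambda>p. shifted_counts (fst p) (snd p - t)"
    have T: "?T \<in> measurable (PX \<Otimes>\<^sub>M half_unif) config_space"
      using shifted_counts_diff_measurable by (simp add: measurable_cong_sets[OF pair_sets])
    have "config_law M (\<lambda>j \<omega>. shifted j \<omega> + t) = distr M config_space (\<lambda>\<omega>. shifted_counts (occ \<omega>) (U \<omega> - t))"
      unfolding config_law_def by (intro distr_cong counts_shifted) auto
    also have "\<dots> = distr (PX \<Otimes>\<^sub>M half_unif) config_space ?T"
      unfolding joint[symmetric] by (subst distr_distr) (auto simp: o_def)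
    finally have "emeasure (config_law M (\<lambda>j \<omega>. shifted j \<omega> + t)) A =
        emeasure (PX \<Otimes>\<^sub>M half_unif) (?T -` A \<inter> space (PX \<Otimes>\<^sub>M half_unif))"
      using T by (simp add: emeasure_distr)
    also have "\<dots> = (\<integral>\<^sup>+u. emeasure PX ((\<lambda>x. (x, u)) -` (?T -` A \<inter> space (PX \<Otimes>\<^sub>M half_unif))) \<partial>half_unif)"
      using measurable_sets[OF T that] by (rule Xu.emeasure_pair_measure_alt2)
    also have "\<dots> = (\<integral>\<^sup>+u. emeasure PX {x. shifted_counts x (u - t) \<in> A} \<partial>half_unif)"
      by (intro nn_integral_cong arg_cong2[where f = emeasure])
        (auto simp: space_pair_measure PX_def space_PiM)
    finally show ?thesis .
  qed
  have shift: "distr PX occ_space (\<lambda>x a. x (a + m)) = PX" for m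
  proof -
    have m: "(\<lambda>x a. x (a + m)) \<in> measurable occ_space occ_space"
      by (rule measurable_PiM_single') (auto intro!: measurable_component_singleton)
    then show ?thesis
      unfolding PX_def using occ_law_shift[of m] by (subst distr_distr) (auto simp: o_def)
  qed
  \<comment> \<open>The form \<open>+ 0\<close> lets \<open>law\<close> compute both sides.\<close>
  have "config_law M (\<lambda>j \<omega>. shifted j \<omega> + t) = config_law M (\<lambda>j \<omega>. shifted j \<omega> + 0)" for t
  proof (rule measure_eqI)
    fix A assume "A \<in> sets (config_law M (\<lambda>j \<omega>. shifted j \<omega> + t))"
    then have A[measurable]: "A \<in> sets config_space" by (simp add: config_law_def)
    define h where "h v = emeasure PX {x. shifted_counts x v \<in> A}" for v
    have slice: "{x. shifted_counts x v \<in> A} \<in> sets occ_space" for v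
    proof -
      have "(\<lambda>x. (x, v)) \<in> measurable occ_space (occ_space \<Otimes>\<^sub>M borel)" by measurable
      from measurable_sets[OF measurable_compose[OF this shifted_counts_measurable] A]
      show ?thesis by (simp add: vimage_def space_PiM)
    qed
    have "h \<in> borel_measurable half_unif"
    proof -
      let ?Q = "(\<lambda>p. shifted_counts (fst p) (snd p)) -` A \<inter> space (occ_space \<Otimes>\<^sub>M borel)"
      have "?Q \<in> sets (PX \<Otimes>\<^sub>M half_unif)"
        unfolding pair_sets by (rule measurable_sets[OF shifted_counts_measurable A])
      from Xu.measurable_emeasure_Pair2[OF this]
      have "(\<lambda>y. emeasure PX ((\<lambda>x. (x, y)) -` ?Q)) \<in> borel_measurable half_unif" .
      moreover have "(\<lambda>x. (x, y)) -` ?Q = {x. shifted_counts x y \<in> A}" for y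
        by (auto simp: space_pair_measure space_PiM)
      ultimately show ?thesis by (simp add: h_def[abs_def])
    qed
    then have h: "h \<in> borel_measurable borel" by simp
    have per: "h (v + real_of_int m / 2) = h v" for v m
    proof -
      have m: "(\<lambda>x a. x (a + m)) \<in> measurable PX occ_space"
        by (rule measurable_PiM_single') (auto intro!: measurable_component_singleton simp: measurable_cong_sets[OF PX_sets])
      have "h v = emeasure (distr PX occ_space (\<lambda>x a. x (a + m))) {x. shifted_counts x v \<in> A}"
        by (simp add: shift h_def)
      also have "\<dots> = emeasure PX {x. shifted_counts (\<lambda>a. x (a + m)) v \<in> A}"
        using m slice by (subst emeasure_distr) (auto simp: PX_def space_PiM intro!: arg_cong2[where f = emeasure])
      finally show ?thesis by (simp add: h_def shifted_counts_half_int)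
    qed
    show "emeasure (config_law M (\<lambda>j \<omega>. shifted j \<omega> + t)) A = emeasure (config_law M (\<lambda>j \<omega>. shifted j \<omega> + 0)) A"
      unfolding law[OF A] h_def[symmetric] nn_integral_half_unif_periodic[OF h per] ..
  qed (simp add: config_law_def)
  then show ?thesis by (simp add: translation_invariant_def)
qed

lemma simple_shifted: "simple_process M shifted"
  unfolding simple_process_def using AE_inj
  by eventually_elim (auto simp: shifted_def inj_def)

text \<open>\<open>U\<close> cancels in differences of points, which leaves differences of
  half-integers.\<close>

lemma shifted_separated:
  assumes "\<omega> \<in> space M" "shifted i \<omega> \<noteq> shifted j \<omega>"
  shows "\<bar>shifted i \<omega> - shifted j \<omega>\<bar> \<in> {real m / 2 | m :: nat. m \<ge> 1}"
proof -
  obtain a b where ab: "w i \<omega> = real_of_int a / 2" "w j \<omega> = real_of_int b / 2"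
    using w_half_int[OF assms(1)] by metis
  then have "a \<noteq> b" using assms(2) by (auto simp: shifted_def)
  moreover have "\<bar>shifted i \<omega> - shifted j \<omega>\<bar> = \<bar>real_of_int (a - b)\<bar> / 2"
    by (simp add: shifted_def ab abs_divide flip: diff_divide_distrib)
  ultimately show ?thesis by (auto intro!: exI[of _ "nat \<bar>a - b\<bar>"])
qed

end

theorem theorem4p7:
  fixes M :: "'a measure"
    and w :: "int \<Rightarrow> 'a \<Rightarrow> real"
    and U :: "'a \<Rightarrow> real"
    and w' :: "int \<Rightarrow> 'a \<Rightarrow> real"
  assumes "prob_space M"
    and "half_discrete_sine_process M w"
    and "U \<in> borel_measurable M"
    and "distr M borel U = uniform_measure lborel {0..<1/2}"
    and "prob_space.indep_set M
           {counts w -` A \<inter> space M | A. A \<in> sets config_space}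
           {U -` B \<inter> space M | B. B \<in> sets borel}"
  defines "w' \<equiv> \<lambda>j \<omega>. w j \<omega> - U \<omega>"
  shows "point_process M w' \<and>
    simple_process M w' \<and>
    translation_invariant M w' \<and>
    (\<forall>n\<ge>1. \<forall>\<eta>\<in>K_class n.
       (AE \<omega> in M. (\<lambda>js. norm (\<eta> (point_tuple n w' \<omega> js))) summable_on distinct_tuples n) \<and>
       has_bochner_integral M
         (\<lambda>\<omega>. \<Sum>\<^sub>\<infinity>js\<in>distinct_tuples n. \<eta> (point_tuple n w' \<omega> js))
         (LINT x|lborel_n n. \<eta> x * of_real (sine_det n x))) \<and>
    (\<forall>\<omega>\<in>space M. \<forall>i j. w' i \<omega> \<noteq> w' j \<omega> \<longrightarrow>
       \<bar>w' i \<omega> - w' j \<omega>\<bar> \<in> {real m / 2 | m :: nat. m \<ge> 1})"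
proof -
  interpret prob_space M by fact
  interpret half_sine_shift M w U
    by unfold_locales fact+
  have "w' = shifted" by (intro ext) (simp add: w'_def shifted_def)
  then show ?thesis
    by (intro conjI allI ballI impI)
      (simp_all only: point_process_shifted simple_shifted translation_invariant_shifted
        K_class_expectation shifted_separated not_False_eq_True)
qed

end
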